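(* Let $(X_t)_{t\ge 0}$ be a discrete time Markov chain on a state space $\mathcal{X}$ with (unique) stationary distribution $\pi$, and let $\theta:\mathcal{X}\to\mathbb{R}$ be any (measurable) observable quantity. For some fixed probability measure $\nu$ on $\mathcal{X}$, assume that $(X_t)$ is equipped with a sequence $0=T_0<T_1<T_2<\cdots$ of $\nu$-regeneration times such that the tours $(X_t)_{T_{k-1}\le t<T_k}$, $k\ge 1$, are iid (in particular, $X_0\sim\nu$). Write $T=T_1$, and assume that for some fixed positive constants $B,\gamma$, $$\mathbf{P}(T>t)\le Be^{-\gamma t}\qquad\text{for all } t\ge 0.$$ Fix an integer $K\ge 1$ and let $n=T_K$. Let $W_k=T_k-T_{k-1}$ for $1\le k\le K$, let $M=\max(W_1,\ldots,W_K)$, and for each integer $j\ge 0$ let $m_j=\#\{1\le k\le K: W_k>j\}$. Let $$\hat{\pi}_n(\theta\le x)=\frac1n\sum_{t=0}^{n-1}\mathbf{1}\{\theta(X_t)\le x\}$$ be the empirical CDF of $\theta$ given the sample path $(X_0,\ldots,X_{n-1})$. Then, for every $\delta>0$, with probability at least $1-\delta$ we have $$\begin{aligned}\sup_{x\in\mathbb{R}}\left|\hat{\pi}_n(\theta\le x)-\pi(\theta\le x)\right|\le{}&\frac{1}{\sqrt{2n}}\sum_{j=0}^{M-1}\sqrt{\frac{m_j}{n}\log\left(\frac{6n}{\delta m_j}\right)\wedge\frac{2m_j^2}{n}}+\frac{\sqrt{K}}{n}\cdot\frac{M}{\sqrt{\delta/3}}\\&+\frac{2}{n\sqrt{\delt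a/3}}\left(\frac{\log(BK)}{\gamma}\sqrt{\log\left(\frac{3}{\delta}\right)}+\frac{1}{1-e^{-\gamma/2}}\right).\end{aligned}$$
   Context: For a probability measure $\nu$ on $\mathcal{X}$, a $\nu$-regeneration time for the chain $(X_t)$ is a random time $T$ such that $X_T\sim\nu$ and, moreover, $X_T$ is independent of the value of $T$ and of the history $(X_t)_{t<T}$. The tours $(X_t)_{T_{k-1}\le t<T_k}$ are regarded as random finite sequences (so iid refers jointly to the length $W_k=T_k-T_{k-1}$ and the states visited); each tour has length at least $1$. The notation $a\wedge b$ means $\min(a,b)$; it is taken inside the square root, of the two quantities $\frac{m_j}{n}\log(\frac{6n}{\delta m_j})$ and $\frac{2m_j^2}{n}$. Note that $n$, $M$ and the $m_j$ are random, while $K$ is fixed. $\pi(\theta\le x)$ denotes $\pi(\{y\in\mathcal{X}:\theta(y)\le x\})$. For $\delta\ge1$ the assertion is vacuous. *)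

theory Defs
  imports "HOL-Probability.Probability"
begin

section \<open>Markov chains and stationary distributions\<close>

definition natural_filtration ::
  "'w measure \<Rightarrow> 'x measure \<Rightarrow> (nat \<Rightarrow> 'w \<Rightarrow> 'x) \<Rightarrow> nat \<Rightarrow> 'w measure" where
  "natural_filtration P S X t =
     sigma (space P) (\<Union>i\<in>{..t}. sets (vimage_algebra (space P) (X i) S))"

definition markov_chain ::
  "'w measure \<Rightarrow> 'x measure \<Rightarrow> ('x \<Rightarrow> 'x measure) \<Rightarrow> (nat \<Rightarrow> 'w \<Rightarrow> 'x) \<Rightarrow> bool" where
  "markov_chain P S \<kappa> X \<longleftrightarrow>
     \<kappa> \<in> S \<rightarrow>\<^sub>M prob_algebra S \<and>
     (\<forall>t. X t \<in> P \<rightarrow>\<^sub>M S) \<and>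
     (\<forall>t. \<forall>A\<in>sets S. AE \<omega> in P.
        real_cond_exp P (natural_filtration P S X t) (indicator (X (Suc t) -` A \<inter> space P)) \<omega>
          = measure (\<kappa> (X t \<omega>)) A)"

definition stationary_distribution ::
  "'x measure \<Rightarrow> ('x \<Rightarrow> 'x measure) \<Rightarrow> 'x measure \<Rightarrow> bool" where
  "stationary_distribution S \<kappa> \<pi> \<longleftrightarrow>
     \<pi> \<in> space (prob_algebra S) \<and> (\<pi> \<bind> \<kappa>) = \<pi>"

section \<open>Random finite sequences, regeneration times and tours\<close>

text \<open>
  The measurable space of finite sequences of elements of \<open>S\<close>, i.e. the disjoint union over
  \<open>n\<close> of the \<open>n\<close>-fold products of \<open>S\<close>.  Its generators \<open>listset [A\<^sub>0, \<dots>, A\<^sub>n]\<close> are the measurable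
  rectangles \<open>A\<^sub>0 \<times> \<dots> \<times> A\<^sub>n\<close>.  The length is a measurable function on this space.
\<close>

definition finseq_space :: "'x measure \<Rightarrow> 'x list measure" where
  "finseq_space S = sigma (lists (space S)) (listset ` lists (sets S))"

definition path_segment :: "(nat \<Rightarrow> 'w \<Rightarrow> 'x) \<Rightarrow> ('w \<Rightarrow> nat) \<Rightarrow> ('w \<Rightarrow> nat) \<Rightarrow> 'w \<Rightarrow> 'x list" where
  "path_segment X \<sigma> \<tau> \<omega> = map (\<lambda>t. X t \<omega>) [\<sigma> \<omega>..<\<tau> \<omega>]"

text \<open>
  Independence is phrased via the generated sigma-algebras, since \<open>indep_var\<close> requires both
  random variables to have the same type.
\<close>

definition regeneration_time ::
  "'w measure \<Rightarrow> 'x measure \<Rightarrow> 'x measure \<Rightarrow> (nat \<Rightarrow> 'w \<Rightarrow> 'x) \<Rightarrow> ('w \<Rightarrow> nat) \<Rightarrow> bool" where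
  "regeneration_time P S \<nu> X \<tau> \<longleftrightarrow>
     \<tau> \<in> P \<rightarrow>\<^sub>M count_space UNIV \<and>
     distr P S (\<lambda>\<omega>. X (\<tau> \<omega>) \<omega>) = \<nu> \<and>
     prob_space.indep_set P
       (sets (vimage_algebra (space P) (\<lambda>\<omega>. X (\<tau> \<omega>) \<omega>) S))
       (sets (vimage_algebra (space P) (\<lambda>\<omega>. (\<tau> \<omega>, path_segment X (\<lambda>_. 0) \<tau> \<omega>))
                (count_space UNIV \<Otimes>\<^sub>M finseq_space S)))"

text \<open>Tours are numbered from 1; the value at index 0 is irrelevant.\<close>

definition tour :: "(nat \<Rightarrow> 'w \<Rightarrow> 'x) \<Rightarrow> (nat \<Rightarrow> 'w \<Rightarrow> nat) \<Rightarrow> nat \<Rightarrow> 'w \<Rightarrow> 'x list" where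
  "tour X T k = path_segment X (T (k - 1)) (T k)"

definition iid_tours ::
  "'w measure \<Rightarrow> 'x measure \<Rightarrow> (nat \<Rightarrow> 'w \<Rightarrow> 'x) \<Rightarrow> (nat \<Rightarrow> 'w \<Rightarrow> nat) \<Rightarrow> bool" where
  "iid_tours P S X T \<longleftrightarrow>
     prob_space.indep_vars P (\<lambda>_. finseq_space S) (tour X T) {1..} \<and>
     (\<forall>k\<ge>1. distr P (finseq_space S) (tour X T k) = distr P (finseq_space S) (tour X T 1))"

definition tour_length :: "(nat \<Rightarrow> 'w \<Rightarrow> nat) \<Rightarrow> nat \<Rightarrow> 'w \<Rightarrow> nat" where
  "tour_length T k \<omega> = T k \<omega> - T (k - 1) \<omega>"

definition max_tour_length :: "(nat \<Rightarrow> 'w \<Rightarrow> nat) \<Rightarrow> nat \<Rightarrow> 'w \<Rightarrow> nat" where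
  "max_tour_length T K \<omega> = Max ((\<lambda>k. tour_length T k \<omega>) ` {1..K})"

definition num_longer_tours :: "(nat \<Rightarrow> 'w \<Rightarrow> nat) \<Rightarrow> nat \<Rightarrow> nat \<Rightarrow> 'w \<Rightarrow> nat" where
  "num_longer_tours T K j \<omega> = card {k \<in> {1..K}. tour_length T k \<omega> > j}"

section \<open>Empirical and true distribution function of an observable\<close>

definition empirical_cdf ::
  "('x \<Rightarrow> real) \<Rightarrow> (nat \<Rightarrow> 'w \<Rightarrow> 'x) \<Rightarrow> nat \<Rightarrow> 'w \<Rightarrow> real \<Rightarrow> real" where
  "empirical_cdf \<theta> X n \<omega> x = (1 / real n) * (\<Sum>t<n. of_bool (\<theta> (X t \<omega>) \<le> x))"

definition observable_cdf :: "'x measure \<Rightarrow> ('x \<Rightarrow> real) \<Rightarrow> real \<Rightarrow> real" where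
  "observable_cdf \<pi> \<theta> x = measure \<pi> {y \<in> space \<pi>. \<theta> y \<le> x}"

end

theory Submission
  imports Defs
begin

text \<open>
  By Kac's formula the mean occupation measure of a tour, divided by the mean tour length, is
  stationary. Since \<open>T\<close> need not be a stopping time, this is deduced from the law of large numbers
  for iid tours together with \<open>E 1\<^sub>A(X\<^sub>t\<^sub>+\<^sub>1) = E \<kappa>(X\<^sub>t, A)\<close>. Hence \<open>n\<close> times the deviation of the
  empirical CDF is a centred sum over tours, which is rearranged by the position \<open>j\<close> inside the
  tours. Write \<open>s = 3 / \<delta>\<close> and let \<open>q\<close> be the least \<open>j\<close> with \<open>K P(W > j) \<le> ln s\<close>.

  For \<open>j < q\<close>, given the set of tours longer than \<open>j\<close>, the states at position \<open>j\<close> of these tours are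
  iid, so the fourth moment of their Kolmogorov statistic \<open>D\<^sub>j\<close> is at most \<open>4 m\<^sub>j\<^sup>2\<close>. As
  \<open>D\<^sub>j \<le> (m\<^sub>j / 2)\<^sup>1\<^sup>/\<^sup>2 + D\<^sub>j\<^sup>2 / (8 m\<^sub>j)\<^sup>1\<^sup>/\<^sup>2\<close>, where the first summand is dominated by the
  \<open>j\<close>-th term of the first sum in the theorem (because \<open>ln 6 \<ge> 1\<close>), a second-moment estimate
  absorbs the second summand and the fluctuations of \<open>m\<^sub>j\<close> into the term
  \<open>(K s)\<^sup>1\<^sup>/\<^sup>2 M\<close>, with failure probability \<open>\<delta> / 2\<close>. The events \<open>M < q\<close> and
  \<open>m\<^sub>q \<ge> s + 5 / 4\<close> have probability at most \<open>\<delta> / 3\<close> and \<open>\<delta> / 6\<close>; outside of them the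
  positions \<open>j \<ge> q\<close> are harmless as well. The last term of the theorem bounds
  \<open>K \<Sum>\<^sub>j\<^sub>\<ge>\<^sub>q P(W > j)\<close>. For \<open>K \<le> s\<close> the bound is at least \<open>1\<close>.
\<close>

section \<open>Maxima of random walk bridges\<close>

text \<open>No exponential inequality of Dvoretzky-Kiefer-Wolfowitz type is used. Of the minimum
  under the square root only the lower bound \<open>m_j / n\<close> is needed, so each
  \<open>D_j\<close> has to be controlled only up to its typical size, the square root of
  \<open>m_j\<close>. The excess over it is of order \<open>D_j^2 / sqrt m_j\<close>, and a
  second-moment estimate squares it; this is why fourth moments appear. Averaging
  \<open>4 m_j^2 / m_j\<close> gives at most \<open>4 K\<close>. The constant 4 is combinatorial: an
  independent second sample symmetrises the statistic, and for a random split of the pooled sample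
  it is dominated by the maximum of a simple random walk bridge. The truncation level
  \<open>q\<close> must be deterministic, because moments are summed over \<open>j < q\<close>; on
  the good event \<open>q \<le> M\<close>, so that \<open>q\<close> positions below and
  \<open>M - q\<close> positions above it together pay for the \<open>M\<close> term. The good event
  depends on the finite set of levels \<open>x\<close> considered, but its probability bound does
  not. This permits the passage to all rational levels by continuity of measure, and to all reals by
  right-continuity.\<close>

definition walk_height :: "bool list \<Rightarrow> int" where
  "walk_height bs = (\<Sum>b\<leftarrow>bs. if b then 1 else - 1)"

lemma walk_height_simps [simp]:
  "walk_height [] = 0" "walk_height (b # bs) = (if b then 1 else - 1) + walk_height bs"
  by (auto simp: walk_height_def)

lemma finite_bool_lists: "finite {bs::bool list. length bs = n}"
  by (rule finite_subset[OF _ finite_lists_length_eq[of "UNIV :: bool set" n]]) auto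

text \<open>
  The reflection bound. Removing the first step replaces \<open>(u, d, h)\<close> by \<open>(u - 1, d, h - 1)\<close> or
  \<open>(u, d - 1, h + 1)\<close>, so the two bounds add up by Pascal's rule.
\<close>

lemma card_walks_reaching:
  fixes u d h :: nat
  assumes "u \<le> d + h"
  shows "card {bs. length bs = u + d \<and> count_list bs True = u \<and>
                   (\<exists>r. int h \<le> walk_height (take r bs))} \<le> (u + d) choose (d + h)"
  using assms
proof (induction "u + d" arbitrary: u d h)
  case 0
  then show ?case
    by (cases h) (auto simp: card_le_Suc0_iff_eq)
next
  case (Suc n)
  let ?S = "\<lambda>u d h. {bs. length bs = u + d \<and> count_list bs True = u \<and>
                   (\<exists>r. int h \<le> walk_height (take r bs))}"
  have fin: "finite (?S u d h)" for u d h
    by (rule finite_subset[OF _ finite_bool_lists[of "u + d"]]) auto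
  define St where "St = (if u = 0 then {} else (#) True ` ?S (u - 1) d (h - 1))"
  define Sf where "Sf = (if d = 0 then {} else (#) False ` ?S u (d - 1) (h + 1))"
  have fin_union: "finite (St \<union> Sf)"
    unfolding St_def Sf_def by (auto simp only: finite_Un finite.emptyI split: if_split intro!: finite_imageI fin)
  show ?case
  \<comment> \<open>Height 0 is reached by the empty prefix, so here all arrangements count; they
    are coded by the positions of their up steps. This case stays apart because \<open>h - 1\<close>
    would not be a genuine decrease.\<close>
  proof (cases "h = 0")
    case True
    have "card (?S u d h) \<le> card {A. A \<subseteq> {..<u + d} \<and> card A = u}"
    proof (rule card_inj_on_le)
      show "inj_on (\<lambda>bs. {i. i < length bs \<and> bs ! i}) (?S u d h)"
      proof (rule inj_onI)
        fix x y assume "x \<in> ?S u d h" "y \<in> ?S u d h"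
          and eq: "{i. i < length x \<and> x ! i} = {i. i < length y \<and> y ! i}"
        then have "length x = length y" by auto
        moreover have "x ! i = y ! i" if "i < length x" for i
          using eq that \<open>length x = length y\<close> by (auto simp: set_eq_iff)
        ultimately show "x = y" by (rule nth_equalityI)
      qed
      have card_eq: "card {i. i < length bs \<and> bs ! i} = count_list bs True" for bs
        by (induction bs rule: rev_induct)
          (auto simp: nth_append less_Suc_eq conj_disj_distribR Collect_disj_eq
            cong: conj_cong)
      show "(\<lambda>bs. {i. i < length bs \<and> bs ! i}) ` ?S u d h
          \<subseteq> {A. A \<subseteq> {..<u + d} \<and> card A = u}"
      proof (intro image_subsetI CollectI conjI)
        fix bs assume "bs \<in> ?S u d h"
        then show "{i. i < length bs \<and> bs ! i} \<subseteq> {..<u + d}"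
            "card {i. i < length bs \<and> bs ! i} = u"
          unfolding card_eq by auto
      qed
      show "finite {A. A \<subseteq> {..<u + d} \<and> card A = u}"
        by (rule finite_subset[of _ "Pow {..<u + d}"]) auto
    qed
    also have "\<dots> = (u + d) choose u"
      using n_subsets[of "{..<u + d}" u] by simp
    also have "\<dots> = (u + d) choose (d + h)"
      using True binomial_symmetric[of u "u + d"] by simp
    finally show ?thesis .
  next
    case False
    have "?S u d h \<subseteq> St \<union> Sf"
    proof
      fix bs assume bs: "bs \<in> ?S u d h"
      then obtain r where r: "int h \<le> walk_height (take r bs)" by auto
      obtain b cs where bcs: "bs = b # cs" using bs Suc.hyps(2) by (cases bs) auto
      obtain r' where r': "r = Suc r'" using r False by (cases r) auto
      show "bs \<in> St \<union> Sf"
      proof (cases b)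
        case True
        have "u \<noteq> 0" using bs bcs True by auto
        moreover have "cs \<in> ?S (u - 1) d (h - 1)"
          using bs bcs True r r' False \<open>u \<noteq> 0\<close> by (auto intro!: exI[of _ r'])
        ultimately show ?thesis using True bcs by (auto simp: St_def)
      next
        case False
        have "d \<noteq> 0"
        proof
          assume "d = 0"
          then have "count_list cs True = Suc (length cs)" using bs bcs False by auto
          then show False using count_le_length[of cs True] by simp
        qed
        moreover have "cs \<in> ?S u (d - 1) (h + 1)"
          using bs bcs False r r' \<open>d \<noteq> 0\<close> by (auto intro!: exI[of _ r'])
        ultimately show ?thesis using False bcs by (auto simp: Sf_def)
      qed
    qed
    then have "card (?S u d h) \<le> card (St \<union> Sf)"
      by (rule card_mono[OF fin_union])
    also have "\<dots> \<le> card St + card Sf" by (rule card_Un_le)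
    also have "card St \<le> n choose (d + h - 1)"
    proof (cases "u = 0")
      case True then show ?thesis by (simp add: St_def)
    next
      case u: False
      have "card St \<le> card (?S (u - 1) d (h - 1))"
        unfolding St_def if_not_P[OF u] by (rule card_image_le[OF fin])
      also have "\<dots> \<le> (u - 1 + d) choose (d + (h - 1))"
        by (rule Suc.hyps(1)) (use Suc.hyps(2) Suc.prems u False in auto)
      also have "u - 1 + d = n" using Suc.hyps(2) u by simp
      finally show ?thesis using False by simp
    qed
    also have "card Sf \<le> n choose (d + h)"
    proof (cases "d = 0")
      case True then show ?thesis by (simp add: Sf_def)
    next
      case d: False
      have "card Sf \<le> card (?S u (d - 1) (h + 1))"
        unfolding Sf_def if_not_P[OF d] by (rule card_image_le[OF fin])
      also have "\<dots> \<le> (u + (d - 1)) choose ((d - 1) + (h + 1))"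
        by (rule Suc.hyps(1)) (use Suc.hyps(2) Suc.prems d in auto)
      also have "u + (d - 1) = n" using Suc.hyps(2) d by simp
      finally show ?thesis using d by simp
    qed
    also have "(n choose (d + h - 1)) + (n choose (d + h)) = Suc n choose (d + h)"
      using False by (cases "d + h") auto
    finally show ?thesis using Suc.hyps(2) by simp
  qed
qed

text \<open>The recurrence \<open>(m + h + 1) * c (h + 1) = (m - h) * c h\<close> for
  \<open>c h = 2 * m choose (m + h)\<close> makes odd moments telescope. The cube is the weight that
  occurs when a fourth moment is written as a sum over the levels reached.\<close>

lemma cubed_central_binomial_sum:
  "(\<Sum>h=1..m. real h ^ 3 * real (2 * m choose (m + h))) = real m ^ 2 / 2 * real (2 * m choose m)"
proof -
  define c where "c h = real (2 * m choose (m + h))" for h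
  have rec: "(real m + real h + 1) * c (Suc h) = (real m - real h) * c h" if "h \<le> m" for h
  proof -
    have "Suc (m + h) * (2 * m choose Suc (m + h)) = (2 * m - (m + h)) * (2 * m choose (m + h))"
      by (metis binomial_absorb_comp binomial_absorption mult.commute Suc_times_binomial_add
          choose_mult_lemma binomial_fact_lemma)
    then have "real (Suc (m + h)) * c (Suc h) = real (2 * m - (m + h)) * c h"
      unfolding c_def by (metis add_Suc_right of_nat_mult)
    then show ?thesis using that by (simp add: of_nat_diff algebra_simps)
  qed
  have top: "c (Suc m) = 0" by (simp add: c_def)
  define t where "t h = (real m + real h) * c h" for h
  \<comment> \<open>chosen so that \<open>T h - T (h + 1) = (h\<^sup>3 - m h) c h\<close>\<close>
  define T where "T h = (real h ^ 2 - real h) / 2 * t h" for h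
  have tS: "t (Suc h) = (real m - real h) * c h" if "h \<le> m" for h
    using rec[OF that] by (simp add: t_def algebra_simps)
  have tel: "sum (\<lambda>h. f h - f (Suc h)) {1..m} = f 1 - f (Suc m)" for f :: "nat \<Rightarrow> real"
    by (induction m) (auto simp: algebra_simps)
  \<comment> \<open>Here \<open>t h - t (Suc h) = 2 * h * c h\<close>, so the first moment
    telescopes to \<open>t 1 / 2\<close>, and \<open>t 1 = m * c 0\<close>.\<close>
  have 1: "(\<Sum>h=1..m. real h * c h) = real m / 2 * c 0"
  proof -
    have "(\<Sum>h=1..m. real h * c h) = (\<Sum>h=1..m. t h / 2 - t (Suc h) / 2)"
      by (intro sum.cong refl) (auto simp: tS, simp add: t_def field_simps)
    also have "\<dots> = t 1 / 2 - t (Suc m) / 2" using tel[of "\<lambda>h. t h / 2"] by simp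
    also have "\<dots> = real m / 2 * c 0" using tS[of 0] top by (simp add: t_def)
    finally show ?thesis .
  qed
  have "(\<Sum>h=1..m. real h ^ 3 * c h) = (\<Sum>h=1..m. real m * (real h * c h) + (T h - T (Suc h)))"
    by (intro sum.cong refl)
      (auto simp: T_def tS, simp add: t_def field_simps power2_eq_square power3_eq_cube)
  also have "\<dots> = real m * (\<Sum>h=1..m. real h * c h) + (T 1 - T (Suc m))"
    by (simp only: sum.distrib sum_distrib_left[symmetric] tel)
  also have "\<dots> = real m ^ 2 / 2 * c 0"
    using top unfolding 1 by (simp add: T_def t_def power2_eq_square)
  finally show ?thesis by (simp add: c_def)
qed

text \<open>A layer-cake estimate. The weights \<open>4 * h ^ 3\<close> replace the exact increments
  \<open>h ^ 4 - (h - 1) ^ 4\<close>, so that the closed form of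
  \<open>cubed_central_binomial_sum\<close> applies directly; the loss is that the sum equals
  \<open>(a * (a + 1))^2\<close> rather than \<open>a ^ 4\<close>.\<close>

lemma sum_cubes_indicator_ge:
  fixes a m :: nat
  assumes "a \<le> m"
  shows "real a ^ 4 \<le> (\<Sum>h=1..m. 4 * real h ^ 3 * of_bool (h \<le> a))"
proof -
  have "(\<Sum>h=1..n. 4 * real h ^ 3) = (real n * (real n + 1)) ^ 2" for n
    by (induction n) (auto simp: power2_eq_square power3_eq_cube algebra_simps)
  then have "(\<Sum>h=1..a. 4 * real h ^ 3) = (real a * (real a + 1)) ^ 2" by simp
  moreover have "real a ^ 4 = (real a * real a) ^ 2" by (simp add: power_def)
  moreover have "(real a * real a) ^ 2 \<le> (real a * (real a + 1)) ^ 2"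
    by (intro power_mono mult_left_mono) auto
  moreover have "(\<Sum>h=1..m. 4 * real h ^ 3 * of_bool (h \<le> a)) = (\<Sum>h=1..a. 4 * real h ^ 3)"
    by (intro sum.mono_neutral_cong_right) (use assms in auto)
  ultimately show ?thesis by simp
qed

lemma takeWhile_eq_filter_sorted:
  fixes z :: "'i \<Rightarrow> 'b::linorder"
  assumes "sorted (map z xs)"
  shows "takeWhile (\<lambda>i. z i \<le> x) xs = filter (\<lambda>i. z i \<le> x) xs"
  using assms
proof (induction xs)
  case (Cons a xs)
  have "\<not> z i \<le> x" if "i \<in> set xs" "\<not> z a \<le> x" for i
    using Cons.prems that by auto
  then have "\<not> z a \<le> x \<Longrightarrow> filter (\<lambda>i. z i \<le> x) xs = []"
    by (simp add: filter_empty_conv)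
  then show ?case using Cons by simp
qed simp

text \<open>Listing \<open>I\<close> in increasing order of \<open>z\<close> turns a split into a
  walk of \<open>2 * m\<close> steps, up for members of \<open>A\<close> and down for the others,
  which ends at 0. The statistic is an absolute height of this walk, so at most
  \<open>2 * (2 * m choose (m + h))\<close> splits reach level \<open>h\<close>, and summing over
  levels gives the fourth moment.\<close>

lemma balanced_split_max_bound:
  fixes z :: "'i \<Rightarrow> real" and V :: "real set"
  assumes I: "finite I" "card I = 2 * m" and V: "finite V" "V \<noteq> {}"
  shows "(\<Sum>A | A \<subseteq> I \<and> card A = m.
            (Max ((\<lambda>x. \<bar>(\<Sum>i\<in>A. of_bool (z i \<le> x)) - (\<Sum>i\<in>I - A. of_bool (z i \<le> x))\<bar>) ` V)) ^ 4)
          \<le> 4 * real m ^ 2 * real (2 * m choose m)"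
proof -
  define F where "F = {A. A \<subseteq> I \<and> card A = m}"
  have finF: "finite F" unfolding F_def using I by auto
  define N :: "'i set \<Rightarrow> real \<Rightarrow> int" where
    "N A x = (\<Sum>i\<in>A. of_bool (z i \<le> x)) - (\<Sum>i\<in>I - A. of_bool (z i \<le> x))" for A x
  define D where "D A = Max ((\<lambda>x. nat \<bar>N A x\<bar>) ` V)" for A
  have N_real: "\<bar>(\<Sum>i\<in>A. of_bool (z i \<le> x)) - (\<Sum>i\<in>I - A. of_bool (z i \<le> x))\<bar>
      = real (nat \<bar>N A x\<bar>)" for A x
    by (simp add: N_def)
  have D_real: "Max ((\<lambda>x. \<bar>(\<Sum>i\<in>A. of_bool (z i \<le> x)) - (\<Sum>i\<in>I - A. of_bool (z i \<le> x))\<bar>) ` V)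
      = real (D A)" for A
    unfolding N_real D_def
    using V by (subst mono_Max_commute[where f = real]) (auto simp: mono_def image_image)
  have D_le: "D A \<le> m" if "A \<in> F" for A
  proof -
    have "nat \<bar>N A x\<bar> \<le> m" for x
    proof -
      have A: "A \<subseteq> I" "card A = m" "finite A"
        using that I finite_subset by (auto simp: F_def)
      then have A': "card (I - A) = m" using I by (simp add: card_Diff_subset)
      have *: "0 \<le> (\<Sum>i\<in>C. of_bool (z i \<le> x) :: int)" "(\<Sum>i\<in>C. of_bool (z i \<le> x) :: int) \<le> int (card C)" for C
        using sum_mono[of C "\<lambda>i. of_bool (z i \<le> x) :: int" "\<lambda>_. 1"] by (auto intro: sum_nonneg)
      show ?thesis using *[of A] *[of "I - A"] A(2) A' unfolding N_def by linarith
    qed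
    then show ?thesis unfolding D_def using V by (subst Max_le_iff) auto
  qed
  obtain ys where ys: "set ys = I" "distinct ys"
    using finite_distinct_list[OF I(1)] by blast
  define xs where "xs = sort_key z ys"
  have xs: "set xs = I" "distinct xs" "sorted (map z xs)" "length xs = 2 * m"
    using ys I distinct_card[of ys] by (auto simp: xs_def)
  define sg where "sg A = map (\<lambda>i. i \<in> A) xs" for A
  have len: "length (sg A) = m + m" for A using xs by (simp add: sg_def)
  have cnt: "count_list (sg A) True = m" if "A \<subseteq> I" "card A = m" for A
  proof -
    have "count_list (sg A) True = length (filter (\<lambda>i. i \<in> A) xs)"
      unfolding sg_def by (induction xs) auto
    also have "\<dots> = card (set xs \<inter> A)"
      using xs(2) by (metis distinct_card distinct_filter inter_set_filter Int_commute)
    also have "set xs \<inter> A = A" using xs(1) that by auto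
    finally show ?thesis using that by simp
  qed
  have inj: "inj_on sg (Pow I)"
    unfolding sg_def by (rule inj_onI) (use xs(1) in \<open>unfold map_eq_conv, blast\<close>)
  have ht: "walk_height (take r (sg A)) = (\<Sum>i\<in>set (take r xs). if i \<in> A then 1 else - 1)" for r A
    using xs(2) by (simp add: sg_def walk_height_def take_map sum_list_distinct_conv_sum_set o_def)
  \<comment> \<open>In sorted order every sublevel set of \<open>z\<close> is a prefix. Ties only
    make some prefixes unattainable, which is harmless for an upper bound.\<close>
  have prefix: "\<exists>r. N A x = walk_height (take r (sg A))" if "A \<subseteq> I" for A x
  proof
    let ?r = "length (takeWhile (\<lambda>i. z i \<le> x) xs)"
    have "takeWhile (\<lambda>i. z i \<le> x) xs = filter (\<lambda>i. z i \<le> x) xs"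
      using xs(3) by (rule takeWhile_eq_filter_sorted)
    then have "set (take ?r xs) = {i \<in> I. z i \<le> x}"
      using xs(1) set_filter[of "\<lambda>i. z i \<le> x" xs]
        takeWhile_eq_take[of "\<lambda>i. z i \<le> x" xs, symmetric] by simp
    then have "walk_height (take ?r (sg A)) = (\<Sum>i | i \<in> I \<and> z i \<le> x. if i \<in> A then 1 else - 1)"
      unfolding ht by simp
    also have "\<dots> = (\<Sum>i\<in>I. if z i \<le> x then if i \<in> A then 1 else - 1 else 0)"
      using I by (simp add: sum.inter_filter)
    also have "\<dots> = (\<Sum>i\<in>A. if z i \<le> x then if i \<in> A then 1 else - 1 else 0)
        + (\<Sum>i\<in>I - A. if z i \<le> x then if i \<in> A then 1 else - 1 else 0)"
      using sum.subset_diff[OF that I(1)] by (simp add: add.commute)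
    also have "\<dots> = (\<Sum>i\<in>A. of_bool (z i \<le> x)) + (\<Sum>i\<in>I - A. - of_bool (z i \<le> x))"
      by (intro arg_cong2[where f = "(+)"] sum.cong) auto
    also have "\<dots> = N A x" by (simp add: N_def sum_negf)
    finally show "N A x = walk_height (take ?r (sg A))" ..
  qed
  \<comment> \<open>Exchanging the halves reflects the walk, so low minima are counted by the same
    bound as high maxima.\<close>
  have neg: "- walk_height (take r (sg A)) = walk_height (take r (sg (I - A)))" for A r
    unfolding ht sum_negf[symmetric]
    by (intro sum.cong refl) (use xs(1) in \<open>auto dest: in_set_takeD\<close>)
  define W where "W h = {bs. length bs = m + m \<and> count_list bs True = m \<and>
                   (\<exists>r. int h \<le> walk_height (take r bs))}" for h
  have finW: "finite (W h)" for h
    by (rule finite_subset[OF _ finite_bool_lists[of "m + m"]]) (auto simp: W_def)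
  have count: "card {A \<in> F. h \<le> D A} \<le> 2 * (2 * m choose (m + h))" for h
  proof -
    let ?U = "{A \<in> F. \<exists>r. int h \<le> walk_height (take r (sg A))}"
    let ?L = "{A \<in> F. \<exists>r. int h \<le> - walk_height (take r (sg A))}"
    have "{A \<in> F. h \<le> D A} \<subseteq> ?U \<union> ?L"
    proof
      fix A assume "A \<in> {A \<in> F. h \<le> D A}"
      then have A: "A \<in> F" "h \<le> D A" by auto
      have "D A \<in> (\<lambda>x. nat \<bar>N A x\<bar>) ` V" unfolding D_def using V by (intro Max_in) auto
      then obtain x where "D A = nat \<bar>N A x\<bar>" by auto
      moreover obtain r where "N A x = walk_height (take r (sg A))"
        using prefix[of A x] A by (auto simp: F_def)
      ultimately have "int h \<le> walk_height (take r (sg A)) \<or> int h \<le> - walk_height (take r (sg A))"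
        using A by linarith
      then show "A \<in> ?U \<union> ?L" using A by blast
    qed
    then have "card {A \<in> F. h \<le> D A} \<le> card (?U \<union> ?L)"
      using finF by (intro card_mono) auto
    also have "\<dots> \<le> card ?U + card ?L" by (rule card_Un_le)
    also have "card ?U \<le> card (W h)"
    proof (rule card_inj_on_le[of sg])
      show "inj_on sg ?U" by (rule inj_on_subset[OF inj]) (auto simp: F_def)
      show "sg ` ?U \<subseteq> W h" using len cnt by (auto simp: W_def F_def)
    qed (rule finW)
    also have "card ?L \<le> card (W h)"
    proof (rule card_inj_on_le[of "\<lambda>A. sg (I - A)"])
      show "inj_on (\<lambda>A. sg (I - A)) ?L"
      proof (rule inj_onI)
        fix A A' assume "A \<in> ?L" "A' \<in> ?L" "sg (I - A) = sg (I - A')"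
        then have "I - A = I - A'" "A \<subseteq> I" "A' \<subseteq> I"
          using inj_onD[OF inj, of "I - A" "I - A'"] by (auto simp: F_def)
        then show "A = A'" by blast
      qed
      have "sg (I - A) \<in> W h" if "A \<in> ?L" for A
      proof -
        have A: "A \<subseteq> I" "card A = m" using that by (auto simp: F_def)
        then have "card (I - A) = m" using I by (simp add: card_Diff_subset finite_subset)
        then show ?thesis using that len cnt[of "I - A"] neg by (auto simp: W_def)
      qed
      then show "(\<lambda>A. sg (I - A)) ` ?L \<subseteq> W h" by blast
    qed (rule finW)
    also have "card (W h) \<le> (m + m) choose (m + h)"
      unfolding W_def by (rule card_walks_reaching) simp
    finally show ?thesis by (simp add: mult_2)
  qed
  have "(\<Sum>A\<in>F. real (D A) ^ 4) \<le> (\<Sum>A\<in>F. \<Sum>h=1..m. 4 * real h ^ 3 * of_bool (h \<le> D A))"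
    by (intro sum_mono sum_cubes_indicator_ge D_le)
  also have "\<dots> = (\<Sum>h=1..m. 4 * real h ^ 3 * real (card {A \<in> F. h \<le> D A}))"
    using finF by (subst sum.swap) (simp add: sum_distrib_left[symmetric] Int_def)
  also have "\<dots> \<le> (\<Sum>h=1..m. 4 * real h ^ 3 * real (2 * (2 * m choose (m + h))))"
    by (intro sum_mono mult_left_mono of_nat_mono count) auto
  also have "\<dots> = 8 * (\<Sum>h=1..m. real h ^ 3 * real (2 * m choose (m + h)))"
    by (simp add: sum_distrib_left mult.assoc mult.left_commute)
  also have "\<dots> = 4 * real m ^ 2 * real (2 * m choose m)"
    unfolding cubed_central_binomial_sum by simp
  finally show ?thesis unfolding F_def[symmetric] D_real .
qed

section \<open>Fourth moments of Kolmogorov statistics\<close>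

text \<open>Jensen's inequality for the fourth power, by using non-negativity of the variance for
  \<open>X\<close> and then for its square; boundedness supplies integrability.\<close>

lemma (in prob_space) expectation_power4_ge:
  fixes X :: "'a \<Rightarrow> real"
  assumes [measurable]: "X \<in> borel_measurable M" and "\<And>\<omega>. \<bar>X \<omega>\<bar> \<le> c"
  shows "expectation X ^ 4 \<le> expectation (\<lambda>\<omega>. X \<omega> ^ 4)"
proof -
  have sq: "(expectation Y)\<^sup>2 \<le> expectation (\<lambda>\<omega>. (Y \<omega>)\<^sup>2)"
    if [measurable]: "Y \<in> borel_measurable M" and b: "\<And>\<omega>. \<bar>Y \<omega>\<bar> \<le> b" for Y :: "'a \<Rightarrow> real" and b
  proof -
    have "integrable M Y" by (rule integrable_const_bound[of _ b]) (use b in auto)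
    moreover have "integrable M (\<lambda>\<omega>. (Y \<omega>)\<^sup>2)"
    proof (rule integrable_const_bound[of _ "b\<^sup>2"])
      have "(Y \<omega>)\<^sup>2 \<le> b\<^sup>2" for \<omega> using power_mono[OF b[of \<omega>], of 2] by simp
      then show "AE \<omega> in M. norm ((Y \<omega>)\<^sup>2) \<le> b\<^sup>2" by simp
    qed simp
    ultimately show ?thesis using variance_eq[of Y] variance_positive[of Y] by simp
  qed
  have "expectation X ^ 4 = ((expectation X)\<^sup>2)\<^sup>2" by simp
  also have "\<dots> \<le> (expectation (\<lambda>\<omega>. (X \<omega>)\<^sup>2))\<^sup>2"
    by (intro power_mono sq[OF assms]) simp
  also have "\<dots> \<le> expectation (\<lambda>\<omega>. ((X \<omega>)\<^sup>2)\<^sup>2)"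
  proof (rule sq)
    show "\<bar>(X \<omega>)\<^sup>2\<bar> \<le> c\<^sup>2" for \<omega> using power_mono[OF assms(2)[of \<omega>], of 2] by simp
  qed simp
  finally show ?thesis by simp
qed

text \<open>
  By Jensen's inequality the deviation from the mean may be replaced by the deviation from an
  independent second sample. The pooled sample is exchangeable, so one may average over all ways
  to split it into halves and apply the walk estimate pointwise.
\<close>

lemma product_empirical_fourth_moment:
  fixes \<mu> :: "real measure" and A :: "nat set" and V :: "real set"
  assumes "prob_space \<mu>" and [measurable_cong, simp]: "sets \<mu> = sets borel"
    and A: "finite A" and V: "finite V" "V \<noteq> {}"
  shows "(\<integral>\<^sup>+ z. ennreal ((Max ((\<lambda>x. \<bar>\<Sum>k\<in>A. of_bool (z k \<le> x) - measure \<mu> {..x}\<bar>) ` V)) ^ 4)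
            \<partial>PiM A (\<lambda>_. \<mu>)) \<le> ennreal (4 * (real (card A))\<^sup>2)"
proof -
  define m where "m = card A"
  interpret \<mu>: prob_space \<mu> by fact
  interpret prod: product_prob_space "\<lambda>_::nat. \<mu>" by standard
  have space_\<mu>[simp]: "space \<mu> = UNIV" using sets_eq_imp_space_eq[of \<mu> borel] by simp
  \<comment> \<open>Fresh indices for the second sample: both samples become coordinates of one
    product over \<open>I\<close>, whose law is invariant under permutations of
    \<open>I\<close>.\<close>
  obtain A' where A': "finite A'" "card A' = m" "A' \<subseteq> UNIV - A"
    using infinite_arbitrarily_large[of "UNIV - A" m] A by (auto simp: infinite_UNIV_nat)
  define I where "I = A \<union> A'"
  have I: "finite I" "A \<subseteq> I" "I - A = A'" "A \<inter> A' = {}"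
    using A A' by (auto simp: I_def)
  then have card_I: "card I = 2 * m"
    using A A' by (simp add: I_def m_def card_Un_disjoint)
  define U :: "nat set \<Rightarrow> (nat \<Rightarrow> real) \<Rightarrow> real" where "U C z = Max ((\<lambda>x. \<bar>(\<Sum>i\<in>C. of_bool (z i \<le> x)) - (\<Sum>i\<in>I - C. of_bool (z i \<le> x))\<bar>) ` V)"
    for C and z :: "nat \<Rightarrow> real"
  have U_meas: "(\<lambda>z. U C z) \<in> borel_measurable (PiM I (\<lambda>_. \<mu>))" if "C \<subseteq> I" for C
    unfolding U_def
  proof (intro borel_measurable_Max V borel_measurable_abs borel_measurable_diff borel_measurable_sum)
    fix x i assume "i \<in> C" with that have [measurable]: "(\<lambda>z. z i) \<in> measurable (PiM I (\<lambda>_. \<mu>)) \<mu>"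
      by (intro measurable_component_singleton) auto
    show "(\<lambda>z. of_bool (z i \<le> x)) \<in> borel_measurable (PiM I (\<lambda>_. \<mu>))" by measurable
  next
    fix x i assume "i \<in> I - C" with that have [measurable]: "(\<lambda>z. z i) \<in> measurable (PiM I (\<lambda>_. \<mu>)) \<mu>"
      by (intro measurable_component_singleton) auto
    show "(\<lambda>z. of_bool (z i \<le> x)) \<in> borel_measurable (PiM I (\<lambda>_. \<mu>))" by measurable
  qed
  have ge_U: "\<bar>(\<Sum>i\<in>C. of_bool (z i \<le> x)) - (\<Sum>i\<in>I - C. of_bool (z i \<le> x))\<bar> \<le> U C z"
    if "x \<in> V" for x C z
    unfolding U_def using V that by (intro Max_ge) auto
  have U_bound: "0 \<le> U A z" "U A z \<le> real m" for z
  proof -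
    obtain x where "x \<in> V" using V by auto
    show "0 \<le> U A z" using ge_U[OF \<open>x \<in> V\<close>, of z A] by linarith
    have *: "0 \<le> (\<Sum>i\<in>C. of_bool (z i \<le> x) :: real)" "(\<Sum>i\<in>C. of_bool (z i \<le> x) :: real) \<le> real (card C)" for C x
      using sum_mono[of C "\<lambda>i. of_bool (z i \<le> x) :: real" "\<lambda>_. 1"] by (auto intro: sum_nonneg)
    have "\<bar>(\<Sum>i\<in>A. of_bool (z i \<le> x)) - (\<Sum>i\<in>A'. of_bool (z i \<le> x))\<bar> \<le> real m" for x
      using *[of x A] *[of x A'] A' by (auto simp: m_def)
    then show "U A z \<le> real m" unfolding U_def I(3) using V by (subst Max_le_iff) auto
  qed
  let ?D = "\<lambda>z. Max ((\<lambda>x. \<bar>\<Sum>k\<in>A. of_bool (z k \<le> x) - measure \<mu> {..x}\<bar>) ` V)"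
  interpret PA': prob_space "PiM A' (\<lambda>_. \<mu>)" by (rule prob_space_PiM) (rule assms(1))
  \<comment> \<open>The centring term is the mean count in the second sample. So the mean of
    \<open>U\<close> dominates the deviation at every level in \<open>V\<close>, hence their
    maximum, and the fourth power is moved inside only afterwards.\<close>
  have ghost: "ennreal (?D z ^ 4) \<le> (\<integral>\<^sup>+ y. ennreal (U A (merge A A' (z, y)) ^ 4) \<partial>PiM A' (\<lambda>_. \<mu>))"
    if z: "z \<in> space (PiM A (\<lambda>_. \<mu>))" for z
  proof -
    have [measurable]: "(\<lambda>y. U A (merge A A' (z, y))) \<in> borel_measurable (PiM A' (\<lambda>_. \<mu>))"
      using U_meas[of A] z I unfolding I_def by measurable
    let ?E = "PA'.expectation (\<lambda>y. U A (merge A A' (z, y)))"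
    have int: "integrable (PiM A' (\<lambda>_. \<mu>)) (\<lambda>y. U A (merge A A' (z, y)))"
      by (rule PA'.integrable_const_bound[of _ "real m"]) (use U_bound in auto)
    have "\<bar>\<Sum>k\<in>A. of_bool (z k \<le> x) - measure \<mu> {..x}\<bar> \<le> ?E" if "x \<in> V" for x
    proof -
      let ?c = "\<Sum>k\<in>A. of_bool (z k \<le> x) :: real"
      have comp: "integrable (PiM A' (\<lambda>_. \<mu>)) (\<lambda>y. of_bool (y i \<le> x) :: real)"
          "PA'.expectation (\<lambda>y. of_bool (y i \<le> x)) = measure \<mu> {..x}" if "i \<in> A'" for i
      proof -
        have [measurable]: "(\<lambda>y. y i) \<in> measurable (PiM A' (\<lambda>_. \<mu>)) \<mu>"
          using that by (intro measurable_component_singleton)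
        show "integrable (PiM A' (\<lambda>_. \<mu>)) (\<lambda>y. of_bool (y i \<le> x) :: real)"
          by (rule PA'.integrable_const_bound[of _ 1]) auto
        have "distr (PiM A' (\<lambda>_. \<mu>)) \<mu> (\<lambda>y. y i) = \<mu>"
          using that \<mu>.prob_space_axioms by (intro distr_PiM_component) auto
        then have "measure \<mu> {..x} = measure (distr (PiM A' (\<lambda>_. \<mu>)) \<mu> (\<lambda>y. y i)) {..x}" by simp
        also have "\<dots> = measure (PiM A' (\<lambda>_. \<mu>)) ((\<lambda>y. y i) -` {..x} \<inter> space (PiM A' (\<lambda>_. \<mu>)))"
          by (rule measure_distr) auto
        also have "\<dots> = PA'.expectation (indicator ((\<lambda>y. y i) -` {..x} \<inter> space (PiM A' (\<lambda>_. \<mu>))))"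
          by simp
        also have "\<dots> = PA'.expectation (\<lambda>y. of_bool (y i \<le> x))"
          by (rule Bochner_Integration.integral_cong) (auto simp: indicator_def)
        finally show "PA'.expectation (\<lambda>y. of_bool (y i \<le> x)) = measure \<mu> {..x}" ..
      qed
      have "(\<Sum>k\<in>A. of_bool (z k \<le> x) - measure \<mu> {..x}) = ?c - real m * measure \<mu> {..x}"
        by (simp add: sum_subtractf m_def)
      also have "\<dots> = PA'.expectation (\<lambda>y. ?c - (\<Sum>i\<in>A'. of_bool (y i \<le> x)))"
        using comp A' by (simp add: PA'.prob_space del: sum_of_bool_eq)
      finally have "\<bar>\<Sum>k\<in>A. of_bool (z k \<le> x) - measure \<mu> {..x}\<bar>
          = \<bar>PA'.expectation (\<lambda>y. ?c - (\<Sum>i\<in>A'. of_bool (y i \<le> x)))\<bar>" by simp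
      also have "\<dots> \<le> PA'.expectation (\<lambda>y. \<bar>?c - (\<Sum>i\<in>A'. of_bool (y i \<le> x))\<bar>)"
        by (rule integral_abs_bound)
      also have "\<dots> \<le> ?E"
      proof (rule integral_mono)
        show "integrable (PiM A' (\<lambda>_. \<mu>)) (\<lambda>y. \<bar>?c - (\<Sum>i\<in>A'. of_bool (y i \<le> x))\<bar>)"
          using comp by (intro integrable_abs Bochner_Integration.integrable_diff Bochner_Integration.integrable_sum) auto
        fix y
        have "(\<Sum>i\<in>A. of_bool (merge A A' (z, y) i \<le> x) :: real) = ?c"
          by (intro sum.cong) (auto simp: merge_def)
        moreover have "(\<Sum>i\<in>A'. of_bool (merge A A' (z, y) i \<le> x) :: real) = (\<Sum>i\<in>A'. of_bool (y i \<le> x))"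
          by (intro sum.cong) (use I in \<open>auto simp: merge_def\<close>)
        ultimately show "\<bar>?c - (\<Sum>i\<in>A'. of_bool (y i \<le> x))\<bar> \<le> U A (merge A A' (z, y))"
          using ge_U[OF that, of "merge A A' (z, y)" A] by (simp add: I(3))
      qed (rule int)
      finally show ?thesis .
    qed
    then have "?D z \<le> ?E" using V by (subst Max_le_iff) auto
    moreover have "0 \<le> ?D z" using V by (subst Max_ge_iff) auto
    ultimately have "?D z ^ 4 \<le> ?E ^ 4" by (rule power_mono)
    also have "\<dots> \<le> PA'.expectation (\<lambda>y. U A (merge A A' (z, y)) ^ 4)"
      by (rule PA'.expectation_power4_ge[where c = "real m"]) (use U_bound in auto)
    finally have "ennreal (?D z ^ 4) \<le> ennreal (PA'.expectation (\<lambda>y. U A (merge A A' (z, y)) ^ 4))"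
      by (rule ennreal_leI)
    also have "\<dots> = (\<integral>\<^sup>+ y. ennreal (U A (merge A A' (z, y)) ^ 4) \<partial>PiM A' (\<lambda>_. \<mu>))"
    proof (rule nn_integral_eq_integral[symmetric])
      show "integrable (PiM A' (\<lambda>_. \<mu>)) (\<lambda>y. U A (merge A A' (z, y)) ^ 4)"
        by (rule PA'.integrable_const_bound[of _ "real m ^ 4"])
          (use U_bound in \<open>auto intro!: power_mono\<close>)
    qed (use U_bound in auto)
    finally show ?thesis .
  qed
  \<comment> \<open>A permutation of \<open>I\<close> that carries \<open>A\<close> to
    \<open>C\<close>, and complement to complement, preserves the product measure and transports one
    statistic into the other.\<close>
  have swap: "(\<integral>\<^sup>+ z. ennreal (U C z ^ 4) \<partial>PiM I (\<lambda>_. \<mu>)) = (\<integral>\<^sup>+ z. ennreal (U A z ^ 4) \<partial>PiM I (\<lambda>_. \<mu>))"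
    if C: "C \<subseteq> I" "card C = m" for C
  proof -
    have fin: "finite C" "finite (I - C)" "card (I - C) = card (I - A)"
      using C I A finite_subset[OF C(1)] card_I by (auto simp: card_Diff_subset m_def)
    obtain f1 where f1: "bij_betw f1 A C" using A fin C m_def finite_same_card_bij by metis
    obtain f2 where f2: "bij_betw f2 (I - A) (I - C)" using I fin finite_same_card_bij by (metis finite_Diff)
    define f where "f i = (if i \<in> A then f1 i else f2 i)" for i
    have fA: "bij_betw f A C" "bij_betw f (I - A) (I - C)"
      using f1 f2 bij_betw_cong[of A f f1 C] bij_betw_cong[of "I - A" f f2 "I - C"] by (auto simp: f_def)
    then have f: "bij_betw f (A \<union> (I - A)) (C \<union> (I - C))"
      by (rule bij_betw_combine) auto
    then have "bij_betw f I I" using I(2) C by (simp only: Un_Diff_cancel Un_absorb1)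
    then have inj: "inj_on f I" "f \<in> I \<rightarrow> I" by (auto simp: bij_betw_def)
    have fI: "f i \<in> I" if "i \<in> I" for i using inj that by auto
    have [measurable]: "(\<lambda>\<omega>. \<lambda>n\<in>I. \<omega> (f n)) \<in> measurable (PiM I (\<lambda>_. \<mu>)) (PiM I (\<lambda>_. \<mu>))"
      using fI by (intro measurable_restrict measurable_component_singleton) auto
    have eq: "U A (\<lambda>n\<in>I. \<omega> (f n)) = U C \<omega>" for \<omega> :: "nat \<Rightarrow> real"
    proof -
      have "(\<Sum>i\<in>A. of_bool ((\<lambda>n\<in>I. \<omega> (f n)) i \<le> x) :: real) = (\<Sum>i\<in>C. of_bool (\<omega> i \<le> x))" for x
        using sum.reindex_bij_betw[OF fA(1), of "\<lambda>i. of_bool (\<omega> i \<le> x) :: real"] I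
        by (auto intro!: sum.cong simp: subset_iff)
      moreover have "(\<Sum>i\<in>I - A. of_bool ((\<lambda>n\<in>I. \<omega> (f n)) i \<le> x) :: real) = (\<Sum>i\<in>I - C. of_bool (\<omega> i \<le> x))" for x
        using sum.reindex_bij_betw[OF fA(2), of "\<lambda>i. of_bool (\<omega> i \<le> x) :: real"]
        by (auto intro!: sum.cong)
      ultimately show ?thesis unfolding U_def by simp
    qed
    have "(\<integral>\<^sup>+ z. ennreal (U A z ^ 4) \<partial>PiM I (\<lambda>_. \<mu>))
        = (\<integral>\<^sup>+ z. ennreal (U A z ^ 4) \<partial>distr (PiM I (\<lambda>_. \<mu>)) (PiM I (\<lambda>_. \<mu>)) (\<lambda>\<omega>. \<lambda>n\<in>I. \<omega> (f n)))"
      using distr_PiM_reindex[of I "\<lambda>_. \<mu>" f I] inj \<mu>.prob_space_axioms by simp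
    also have "\<dots> = (\<integral>\<^sup>+ z. ennreal (U C z ^ 4) \<partial>PiM I (\<lambda>_. \<mu>))"
      using U_meas[OF I(2)] by (subst nn_integral_distr) (auto simp: eq)
    finally show ?thesis ..
  qed
  let ?F = "{C. C \<subseteq> I \<and> card C = m}"
  let ?N = "\<integral>\<^sup>+ z. ennreal (U A z ^ 4) \<partial>PiM I (\<lambda>_. \<mu>)"
  interpret PI: prob_space "PiM I (\<lambda>_. \<mu>)" by (rule prob_space_PiM) (rule assms(1))
  have finF: "finite ?F" using I by auto
  have cF: "card ?F = 2 * m choose m" using n_subsets[OF I(1), of m] card_I by simp
  have "of_nat (2 * m choose m) * ?N = (\<Sum>C\<in>?F. \<integral>\<^sup>+ z. ennreal (U C z ^ 4) \<partial>PiM I (\<lambda>_. \<mu>))"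
    using swap cF by simp
  also have "\<dots> = (\<integral>\<^sup>+ z. (\<Sum>C\<in>?F. ennreal (U C z ^ 4)) \<partial>PiM I (\<lambda>_. \<mu>))"
    using U_meas by (intro nn_integral_sum[symmetric]) auto
  also have "\<dots> \<le> (\<integral>\<^sup>+ z. ennreal (4 * (real m)\<^sup>2 * real (2 * m choose m)) \<partial>PiM I (\<lambda>_. \<mu>))"
  proof (rule nn_integral_mono)
    fix z
    have "(\<Sum>C\<in>?F. ennreal (U C z ^ 4)) = ennreal (\<Sum>C\<in>?F. U C z ^ 4)"
      by (rule sum_ennreal) simp
    also have "\<dots> \<le> ennreal (4 * (real m)\<^sup>2 * real (2 * m choose m))"
      unfolding U_def by (intro ennreal_leI balanced_split_max_bound I card_I V)
    finally show "(\<Sum>C\<in>?F. ennreal (U C z ^ 4)) \<le> ennreal (4 * (real m)\<^sup>2 * real (2 * m choose m))" .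
  qed
  also have "\<dots> = of_nat (2 * m choose m) * ennreal (4 * (real m)\<^sup>2)"
    by (simp add: PI.emeasure_space_1 ennreal_mult'' ennreal_of_nat_eq_real_of_nat mult.commute)
  finally have N: "?N \<le> ennreal (4 * (real m)\<^sup>2)"
    by (subst (asm) ennreal_mult_le_mult_iff) (auto simp: ennreal_of_nat_eq_real_of_nat)
  have "(\<integral>\<^sup>+ z. ennreal (?D z ^ 4) \<partial>PiM A (\<lambda>_. \<mu>))
      \<le> (\<integral>\<^sup>+ z. (\<integral>\<^sup>+ y. ennreal (U A (merge A A' (z, y)) ^ 4) \<partial>PiM A' (\<lambda>_. \<mu>)) \<partial>PiM A (\<lambda>_. \<mu>))"
    by (intro nn_integral_mono ghost)
  also have "\<dots> = ?N"
    unfolding I_def using U_meas[OF I(2)] A A' I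
    by (intro prod.product_nn_integral_fold[symmetric]) (auto simp: I_def)
  also note N
  finally show ?thesis by (simp add: m_def)
qed

text \<open>
  Conditionally on which of the \<open>\<tau> k\<close> lie in \<open>H\<close>, the values \<open>Y (\<tau> k)\<close> for those \<open>k\<close> are iid. If none
  of them does, the quotient is \<open>0\<close> by the convention \<open>x / 0 = 0\<close>.
\<close>

lemma (in prob_space) conditional_empirical_fourth_moment:
  fixes \<tau> :: "nat \<Rightarrow> 'a \<Rightarrow> 'b" and Y :: "'b \<Rightarrow> real" and V :: "real set"
  assumes J: "finite J" and indep: "indep_vars (\<lambda>_. N) \<tau> J"
    and law: "\<And>k. k \<in> J \<Longrightarrow> distr M N (\<tau> k) = \<rho>"
    and H[measurable]: "H \<in> sets N" and Y[measurable]: "Y \<in> borel_measurable N"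
    and V: "finite V" "V \<noteq> {}"
  defines "F \<equiv> \<lambda>x. measure \<rho> (H \<inter> (Y -` {..x} \<inter> space N)) / measure \<rho> H"
    and "R \<equiv> \<lambda>\<omega>. {k \<in> J. \<tau> k \<omega> \<in> H}"
  shows "(\<integral>\<^sup>+ \<omega>. ennreal ((Max ((\<lambda>x. \<bar>\<Sum>k\<in>R \<omega>. of_bool (Y (\<tau> k \<omega>) \<le> x) - F x\<bar>) ` V)) ^ 4 / real (card (R \<omega>))) \<partial>M)
         \<le> ennreal (4 * real (card J))"
proof -
  have rv[measurable]: "\<tau> k \<in> measurable M N" if "k \<in> J" for k
    using indep that by (auto simp: indep_vars_def)
  define D where "D A \<omega> = Max ((\<lambda>x. \<bar>\<Sum>k\<in>A. of_bool (Y (\<tau> k \<omega>) \<le> x) - F x\<bar>) ` V)" for A \<omega>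
  have D_meas: "D A \<in> borel_measurable M" if "A \<subseteq> J" for A
    unfolding D_def
  proof (intro borel_measurable_Max V borel_measurable_abs borel_measurable_sum)
    fix x k assume "k \<in> A"
    with that have [measurable]: "\<tau> k \<in> measurable M N" by (intro rv) auto
    show "(\<lambda>\<omega>. of_bool (Y (\<tau> k \<omega>) \<le> x) - F x) \<in> borel_measurable M" by measurable
  qed
  have D_nonneg: "0 \<le> D A \<omega>" for A \<omega> unfolding D_def using V by (subst Max_ge_iff) auto
  define E where "E A = {\<omega> \<in> space M. R \<omega> = A}" for A
  define c :: "nat set \<Rightarrow> nat \<Rightarrow> 'b set" where "c A k = (if k \<in> A then H else space N - H)" for A k
  have E_eq: "E A = {\<omega> \<in> space M. \<forall>k\<in>J. \<tau> k \<omega> \<in> c A k}" if "A \<subseteq> J" for A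
  proof -
    have "R \<omega> = A \<longleftrightarrow> (\<forall>k\<in>J. \<tau> k \<omega> \<in> c A k)" if "\<omega> \<in> space M" for \<omega>
      using measurable_space[OF rv that] \<open>A \<subseteq> J\<close> by (auto simp: R_def c_def split: if_splits)
    then show ?thesis by (auto simp: E_def)
  qed
  have c_sets[measurable]: "c A k \<in> sets N" for A k by (simp add: c_def)
  have E_sets[measurable]: "E A \<in> sets M" if "A \<subseteq> J" for A
    unfolding E_eq[OF that] using J by measurable
  \<comment> \<open>On \<open>E A\<close> the random index set is the fixed set \<open>A\<close>. A
    bound proportional to the probability of \<open>E A\<close> lets the disjoint patterns be summed
    up at the end.\<close>
  have pattern: "(\<integral>\<^sup>+ \<omega>. ennreal (D A \<omega> ^ 4 / real (card A)) * indicator (E A) \<omega> \<partial>M)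
      \<le> ennreal (4 * real (card J)) * emeasure M (E A)" if A: "A \<subseteq> J" for A
  proof (cases "A = {} \<or> emeasure M (E A) = 0")
    case True
    then show ?thesis
    proof
      assume "emeasure M (E A) = 0"
      then have "E A \<in> null_sets M" using A by (auto simp: null_sets_def)
      then have "AE \<omega> in M. \<omega> \<notin> E A" by (rule AE_not_in)
      then have "AE \<omega> in M. ennreal (D A \<omega> ^ 4 / real (card A)) * indicator (E A) \<omega> = 0"
        by eventually_elim simp
      then have "(\<integral>\<^sup>+ \<omega>. ennreal (D A \<omega> ^ 4 / real (card A)) * indicator (E A) \<omega> \<partial>M) = (\<integral>\<^sup>+ \<omega>. 0 \<partial>M)"
        by (rule nn_integral_cong_AE)
      then show ?thesis by simp
    qed simp
  next
    case False
    define Q where "Q = uniform_measure M (E A)"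
    have fin_A: "finite A" using A J finite_subset by auto
    have J_ne: "J \<noteq> {}" using False A by auto
    interpret Q: prob_space Q
      unfolding Q_def using False by (intro prob_space_uniform_measure) auto
    have space_Q: "space Q = space M" and sets_Q[measurable_cong]: "sets Q = sets M"
      by (simp_all add: Q_def)
    have prob_rect: "prob {\<omega> \<in> space M. \<forall>k\<in>J. \<tau> k \<omega> \<in> C k} = (\<Prod>k\<in>J. measure \<rho> (C k))"
      if "\<And>k. k \<in> J \<Longrightarrow> C k \<in> sets N" for C
    proof -
      have "{\<omega> \<in> space M. \<forall>k\<in>J. \<tau> k \<omega> \<in> C k} = (\<Inter>k\<in>J. \<tau> k -` C k \<inter> space M)"
        using J_ne by auto
      also have "prob \<dots> = (\<Prod>k\<in>J. prob (\<tau> k -` C k \<inter> space M))"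
        using indep_varsD[OF indep J_ne J order_refl] that by simp
      also have "\<dots> = (\<Prod>k\<in>J. measure \<rho> (C k))"
        by (intro prod.cong refl) (use that in \<open>simp add: law[symmetric] measure_distr\<close>)
      finally show ?thesis .
    qed
    have prob_E: "prob (E A) = (\<Prod>k\<in>J. measure \<rho> (c A k))"
      unfolding E_eq[OF A] by (rule prob_rect) simp
    moreover have "prob (E A) \<noteq> 0" using False by (simp add: emeasure_eq_measure)
    ultimately have c_pos: "measure \<rho> (c A k) \<noteq> 0" if "k \<in> J" for k
      using that J by auto
    define a where "a b = measure \<rho> (H \<inter> (Y -` b \<inter> space N)) / measure \<rho> H" for b
    \<comment> \<open>Numerator and denominator of the conditional probability both factor over
      \<open>J\<close>, and the factors outside \<open>J'\<close> cancel since they are nonzero.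
      Singletons \<open>J'\<close> give the common law, general \<open>J'\<close> the
      independence.\<close>
    have Q_prob: "Q.prob (\<Inter>k\<in>J'. (\<lambda>\<omega>. Y (\<tau> k \<omega>)) -` b k \<inter> space M) = (\<Prod>k\<in>J'. a (b k))"
      if J': "J' \<subseteq> A" "J' \<noteq> {}" and b: "\<And>k. k \<in> J' \<Longrightarrow> b k \<in> sets borel" for J' b
    proof -
      define C where "C k = (if k \<in> J' then H \<inter> (Y -` b k \<inter> space N) else c A k)" for k
      have C_sets: "C k \<in> sets N" if "k \<in> J" for k
      proof -
        have "Y -` b k \<inter> space N \<in> sets N" if "k \<in> J'"
          using b[OF that] by measurable
        then show ?thesis using b by (auto simp: C_def)
      qed
      have "finite J'" using J' fin_A finite_subset by auto
      have meas: "(\<Inter>k\<in>J'. (\<lambda>\<omega>. Y (\<tau> k \<omega>)) -` b k \<inter> space M) \<in> sets M"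
      proof (intro sets.finite_INT J' \<open>finite J'\<close>)
        fix k assume "k \<in> J'"
        then have [measurable]: "\<tau> k \<in> measurable M N" "b k \<in> sets borel" using J' A b by auto
        show "(\<lambda>\<omega>. Y (\<tau> k \<omega>)) -` b k \<inter> space M \<in> sets M" by measurable
      qed
      have "E A \<inter> (\<Inter>k\<in>J'. (\<lambda>\<omega>. Y (\<tau> k \<omega>)) -` b k \<inter> space M) = {\<omega> \<in> space M. \<forall>k\<in>J. \<tau> k \<omega> \<in> C k}"
        unfolding E_eq[OF A] using measurable_space[OF rv] J' A
        by (auto simp: C_def c_def split: if_splits) blast+
      then have "Q.prob (\<Inter>k\<in>J'. (\<lambda>\<omega>. Y (\<tau> k \<omega>)) -` b k \<inter> space M)
          = prob {\<omega> \<in> space M. \<forall>k\<in>J. \<tau> k \<omega> \<in> C k} / prob (E A)"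
        unfolding Q_def using False meas A by (subst measure_uniform_measure) auto
      also have "\<dots> = (\<Prod>k\<in>J. measure \<rho> (C k) / measure \<rho> (c A k))"
        using prob_rect[of C] C_sets by (simp add: prob_E prod_dividef)
      also have "\<dots> = (\<Prod>k\<in>J'. measure \<rho> (C k) / measure \<rho> (c A k))"
        by (intro prod.mono_neutral_right J) (use J' A c_pos in \<open>auto simp: C_def\<close>)
      also have "\<dots> = (\<Prod>k\<in>J'. a (b k))"
        by (intro prod.cong refl) (use J' in \<open>auto simp: C_def c_def a_def\<close>)
      finally show ?thesis .
    qed
    obtain k0 where k0: "k0 \<in> A" using False by auto
    define \<mu> where "\<mu> = distr Q borel (\<lambda>\<omega>. Y (\<tau> k0 \<omega>))"
    have rvY: "(\<lambda>\<omega>. Y (\<tau> k \<omega>)) \<in> borel_measurable Q" if "k \<in> A" for k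
    proof -
      have [measurable]: "\<tau> k \<in> measurable M N" using that A by auto
      show ?thesis by measurable
    qed
    have law_Y: "measure (distr Q borel (\<lambda>\<omega>. Y (\<tau> k \<omega>))) b = a b" if "k \<in> A" "b \<in> sets borel" for k b
      using Q_prob[of "{k}" "\<lambda>_. b"] that rvY by (simp add: measure_distr space_Q)
    have eq_\<mu>: "distr Q borel (\<lambda>\<omega>. Y (\<tau> k \<omega>)) = \<mu>" if "k \<in> A" for k
    proof (rule measure_eqI)
      interpret d: prob_space "distr Q borel (\<lambda>\<omega>. Y (\<tau> k \<omega>))"
        by (rule Q.prob_space_distr[OF rvY[OF that]])
      interpret \<mu>: prob_space \<mu>
        unfolding \<mu>_def by (rule Q.prob_space_distr[OF rvY[OF k0]])
      fix b assume "b \<in> sets (distr Q borel (\<lambda>\<omega>. Y (\<tau> k \<omega>)))"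
      then have "b \<in> sets borel" by simp
      then show "emeasure (distr Q borel (\<lambda>\<omega>. Y (\<tau> k \<omega>))) b = emeasure \<mu> b"
        unfolding d.emeasure_eq_measure \<mu>.emeasure_eq_measure
        using law_Y[OF that] law_Y[OF k0] by (simp add: \<mu>_def)
    qed (simp add: \<mu>_def)
    have indep_Q: "Q.indep_vars (\<lambda>_. borel) (\<lambda>k \<omega>. Y (\<tau> k \<omega>)) A"
      unfolding Q.indep_vars_def2
    proof (intro conjI ballI rvY Q.indep_setsI)
      fix k assume "k \<in> A"
      then show "{(\<lambda>\<omega>. Y (\<tau> k \<omega>)) -` B \<inter> space Q |B. B \<in> sets borel} \<subseteq> Q.events"
        using rvY[of k] by auto
    next
      fix X J' assume J': "J' \<noteq> {}" "J' \<subseteq> A" "finite J'"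
        and X: "\<forall>j\<in>J'. X j \<in> {(\<lambda>\<omega>. Y (\<tau> j \<omega>)) -` B \<inter> space Q |B. B \<in> sets borel}"
      then have "\<forall>j\<in>J'. \<exists>B. X j = (\<lambda>\<omega>. Y (\<tau> j \<omega>)) -` B \<inter> space Q \<and> B \<in> sets borel" by auto
      then obtain b where b: "\<And>j. j \<in> J' \<Longrightarrow> X j = (\<lambda>\<omega>. Y (\<tau> j \<omega>)) -` b j \<inter> space Q"
          "\<And>j. j \<in> J' \<Longrightarrow> b j \<in> sets borel"
        by metis
      have "Q.prob (\<Inter>j\<in>J'. X j) = (\<Prod>j\<in>J'. a (b j))"
        using Q_prob[OF J'(2,1), of b] b by (simp add: space_Q cong: INF_cong)
      also have "\<dots> = (\<Prod>j\<in>J'. Q.prob (X j))"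
        by (intro prod.cong refl) (use J' b Q_prob[of "{_}" "\<lambda>_. b _"] in \<open>auto simp: space_Q\<close>)
      finally show "Q.prob (\<Inter>j\<in>J'. X j) = (\<Prod>j\<in>J'. Q.prob (X j))" .
    qed
    have distr_eq: "distr Q (PiM A (\<lambda>_. borel)) (\<lambda>\<omega>. \<lambda>k\<in>A. Y (\<tau> k \<omega>)) = PiM A (\<lambda>_. \<mu>)"
    proof -
      have "distr Q (PiM A (\<lambda>_. borel)) (\<lambda>\<omega>. \<lambda>k\<in>A. Y (\<tau> k \<omega>))
          = PiM A (\<lambda>k. distr Q borel (\<lambda>\<omega>. Y (\<tau> k \<omega>)))"
        using Q.indep_vars_iff_distr_eq_PiM'[of A "\<lambda>k \<omega>. Y (\<tau> k \<omega>)" "\<lambda>_. borel"] indep_Q rvY k0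
        by auto
      also have "\<dots> = PiM A (\<lambda>_. \<mu>)" by (intro PiM_cong refl eq_\<mu>)
      finally show ?thesis .
    qed
    let ?G = "\<lambda>z. Max ((\<lambda>x. \<bar>\<Sum>k\<in>A. of_bool (z k \<le> x) - measure \<mu> {..x}\<bar>) ` V)"
    have G_meas: "?G \<in> borel_measurable (PiM A (\<lambda>_. borel))"
      by (intro borel_measurable_Max V borel_measurable_abs borel_measurable_sum) measurable
    have D_G: "D A \<omega> = ?G (\<lambda>k\<in>A. Y (\<tau> k \<omega>))" for \<omega>
    proof -
      have "measure \<mu> {..x} = F x" for x
        using law_Y[OF k0, of "{..x}"] by (simp add: \<mu>_def a_def F_def)
      then show ?thesis unfolding D_def by simp
    qed
    have pr: "prob_space \<mu>" unfolding \<mu>_def by (rule Q.prob_space_distr[OF rvY[OF k0]])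
    have "(\<integral>\<^sup>+ \<omega>. ennreal (D A \<omega> ^ 4) \<partial>Q) = (\<integral>\<^sup>+ z. ennreal (?G z ^ 4) \<partial>distr Q (PiM A (\<lambda>_. borel)) (\<lambda>\<omega>. \<lambda>k\<in>A. Y (\<tau> k \<omega>)))"
      unfolding D_G using G_meas by (intro nn_integral_distr[symmetric] measurable_restrict rvY) auto
    also have "\<dots> \<le> ennreal (4 * (real (card A))\<^sup>2)"
      unfolding distr_eq by (rule product_empirical_fourth_moment) (use pr fin_A V in \<open>auto simp: \<mu>_def\<close>)
    finally have Q4: "(\<integral>\<^sup>+ \<omega>. ennreal (D A \<omega> ^ 4) \<partial>Q) \<le> ennreal (4 * (real (card A))\<^sup>2)" .
    \<comment> \<open>Division by \<open>card A\<close> turns the quadratic bound into a linear one,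
      which no longer depends on the pattern once \<open>card A\<close> is replaced by
      \<open>card J\<close>.\<close>
    have card_A: "0 < card A" "card A \<le> card J" using fin_A k0 A J by (auto simp: card_gt_0_iff card_mono)
    have "(\<integral>\<^sup>+ \<omega>. ennreal (D A \<omega> ^ 4 / real (card A)) \<partial>Q)
        = (\<integral>\<^sup>+ \<omega>. ennreal (1 / real (card A)) * ennreal (D A \<omega> ^ 4) \<partial>Q)"
      by (simp add: ennreal_mult[symmetric])
    also have "\<dots> = ennreal (1 / real (card A)) * (\<integral>\<^sup>+ \<omega>. ennreal (D A \<omega> ^ 4) \<partial>Q)"
      using D_meas[OF A] by (intro nn_integral_cmult) measurable
    also have "\<dots> \<le> ennreal (1 / real (card A)) * ennreal (4 * (real (card A))\<^sup>2)"
      by (intro mult_left_mono Q4) simp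
    also have "\<dots> = ennreal (4 * real (card A))"
      using card_A by (simp add: ennreal_mult[symmetric] power2_eq_square)
    also have "\<dots> \<le> ennreal (4 * real (card J))" using card_A by (intro ennreal_leI) simp
    finally have "(\<integral>\<^sup>+ \<omega>. ennreal (D A \<omega> ^ 4 / real (card A)) \<partial>Q) \<le> ennreal (4 * real (card J))" .
    moreover have "(\<integral>\<^sup>+ \<omega>. ennreal (D A \<omega> ^ 4 / real (card A)) \<partial>Q)
        = (\<integral>\<^sup>+ \<omega>. ennreal (D A \<omega> ^ 4 / real (card A)) * indicator (E A) \<omega> \<partial>M) / emeasure M (E A)"
      unfolding Q_def using D_meas[OF A] A by (intro nn_integral_uniform_measure) auto
    ultimately have le: "(\<integral>\<^sup>+ \<omega>. ennreal (D A \<omega> ^ 4 / real (card A)) * indicator (E A) \<omega> \<partial>M) / emeasure M (E A)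
        \<le> ennreal (4 * real (card J))" by simp
    have "(\<integral>\<^sup>+ \<omega>. ennreal (D A \<omega> ^ 4 / real (card A)) * indicator (E A) \<omega> \<partial>M)
       = (\<integral>\<^sup>+ \<omega>. ennreal (D A \<omega> ^ 4 / real (card A)) * indicator (E A) \<omega> \<partial>M) / emeasure M (E A) * emeasure M (E A)"
      using False emeasure_finite[of "E A"]
      by (subst ennreal_divide_times) (simp add: ennreal_divide_self less_top[symmetric])
    also have "\<dots> \<le> ennreal (4 * real (card J)) * emeasure M (E A)"
      by (intro mult_right_mono le) simp
    finally show ?thesis .
  qed
  have R_sub: "R \<omega> \<in> Pow J" for \<omega> by (auto simp: R_def)
  have "(\<integral>\<^sup>+ \<omega>. ennreal (D (R \<omega>) \<omega> ^ 4 / real (card (R \<omega>))) \<partial>M)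
      = (\<integral>\<^sup>+ \<omega>. (\<Sum>A\<in>Pow J. ennreal (D A \<omega> ^ 4 / real (card A)) * indicator (E A) \<omega>) \<partial>M)"
  proof (rule nn_integral_cong)
    fix \<omega> assume "\<omega> \<in> space M"
    then have "(\<Sum>A\<in>Pow J. ennreal (D A \<omega> ^ 4 / real (card A)) * indicator (E A) \<omega>)
        = (\<Sum>A\<in>Pow J. if A = R \<omega> then ennreal (D A \<omega> ^ 4 / real (card A)) else 0)"
      by (intro sum.cong refl) (auto simp: E_def indicator_def)
    also have "\<dots> = ennreal (D (R \<omega>) \<omega> ^ 4 / real (card (R \<omega>)))"
      using J R_sub by (subst sum.delta) auto
    finally show "ennreal (D (R \<omega>) \<omega> ^ 4 / real (card (R \<omega>)))
        = (\<Sum>A\<in>Pow J. ennreal (D A \<omega> ^ 4 / real (card A)) * indicator (E A) \<omega>)" ..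
  qed
  also have "\<dots> = (\<Sum>A\<in>Pow J. \<integral>\<^sup>+ \<omega>. ennreal (D A \<omega> ^ 4 / real (card A)) * indicator (E A) \<omega> \<partial>M)"
  proof (rule nn_integral_sum)
    fix A assume "A \<in> Pow J"
    then have [measurable]: "D A \<in> borel_measurable M" "E A \<in> sets M" using D_meas E_sets by auto
    show "(\<lambda>\<omega>. ennreal (D A \<omega> ^ 4 / real (card A)) * indicator (E A) \<omega>) \<in> borel_measurable M"
      by measurable
  qed
  also have "\<dots> \<le> (\<Sum>A\<in>Pow J. ennreal (4 * real (card J)) * emeasure M (E A))"
    by (intro sum_mono pattern) auto
  also have "\<dots> = ennreal (4 * real (card J)) * (\<Sum>A\<in>Pow J. emeasure M (E A))"
    by (simp add: sum_distrib_left)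
  also have "(\<Sum>A\<in>Pow J. emeasure M (E A)) = emeasure M (\<Union>A\<in>Pow J. E A)"
    using J E_sets by (intro sum_emeasure) (auto simp: disjoint_family_on_def E_def)
  also have "ennreal (4 * real (card J)) * emeasure M (\<Union>A\<in>Pow J. E A) \<le> ennreal (4 * real (card J)) * 1"
    by (intro mult_left_mono emeasure_le_1) simp
  finally show ?thesis by (simp add: D_def)
qed

section \<open>Deviations of sums over iid blocks\<close>

text \<open>Cross terms vanish by independence and centring. This serves both for the number of
  tours longer than \<open>j\<close> and for the regeneration time \<open>T K\<close>.\<close>

lemma (in prob_space) expectation_square_sum_indep:
  fixes X :: "'i \<Rightarrow> 'a \<Rightarrow> real"
  assumes J: "finite J" and indep: "indep_vars (\<lambda>_. borel) X J"
    and sq: "\<And>k. k \<in> J \<Longrightarrow> integrable M (\<lambda>\<omega>. (X k \<omega>)\<^sup>2)"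
    and mean: "\<And>k. k \<in> J \<Longrightarrow> expectation (X k) = 0"
  shows "integrable M (\<lambda>\<omega>. (\<Sum>k\<in>J. X k \<omega>)\<^sup>2)"
    and "expectation (\<lambda>\<omega>. (\<Sum>k\<in>J. X k \<omega>)\<^sup>2) = (\<Sum>k\<in>J. expectation (\<lambda>\<omega>. (X k \<omega>)\<^sup>2))"
proof -
  have rv: "X k \<in> borel_measurable M" if "k \<in> J" for k
    using indep that by (auto simp: indep_vars_def)
  have int: "integrable M (X k)" if "k \<in> J" for k
    using square_integrable_imp_integrable[OF rv[OF that] sq[OF that]] .
  have prod: "integrable M (\<lambda>\<omega>. X i \<omega> * X k \<omega>) \<and>
      expectation (\<lambda>\<omega>. X i \<omega> * X k \<omega>) = (if i = k then expectation (\<lambda>\<omega>. (X k \<omega>)\<^sup>2) else 0)"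
    if "i \<in> J" "k \<in> J" for i k
  proof (cases "i = k")
    case True
    then show ?thesis using sq[of k] that by (simp add: power2_eq_square)
  next
    case False
    have "indep_vars (\<lambda>_. borel) X {i, k}" using indep that by (rule_tac indep_vars_subset) auto
    then show ?thesis
      using indep_vars_lebesgue_integral[of "{i, k}" X] indep_vars_integrable[of "{i, k}" X] False that int mean
      by auto
  qed
  have eq: "(\<Sum>k\<in>J. X k \<omega>)\<^sup>2 = (\<Sum>i\<in>J. \<Sum>k\<in>J. X i \<omega> * X k \<omega>)" for \<omega>
    by (simp add: power2_eq_square sum_product)
  show "integrable M (\<lambda>\<omega>. (\<Sum>k\<in>J. X k \<omega>)\<^sup>2)"
    unfolding eq using prod by (intro Bochner_Integration.integrable_sum) auto
  have "expectation (\<lambda>\<omega>. (\<Sum>k\<in>J. X k \<omega>)\<^sup>2)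
      = (\<Sum>i\<in>J. \<Sum>k\<in>J. if i = k then expectation (\<lambda>\<omega>. (X k \<omega>)\<^sup>2) else 0)"
    unfolding eq using prod by (simp add: Bochner_Integration.integral_sum)
  then show "expectation (\<lambda>\<omega>. (\<Sum>k\<in>J. X k \<omega>)\<^sup>2) = (\<Sum>k\<in>J. expectation (\<lambda>\<omega>. (X k \<omega>)\<^sup>2))"
    using J by simp
qed

text \<open>After \<open>q\<close> the first \<open>n\<close> terms, with \<open>n\<close> the
  ceiling of \<open>ln (B * K) / \<gamma>\<close>, are each at most \<open>ln s\<close> by
  monotonicity. From then on the exponential decay has absorbed the factor \<open>K * B\<close>, and
  a geometric series remains.\<close>

lemma tail_sum_bound:
  fixes p :: "nat \<Rightarrow> real" and K B \<gamma> s :: real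
  assumes p: "\<And>j. 0 \<le> p j" "antimono p" "\<And>j. p j \<le> B * exp (- \<gamma> * real j)"
    and q: "K * p q \<le> ln s" and "\<gamma> > 0" "B > 0" "K > 0" "B * K \<ge> 1" "s > 1"
  shows "K * (\<Sum>j. p (j + q)) \<le> 2 * sqrt s * (ln (B * K) / \<gamma> * sqrt (ln s) + 1 / (1 - exp (- \<gamma> / 2)))"
proof -
  define l where "l = ln (B * K) / \<gamma>"
  define n where "n = nat \<lceil>l\<rceil>"
  define r where "r = exp (- \<gamma>)"
  have r: "0 < r" "r < 1" using \<open>\<gamma> > 0\<close> by (auto simp: r_def)
  have r_pow: "exp (- \<gamma> * real j) = r ^ j" for j
    by (simp add: r_def exp_of_nat_mult[symmetric] mult.commute)
  have l: "0 \<le> l" using assms by (simp add: l_def)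
  have n: "l \<le> real n" "real n \<le> l + 1" using l by (auto simp: n_def)
  have KB: "K * B * r ^ n \<le> 1"
  proof -
    have "K * B = exp (l * \<gamma>)" using assms by (simp add: l_def mult.commute)
    moreover have "r ^ n = exp (- \<gamma> * real n)" by (rule r_pow[symmetric])
    ultimately have "K * B * r ^ n = exp (\<gamma> * (l - real n))" by (simp add: exp_add[symmetric] algebra_simps)
    then show ?thesis using n \<open>\<gamma> > 0\<close> by (simp add: mult_nonneg_nonpos)
  qed
  have summ: "summable p"
  proof (rule summable_comparison_test'[of "\<lambda>j. B * r ^ j" 0])
    show "summable (\<lambda>j. B * r ^ j)" using r by (intro summable_mult summable_geometric) simp
    show "norm (p j) \<le> B * r ^ j" for j using p(1)[of j] p(3)[of j] unfolding r_pow by simp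
  qed
  have summ_q: "summable (\<lambda>j. K * p (j + q))" using summ by (intro summable_mult summable_ignore_initial_segment)
  have first: "K * p (j + q) \<le> ln s" for j
    using order_trans[OF mult_left_mono[OF antimonoD[OF p(2), of q "j + q"], of K] q] \<open>K > 0\<close> by simp
  have second: "K * p (j + n + q) \<le> r ^ j" for j
  proof -
    have "K * p (j + n + q) \<le> K * (B * r ^ (j + n + q))"
      using p(3)[of "j + n + q"] \<open>K > 0\<close> unfolding r_pow by simp
    also have "\<dots> = (K * B * r ^ n) * (r ^ j * r ^ q)" by (simp add: power_add)
    also have "\<dots> \<le> 1 * (r ^ j * 1)"
      using KB r assms by (intro mult_mono power_le_one) auto
    finally show ?thesis by simp
  qed
  have "K * (\<Sum>j. p (j + q)) = (\<Sum>j. K * p (j + q))"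
    using summ by (intro suminf_mult[symmetric] summable_ignore_initial_segment)
  also have "\<dots> = (\<Sum>j. K * p (j + n + q)) + (\<Sum>j<n. K * p (j + q))"
    using suminf_split_initial_segment[OF summ_q, of n] by simp
  also have "(\<Sum>j. K * p (j + n + q)) \<le> (\<Sum>j. r ^ j)"
    using second summable_ignore_initial_segment[OF summ_q, of n] r by (intro suminf_le) auto
  also have "(\<Sum>j. r ^ j) = 1 / (1 - r)" using r by (intro suminf_geometric) simp
  also have "(\<Sum>j<n. K * p (j + q)) \<le> real n * ln s"
    using sum_mono[of "{..<n}" "\<lambda>j. K * p (j + q)" "\<lambda>_. ln s"] first by simp
  also have "real n * ln s \<le> (l + 1) * ln s" using n \<open>s > 1\<close> by (intro mult_right_mono) auto
  finally have main: "K * (\<Sum>j. p (j + q)) \<le> 1 / (1 - r) + (l + 1) * ln s" by simp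
  define L where "L = ln s"
  have L: "0 < L" "s = exp L" using \<open>s > 1\<close> by (auto simp: L_def)
  have sqrt_s: "sqrt s = exp (L / 2)" unfolding L(2) by (simp add: real_sqrt_unique exp_double[symmetric] power2_eq_square exp_add[symmetric])
  have s1: "1 \<le> sqrt s" using \<open>s > 1\<close> by simp
  \<comment> \<open>From \<open>exp (L / 2) / 2 \<ge> 1 + L / 2 - ln 2\<close>, which is at least
    \<open>L / 2\<close> since \<open>ln 2 \<le> 1\<close>.\<close>
  have L_le: "L \<le> sqrt s"
    using exp_ge_add_one_self[of "L / 2 - ln 2"] ln2_le_25_over_36 unfolding sqrt_s by (simp add: exp_diff)
  have "L \<le> s" unfolding L(2) using exp_ge_add_one_self[of L] by linarith
  then have sqrt_L_le: "sqrt L \<le> sqrt s" by simp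
  have a: "l * L \<le> 2 * sqrt s * (l * sqrt L)"
  proof -
    have "l * L = l * (sqrt L * sqrt L)" using L by simp
    also have "\<dots> \<le> l * (sqrt L * (2 * sqrt s))"
    proof (intro mult_left_mono l)
      show "sqrt L \<le> 2 * sqrt s" using sqrt_L_le s1 by linarith
    qed (use L in auto)
    finally show ?thesis by (simp add: algebra_simps)
  qed
  \<comment> \<open>The factor 2 in the bound provides two copies of this quotient: one for the
    geometric series, one for the extra \<open>ln s\<close> caused by rounding \<open>n\<close>
    up.\<close>
  have half: "1 / (1 - r) \<le> 1 / (1 - exp (- \<gamma> / 2))" "1 \<le> 1 / (1 - exp (- \<gamma> / 2))"
    using \<open>\<gamma> > 0\<close> by (auto simp: r_def intro!: divide_left_mono mult_pos_pos)
  have "1 / (1 - r) \<le> sqrt s * (1 / (1 - exp (- \<gamma> / 2)))"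
    using mult_mono[OF s1 half(1)] r \<open>s > 1\<close> by simp
  moreover have "L \<le> sqrt s * (1 / (1 - exp (- \<gamma> / 2)))"
    using mult_left_mono[OF half(2), of "sqrt s"] L_le s1 by linarith
  moreover have "(l + 1) * ln s = l * L + L" by (simp add: L_def algebra_simps)
  ultimately have "K * (\<Sum>j. p (j + q)) \<le> 2 * sqrt s * (l * sqrt L) + 2 * (sqrt s * (1 / (1 - exp (- \<gamma> / 2))))"
    using main a by linarith
  then show ?thesis by (simp only: l_def L_def distrib_left mult.assoc)
qed

lemma square_sum_le_card:
  fixes a b :: "nat \<Rightarrow> real"
  shows "(\<Sum>j<q. a j + b j)\<^sup>2 \<le> real q * (\<Sum>j<q. 2 * ((a j)\<^sup>2 + (b j)\<^sup>2))"
proof -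
  have "(\<Sum>j<q. 1 * (a j + b j))\<^sup>2 \<le> (\<Sum>j<q. 1\<^sup>2) * (\<Sum>j<q. (a j + b j)\<^sup>2)"
    by (rule Cauchy_Schwarz_ineq_sum)
  also have "\<dots> \<le> real q * (\<Sum>j<q. 2 * ((a j)\<^sup>2 + (b j)\<^sup>2))"
  proof -
    have "(a j + b j)\<^sup>2 \<le> 2 * ((a j)\<^sup>2 + (b j)\<^sup>2)" for j
      using zero_le_power2[of "a j - b j"] by (simp add: power2_eq_square algebra_simps)
    then show ?thesis by (auto intro!: mult_left_mono sum_mono)
  qed
  finally show ?thesis by simp
qed

text \<open>Equivalent to \<open>s^2 \<le> 2 powr (s + 1 / 4)\<close>, which makes the failure
  probability of \<open>G3\<close> in \<open>regenerative_deviation\<close> small enough. The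
  tangent of \<open>ln\<close> at 3 doubles to slope \<open>2 / 3 \<le> ln 2\<close>, and at 3
  itself the claim follows from \<open>3 ^ 8 \<le> 2 ^ 13\<close>; the summand \<open>1 / 4\<close>
  is the slack needed there.\<close>

lemma two_ln_le:
  fixes s :: real
  assumes "s \<ge> 3"
  shows "2 * ln s \<le> (s + 1 / 4) * ln 2"
proof -
  have "ln (s / 3) \<le> s / 3 - 1" using assms by (intro ln_le_minus_one) auto
  moreover have "ln s = ln 3 + ln (s / 3)" using assms by (simp add: ln_div)
  ultimately have "2 * ln s \<le> 2 * ln 3 + 2 / 3 * (s - 3)" by argo
  also have "2 / 3 * (s - 3) \<le> ln 2 * (s - 3)"
    using ln2_ge_two_thirds assms by (intro mult_right_mono) auto
  also have "2 * ln 3 \<le> (3 + 1 / 4) * ln (2::real)"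
  proof -
    have "8 * ln (3::real) = ln (3 ^ 8)" using ln_realpow[of "3::real" 8] by (simp only: of_nat_numeral)
    also have "\<dots> \<le> ln (2 ^ 13)" by simp
    also have "\<dots> = 13 * ln 2" using ln_realpow[of "2::real" 13] by (simp only: of_nat_numeral)
    finally show ?thesis by simp
  qed
  finally show ?thesis by (simp add: algebra_simps)
qed

lemma sum_blocks_by_position:
  fixes a :: "'i \<Rightarrow> nat \<Rightarrow> 'b::comm_monoid_add"
  assumes J: "finite J" and w: "\<And>k. k \<in> J \<Longrightarrow> w k \<le> n"
  shows "(\<Sum>k\<in>J. \<Sum>j<w k. a k j) = (\<Sum>j<n. \<Sum>k | k \<in> J \<and> j < w k. a k j)"
proof -
  have "(\<Sum>k\<in>J. \<Sum>j<w k. a k j) = (\<Sum>k\<in>J. \<Sum>j<n. if j < w k then a k j else 0)"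
  proof (rule sum.cong[OF refl])
    fix k assume "k \<in> J"
    then show "(\<Sum>j<w k. a k j) = (\<Sum>j<n. if j < w k then a k j else 0)"
      using w by (intro sum.mono_neutral_cong_left) (auto simp: less_le_trans)
  qed
  also have "\<dots> = (\<Sum>j<n. \<Sum>k\<in>J. if j < w k then a k j else 0)" by (rule sum.swap)
  also have "\<dots> = (\<Sum>j<n. \<Sum>k | k \<in> J \<and> j < w k. a k j)"
    using J by (simp add: sum.inter_filter)
  finally show ?thesis .
qed

text \<open>
  The last sum uses \<open>\<Sum>\<^sub>j (Q\<^sub>j - p\<^sub>j c) = 0\<close>: the part below the truncation level \<open>q\<close> is
  minus the part above it.
\<close>

lemma block_sum_decomposition:
  fixes J :: "'i set" and w :: "'i \<Rightarrow> nat" and u :: "'i \<Rightarrow> nat \<Rightarrow> real" and p Q :: "nat \<Rightarrow> real" and c :: real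
  assumes J: "finite J" and w: "\<And>k. k \<in> J \<Longrightarrow> w k \<le> n" and "q \<le> n"
    and u: "\<And>k j. 0 \<le> u k j" "\<And>k j. u k j \<le> 1" and c: "0 \<le> c" "c \<le> 1"
    and p: "summable p" "\<And>j. j < q \<Longrightarrow> 0 < p j" and Q: "\<And>j. 0 \<le> Q j" "\<And>j. Q j \<le> p j"
    and balance: "(\<lambda>j. Q j - p j * c) sums 0"
  defines "R \<equiv> \<lambda>j. {k \<in> J. j < w k}"
  shows "\<bar>\<Sum>k\<in>J. \<Sum>j<w k. u k j - c\<bar>
    \<le> (\<Sum>j<q. \<bar>\<Sum>k\<in>R j. u k j - Q j / p j\<bar> + \<bar>real (card (R j)) - card J * p j\<bar>)
      + (\<Sum>j=q..<n. real (card (R j))) + card J * (\<Sum>j. p (j + q))"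
proof -
  have finR: "finite (R j)" for j using J by (simp add: R_def)
  have small: "\<bar>\<Sum>k\<in>R j. u k j - c\<bar> \<le> real (card (R j))" for j
  proof -
    have "\<bar>\<Sum>k\<in>R j. u k j - c\<bar> \<le> (\<Sum>k\<in>R j. \<bar>u k j - c\<bar>)" by (rule sum_abs)
    also have "\<dots> \<le> (\<Sum>k\<in>R j. 1)"
    proof (rule sum_mono)
      fix k show "\<bar>u k j - c\<bar> \<le> 1" using u(1)[of k j] u(2)[of k j] c by linarith
    qed
    finally show ?thesis by simp
  qed
  \<comment> \<open>Recentre at the conditional mean \<open>Q j / p j\<close> given a length beyond
    \<open>j\<close>. What remains is the fluctuation of the number of long blocks times
    \<open>Q j / p j - c\<close>, a difference of two numbers in the unit interval.\<close>
  have large: "\<bar>(\<Sum>k\<in>R j. u k j - c) - card J * (Q j - p j * c)\<bar>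
      \<le> \<bar>\<Sum>k\<in>R j. u k j - Q j / p j\<bar> + \<bar>real (card (R j)) - card J * p j\<bar>" if "j < q" for j
  proof -
    have pj: "0 < p j" using p that by auto
    have 0: "0 \<le> Q j / p j" "Q j / p j \<le> 1" using Q[of j] pj by auto
    have "Q j = p j * (Q j / p j)" using pj by simp
    then have "(\<Sum>k\<in>R j. u k j - c) - card J * (Q j - p j * c)
        = (\<Sum>k\<in>R j. u k j - c) - card J * (p j * (Q j / p j) - p j * c)" by metis
    also have "\<dots> = (\<Sum>k\<in>R j. u k j - Q j / p j) + (real (card (R j)) - card J * p j) * (Q j / p j - c)"
      unfolding sum_subtractf sum_constant by algebra
    also have "\<bar>\<dots>\<bar> \<le> \<bar>\<Sum>k\<in>R j. u k j - Q j / p j\<bar> + \<bar>(real (card (R j)) - card J * p j) * (Q j / p j - c)\<bar>"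
      by (rule abs_triangle_ineq)
    also have "\<bar>(real (card (R j)) - card J * p j) * (Q j / p j - c)\<bar>
        \<le> \<bar>real (card (R j)) - card J * p j\<bar> * 1"
    proof -
      have "\<bar>Q j / p j - c\<bar> \<le> 1" using 0 c by linarith
      then show ?thesis unfolding abs_mult by (intro mult_left_mono) auto
    qed
    finally show ?thesis by simp
  qed
  have split: "(\<Sum>j<q. Q j - p j * c) = - (\<Sum>j. Q (j + q) - p (j + q) * c)"
    using suminf_split_initial_segment[OF sums_summable[OF balance], of q] sums_unique[OF balance] by simp
  have tail: "\<bar>\<Sum>j. Q (j + q) - p (j + q) * c\<bar> \<le> (\<Sum>j. p (j + q))"
  proof -
    have le: "\<bar>Q j - p j * c\<bar> \<le> p j" for j
    proof -
      have "0 \<le> p j * c" "p j * c \<le> p j"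
        using Q[of j] c mult_left_le[of c "p j"] by auto
      then show ?thesis using Q[of j] by linarith
    qed
    have summ: "summable (\<lambda>j. p (j + q))" using p by (intro summable_ignore_initial_segment)
    have summ': "summable (\<lambda>j. \<bar>Q (j + q) - p (j + q) * c\<bar>)"
      by (rule summable_comparison_test'[OF summ]) (use le in auto)
    have "\<bar>\<Sum>j. Q (j + q) - p (j + q) * c\<bar> \<le> (\<Sum>j. \<bar>Q (j + q) - p (j + q) * c\<bar>)"
      by (rule summable_rabs[OF summ'])
    also have "\<dots> \<le> (\<Sum>j. p (j + q))" by (rule suminf_le[OF le summ' summ])
    finally show ?thesis .
  qed
  have "(\<Sum>k\<in>J. \<Sum>j<w k. u k j - c) = (\<Sum>j<n. \<Sum>k\<in>R j. u k j - c)"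
    unfolding R_def by (rule sum_blocks_by_position[OF J w])
  also have "\<dots> = (\<Sum>j<q. \<Sum>k\<in>R j. u k j - c) + (\<Sum>j=q..<n. \<Sum>k\<in>R j. u k j - c)"
    using \<open>q \<le> n\<close> by (subst sum.union_disjoint[symmetric]) (auto intro!: sum.cong)
  also have "(\<Sum>j<q. \<Sum>k\<in>R j. u k j - c)
      = (\<Sum>j<q. (\<Sum>k\<in>R j. u k j - c) - card J * (Q j - p j * c)) - card J * (\<Sum>j. Q (j + q) - p (j + q) * c)"
    unfolding sum_subtractf[of _ "\<lambda>j. card J * (Q j - p j * c)"] sum_distrib_left[symmetric] split by simp
  finally have "(\<Sum>k\<in>J. \<Sum>j<w k. u k j - c)
      = (\<Sum>j<q. (\<Sum>k\<in>R j. u k j - c) - card J * (Q j - p j * c))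
        - card J * (\<Sum>j. Q (j + q) - p (j + q) * c) + (\<Sum>j=q..<n. \<Sum>k\<in>R j. u k j - c)" .
  moreover have "\<bar>a - card J * b + d\<bar> \<le> \<bar>a\<bar> + card J * \<bar>b\<bar> + \<bar>d\<bar>" for a b d :: real
    using abs_triangle_ineq[of "a - card J * b" d] abs_triangle_ineq4[of a "card J * b"]
    by (simp add: abs_mult)
  ultimately have "\<bar>\<Sum>k\<in>J. \<Sum>j<w k. u k j - c\<bar>
      \<le> \<bar>\<Sum>j<q. (\<Sum>k\<in>R j. u k j - c) - card J * (Q j - p j * c)\<bar>
        + card J * \<bar>\<Sum>j. Q (j + q) - p (j + q) * c\<bar> + \<bar>\<Sum>j=q..<n. \<Sum>k\<in>R j. u k j - c\<bar>"
    by simp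
  also have "\<bar>\<Sum>j<q. (\<Sum>k\<in>R j. u k j - c) - card J * (Q j - p j * c)\<bar>
      \<le> (\<Sum>j<q. \<bar>\<Sum>k\<in>R j. u k j - Q j / p j\<bar> + \<bar>real (card (R j)) - card J * p j\<bar>)"
    by (rule order_trans[OF sum_abs]) (intro sum_mono large, simp)
  also have "\<bar>\<Sum>j=q..<n. \<Sum>k\<in>R j. u k j - c\<bar> \<le> (\<Sum>j=q..<n. real (card (R j)))"
    by (rule order_trans[OF sum_abs]) (intro sum_mono small)
  also have "card J * \<bar>\<Sum>j. Q (j + q) - p (j + q) * c\<bar> \<le> card J * (\<Sum>j. p (j + q))"
    by (intro mult_left_mono tail) simp
  finally show ?thesis by simp
qed

text \<open>Evaluates the probability that no tour exceeds a given length and the exponential moment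
  of the number of long tours, as both are expectations of products over tours.\<close>

lemma (in prob_space) expectation_prod_iid:
  fixes f :: "'b \<Rightarrow> real"
  assumes J: "finite J" and indep: "indep_vars (\<lambda>_. N) \<tau> J"
    and law: "\<And>k. k \<in> J \<Longrightarrow> distr M N (\<tau> k) = \<rho>"
    and f[measurable]: "f \<in> borel_measurable N" and bound: "\<And>l. \<bar>f l\<bar> \<le> b"
  shows "expectation (\<lambda>\<omega>. \<Prod>k\<in>J. f (\<tau> k \<omega>)) = (\<integral>l. f l \<partial>\<rho>) ^ card J"
proof -
  have rv[measurable]: "\<tau> k \<in> measurable M N" if "k \<in> J" for k
    using indep that by (auto simp: indep_vars_def)
  have "expectation (\<lambda>\<omega>. \<Prod>k\<in>J. f (\<tau> k \<omega>)) = (\<Prod>k\<in>J. expectation (\<lambda>\<omega>. f (\<tau> k \<omega>)))"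
  proof (rule indep_vars_lebesgue_integral[OF J])
    show "indep_vars (\<lambda>_. borel) (\<lambda>k \<omega>. f (\<tau> k \<omega>)) J"
      by (rule indep_vars_compose2[OF indep]) measurable
    show "integrable M (\<lambda>\<omega>. f (\<tau> k \<omega>))" if "k \<in> J" for k
      by (rule integrable_const_bound[of _ b]) (use bound that in auto)
  qed
  also have "\<dots> = (\<Prod>k\<in>J. \<integral>l. f l \<partial>\<rho>)"
    by (intro prod.cong refl) (simp add: law[symmetric] integral_distr)
  finally show ?thesis by simp
qed

lemma am_gm_sqrt_bound:
  fixes d m :: real
  assumes "0 \<le> d" "0 < m"
  shows "d \<le> sqrt (m / 2) + sqrt (d ^ 4 / m / 8)"
proof -
  \<comment> \<open>The bound is \<open>0 \<le> (d - 2 * a)^2\<close> divided by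
    \<open>4 * a\<close>; this \<open>a\<close> is what the first sum of the theorem can pay
    for.\<close>
  define a where "a = sqrt (m / 2)"
  have a: "0 < a" "a\<^sup>2 = m / 2" using assms by (auto simp: a_def)
  have "d ^ 4 / m / 8 = (d\<^sup>2 / (4 * a))\<^sup>2"
    unfolding power_divide power_mult_distrib a(2) by simp
  then have "sqrt (d ^ 4 / m / 8) = d\<^sup>2 / (4 * a)"
    using assms a by simp
  moreover have "d \<le> a + d\<^sup>2 / (4 * a)"
    using a zero_le_power2[of "d - 2 * a"] by (simp add: field_simps power2_eq_square)
  ultimately show ?thesis by (simp add: a_def)
qed

text \<open>The chain has disappeared: only iid blocks are left, with a length and a real reading
  \<open>Y j\<close> at each position. The target \<open>c\<close> enters through
  \<open>balance\<close>, that is, through the vanishing of the centred sum over one mean block. The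
  parameter \<open>s\<close> stands for \<open>3 / \<delta>\<close>.\<close>

lemma (in prob_space) regenerative_deviation:
  fixes \<tau> :: "nat \<Rightarrow> 'a \<Rightarrow> 'b" and len :: "'b \<Rightarrow> nat" and Y :: "nat \<Rightarrow> 'b \<Rightarrow> real"
    and c :: "real \<Rightarrow> real" and V :: "real set" and s B \<gamma> :: real
  assumes J: "finite J" and indep: "indep_vars (\<lambda>_. N) \<tau> J"
    and law: "\<And>k. k \<in> J \<Longrightarrow> distr M N (\<tau> k) = \<rho>"
    and len[measurable]: "len \<in> measurable N (count_space UNIV)"
    and Y[measurable]: "\<And>j. Y j \<in> borel_measurable N"
    and V: "finite V" "V \<noteq> {}"
  defines "H \<equiv> \<lambda>j. {l \<in> space N. j < len l}"
    and "Q \<equiv> \<lambda>j x. measure \<rho> {l \<in> space N. j < len l \<and> Y j l \<le> x}"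
    and "p \<equiv> \<lambda>j. measure \<rho> {l \<in> space N. j < len l}"
  assumes tail: "\<And>j. p j \<le> B * exp (- \<gamma> * real j)" and p0: "p 0 = 1"
    and c: "\<And>x. 0 \<le> c x" "\<And>x. c x \<le> 1"
    and balance: "\<And>x. (\<lambda>j. Q j x - p j * c x) sums 0"
    and pos: "B > 0" "\<gamma> > 0" and s: "3 < s" "s < real (card J)"
  shows "\<exists>G\<in>events. 1 - 3 / s \<le> prob G \<and> (\<forall>\<omega>\<in>G. \<forall>x\<in>V.
    \<bar>\<Sum>k\<in>J. \<Sum>j<len (\<tau> k \<omega>). of_bool (Y j (\<tau> k \<omega>) \<le> x) - c x\<bar>
    \<le> (\<Sum>j<Max ((\<lambda>k. len (\<tau> k \<omega>)) ` J). sqrt (real (card {k \<in> J. j < len (\<tau> k \<omega>)}) / 2))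
      + sqrt (real (card J) * s) * real (Max ((\<lambda>k. len (\<tau> k \<omega>)) ` J))
      + 2 * sqrt s * (ln (B * real (card J)) / \<gamma> * sqrt (ln s) + 1 / (1 - exp (- \<gamma> / 2))))"
proof -
  define K where "K = real (card J)"
  have K: "0 < K" "s < K" "3 < K" using s by (auto simp: K_def)
  have J_ne: "J \<noteq> {}" using s by auto
  then obtain k0 where k0: "k0 \<in> J" by auto
  have rv[measurable]: "\<tau> k \<in> measurable M N" if "k \<in> J" for k
    using indep that by (auto simp: indep_vars_def)
  interpret \<rho>: prob_space \<rho>
    using law[OF k0] prob_space_distr[OF rv[OF k0]] by simp
  have sets_\<rho>[measurable_cong, simp]: "sets \<rho> = sets N" and space_\<rho>: "space \<rho> = space N"
    using law[OF k0] by auto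
  have H[measurable]: "H j \<in> sets N" for j unfolding H_def by measurable
  have p_H: "p j = measure \<rho> (H j)" for j by (simp add: p_def H_def)
  have p_nonneg: "0 \<le> p j" for j by (simp add: p_def)
  have anti: "antimono p"
    unfolding p_H using H by (intro antimonoI \<rho>.finite_measure_mono) (auto simp: H_def)
  have ln_s: "1 < ln s"
  proof -
    have "exp 1 < s" using s e_less_272 by linarith
    then show ?thesis using s by (metis exp_gt_zero ln_exp ln_less_cancel_iff less_trans zero_less_numeral)
  qed
  have summ: "summable p"
  proof (rule summable_comparison_test'[of "\<lambda>j. B * exp (- \<gamma>) ^ j" 0])
    show "summable (\<lambda>j. B * exp (- \<gamma>) ^ j)"
      using pos by (intro summable_mult summable_geometric) simp
    show "norm (p j) \<le> B * exp (- \<gamma>) ^ j" for j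
      using tail[of j] p_nonneg[of j] by (simp add: exp_of_nat_mult[symmetric] mult.commute)
  qed
  \<comment> \<open>with high probability some tour is longer than \<open>q - 1\<close>, but only few are longer than \<open>q\<close>\<close>
  define q where "q = (LEAST j. K * p j \<le> ln s)"
  have "\<exists>j. K * p j \<le> ln s"
  proof -
    have "(\<lambda>j. K * p j) \<longlonglongrightarrow> K * 0" by (intro tendsto_intros summable_LIMSEQ_zero summ)
    then have "\<forall>\<^sub>F j in sequentially. K * p j < ln s" using ln_s by (intro order_tendstoD(2)[of _ "K * 0"]) auto
    then show ?thesis by (auto simp: eventually_sequentially intro: less_imp_le)
  qed
  then have q: "K * p q \<le> ln s" unfolding q_def by (rule LeastI_ex)
  have below_q: "ln s < K * p j" if "j < q" for j
    using not_less_Least[of j "\<lambda>j. K * p j \<le> ln s"] that by (simp add: q_def)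
  have p_pos: "0 < p j" if "j < q" for j
    using below_q[OF that] ln_s K by (metis less_trans zero_less_mult_pos zero_less_one)
  \<comment> \<open>Hence \<open>q - 1\<close> lies strictly below \<open>q\<close>, and the
    minimality of \<open>q\<close> gives \<open>ln s < K * p (q - 1)\<close>.\<close>
  have "q \<noteq> 0"
  proof
    assume "q = 0"
    then have "K \<le> ln s" using q p0 by simp
    then show False using ln_le_minus_one[of s] s K by linarith
  qed
  define R where "R j \<omega> = {k \<in> J. \<tau> k \<omega> \<in> H j}" for j \<omega>
  have R_eq: "R j \<omega> = {k \<in> J. j < len (\<tau> k \<omega>)}" if "\<omega> \<in> space M" for j \<omega>
    using measurable_space[OF rv that] by (auto simp: R_def H_def)
  have R_card: "real (card (R j \<omega>)) = (\<Sum>k\<in>J. indicator (H j) (\<tau> k \<omega>))" for j \<omega>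
    using J by (simp add: R_def indicator_def[abs_def] of_bool_def[symmetric] Int_def)
  have R_meas[measurable]: "(\<lambda>\<omega>. real (card (R j \<omega>))) \<in> borel_measurable M" for j
    unfolding R_card by measurable
  define D where "D j \<omega> = Max ((\<lambda>x. \<bar>\<Sum>k\<in>R j \<omega>. of_bool (Y j (\<tau> k \<omega>) \<le> x) - Q j x / p j\<bar>) ` V)" for j \<omega>
  have D_meas[measurable]: "D j \<in> borel_measurable M" for j
  proof -
    have "(\<Sum>k\<in>R j \<omega>. of_bool (Y j (\<tau> k \<omega>) \<le> x) - Q j x / p j)
        = (\<Sum>k\<in>J. indicator (H j) (\<tau> k \<omega>) * (of_bool (Y j (\<tau> k \<omega>) \<le> x) - Q j x / p j))" for x \<omega>
      using J unfolding R_def by (intro sum.mono_neutral_cong_left) auto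
    then show ?thesis unfolding D_def
    proof (simp only:, intro borel_measurable_Max V borel_measurable_abs borel_measurable_sum)
      fix x k assume "k \<in> J"
      then have [measurable]: "\<tau> k \<in> measurable M N" by auto
      show "(\<lambda>\<omega>. indicator (H j) (\<tau> k \<omega>) * (of_bool (Y j (\<tau> k \<omega>) \<le> x) - Q j x / p j)) \<in> borel_measurable M"
        by measurable
    qed
  qed
  have D_nonneg: "0 \<le> D j \<omega>" for j \<omega> unfolding D_def using V by (subst Max_ge_iff) auto
  define W where "W j \<omega> = D j \<omega> ^ 4 / real (card (R j \<omega>))" for j \<omega>
  have W_meas[measurable]: "W j \<in> borel_measurable M" for j unfolding W_def by measurable
  have W_nonneg: "0 \<le> W j \<omega>" for j \<omega> by (simp add: W_def)
  have W4: "(\<integral>\<^sup>+ \<omega>. ennreal (W j \<omega>) \<partial>M) \<le> ennreal (4 * K)" for j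
  proof -
    have "{l \<in> space N. j < len l \<and> Y j l \<le> x} = H j \<inter> (Y j -` {..x} \<inter> space N)" for x
      by (auto simp: H_def)
    then show ?thesis
      using conditional_empirical_fourth_moment[OF J indep law H Y V, of j j]
      unfolding W_def D_def R_def K_def Q_def p_H by simp
  qed
  have W: "integrable M (W j)" "expectation (W j) \<le> 4 * K" for j
  proof -
    show "integrable M (W j)"
      using le_less_trans[OF W4[of j] ennreal_less_top] W_nonneg by (intro integrableI_nonneg) auto
    show "expectation (W j) \<le> 4 * K" using K W4 by (intro integral_real_bounded) auto
  qed
  define Z where "Z j \<omega> = real (card (R j \<omega>)) - K * p j" for j \<omega>
  have Z_meas[measurable]: "Z j \<in> borel_measurable M" for j unfolding Z_def by measurable
  have Z: "integrable M (\<lambda>\<omega>. (Z j \<omega>)\<^sup>2)" "expectation (\<lambda>\<omega>. (Z j \<omega>)\<^sup>2) \<le> K / 4" for j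
  proof -
    define X where "X k \<omega> = indicator (H j) (\<tau> k \<omega>) - p j" for k \<omega>
    have Z_X: "Z j \<omega> = (\<Sum>k\<in>J. X k \<omega>)" for \<omega>
      by (simp add: Z_def X_def R_card sum_subtractf K_def)
    have "indep_vars (\<lambda>_. borel) (\<lambda>k \<omega>. (\<lambda>l. indicator (H j) l - p j) (\<tau> k \<omega>)) J"
      by (rule indep_vars_compose2[OF indep]) measurable
    then have X_indep: "indep_vars (\<lambda>_. borel) X J" unfolding X_def by simp
    have ind: "expectation (\<lambda>\<omega>. indicator (H j) (\<tau> k \<omega>)) = p j"
        "integrable M (\<lambda>\<omega>. indicator (H j) (\<tau> k \<omega>) :: real)" if "k \<in> J" for k
    proof -
      have [measurable]: "\<tau> k \<in> measurable M N" using that by auto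
      have "expectation (\<lambda>\<omega>. indicator (H j) (\<tau> k \<omega>) :: real) = (\<integral>l. indicator (H j) l \<partial>distr M N (\<tau> k))"
        by (subst integral_distr) auto
      also have "\<dots> = p j" using sets.sets_into_space[OF H[of j]]
        by (simp add: law[OF that] p_H space_\<rho> Int_absorb1)
      finally show "expectation (\<lambda>\<omega>. indicator (H j) (\<tau> k \<omega>)) = p j" .
      show "integrable M (\<lambda>\<omega>. indicator (H j) (\<tau> k \<omega>) :: real)"
        by (rule integrable_const_bound[of _ 1]) auto
    qed
    have X_sq: "(X k \<omega>)\<^sup>2 = indicator (H j) (\<tau> k \<omega>) * (1 - 2 * p j) + (p j)\<^sup>2" for k \<omega>
      by (simp add: X_def power2_eq_square algebra_simps indicator_def)
    have X2: "integrable M (\<lambda>\<omega>. (X k \<omega>)\<^sup>2)" "expectation (\<lambda>\<omega>. (X k \<omega>)\<^sup>2) \<le> 1 / 4" if "k \<in> J" for k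
    proof -
      show "integrable M (\<lambda>\<omega>. (X k \<omega>)\<^sup>2)" unfolding X_sq using ind[OF that] by simp
      have "expectation (\<lambda>\<omega>. (X k \<omega>)\<^sup>2) = p j * (1 - 2 * p j) + (p j)\<^sup>2"
        unfolding X_sq using ind[OF that] by (simp add: prob_space)
      then show "expectation (\<lambda>\<omega>. (X k \<omega>)\<^sup>2) \<le> 1 / 4"
        using zero_le_power2[of "p j - 1 / 2"] by (simp add: power2_eq_square algebra_simps)
    qed
    have X0: "expectation (X k) = 0" if "k \<in> J" for k
      unfolding X_def using ind[OF that] by (simp add: prob_space)
    show "integrable M (\<lambda>\<omega>. (Z j \<omega>)\<^sup>2)" unfolding Z_X
      by (rule expectation_square_sum_indep(1)[OF J X_indep X2(1) X0])
    have "expectation (\<lambda>\<omega>. (Z j \<omega>)\<^sup>2) = (\<Sum>k\<in>J. expectation (\<lambda>\<omega>. (X k \<omega>)\<^sup>2))" unfolding Z_X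
      by (rule expectation_square_sum_indep(2)[OF J X_indep X2(1) X0])
    also have "\<dots> \<le> (\<Sum>k\<in>J. 1 / 4)" by (intro sum_mono X2)
    finally show "expectation (\<lambda>\<omega>. (Z j \<omega>)\<^sup>2) \<le> K / 4" by (simp add: K_def)
  qed
  \<comment> \<open>Here \<open>W j / 8\<close> is the square of the second summand in
    \<open>am_gm_sqrt_bound\<close>, and the factor 2 comes from squaring a sum of two terms. Each
    position has mean at most \<open>2 * (4 * K / 8 + K / 4) = 3 / 2 * K\<close>, so by Markov's
    inequality the level \<open>q * K * s\<close> is exceeded with probability at most
    \<open>3 / 2 / s\<close>.\<close>
  define U where "U \<omega> = (\<Sum>j<q. 2 * (W j \<omega> / 8 + (Z j \<omega>)\<^sup>2))" for \<omega>
  have U_meas[measurable]: "U \<in> borel_measurable M" unfolding U_def by measurable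
  define G1 where "G1 = {\<omega> \<in> space M. U \<omega> \<ge> real q * K * s}"
  \<comment> \<open>Off this event some tour has length at least \<open>q\<close>, so the truncation
    level does not exceed the maximal tour length.\<close>
  define G2 where "G2 = {\<omega> \<in> space M. R (q - 1) \<omega> = {}}"
  \<comment> \<open>Prepared for an exponential Markov inequality with base 2, where
    \<open>(1 + p q) ^ card J \<le> exp (K * p q) \<le> s\<close>. The threshold
    \<open>5 / 4\<close> is \<open>1 + 1 / 4\<close>: the 1 produces the factor \<open>1 / 2\<close>
    in the probability, and \<open>1 / 4\<close> is the slack in \<open>two_ln_le\<close>.\<close>
  define G3 where "G3 = {\<omega> \<in> space M. 2 ^ card (R q \<omega>) \<ge> 2 powr (s + 5 / 4)}"
  have G1[measurable]: "G1 \<in> events" unfolding G1_def by measurable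
  have G2_alt: "G2 = {\<omega> \<in> space M. real (card (R (q - 1) \<omega>)) = 0}"
    using J by (auto simp: G2_def R_def)
  have G2[measurable]: "G2 \<in> events" unfolding G2_alt by measurable
  have G3_alt: "G3 = {\<omega> \<in> space M. 2 powr real (card (R q \<omega>)) \<ge> 2 powr (s + 5 / 4)}"
    by (simp add: G3_def powr_realpow)
  have G3[measurable]: "G3 \<in> events" unfolding G3_alt by measurable
  have P1: "prob G1 \<le> 3 / 2 / s"
  proof -
    have int_U: "integrable M U" unfolding U_def using W Z by (intro Bochner_Integration.integrable_sum) simp
    have "expectation U = (\<Sum>j<q. 2 * (expectation (W j) / 8 + expectation (\<lambda>\<omega>. (Z j \<omega>)\<^sup>2)))"
      unfolding U_def using W Z by (subst Bochner_Integration.integral_sum) auto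
    also have "\<dots> \<le> (\<Sum>j<q. 3 / 2 * K)"
    proof (rule sum_mono)
      fix j show "2 * (expectation (W j) / 8 + expectation (\<lambda>\<omega>. (Z j \<omega>)\<^sup>2)) \<le> 3 / 2 * K"
        using W(2)[of j] Z(2)[of j] by simp
    qed
    finally have EU: "expectation U \<le> real q * (3 / 2 * K)" by simp
    have c0: "0 < real q * K * s" using \<open>q \<noteq> 0\<close> K s by simp
    have "prob G1 \<le> expectation U / (real q * K * s)"
      unfolding G1_def using W_nonneg
      by (intro integral_Markov_inequality_measure[where A = "{}"] int_U c0) (auto simp: U_def intro!: sum_nonneg)
    also have "\<dots> \<le> real q * (3 / 2 * K) / (real q * K * s)"
      using c0 by (intro divide_right_mono EU) simp
    also have "\<dots> = 3 / 2 / s" using \<open>q \<noteq> 0\<close> K s by simp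
    finally show ?thesis .
  qed
  have int_H: "(\<integral>l. indicator (H j) l \<partial>\<rho>) = p j" for j
    using sets.sets_into_space[OF H[of j]] by (simp add: p_H space_\<rho> Int_absorb1)
  have ind_int: "integrable \<rho> (indicator (H j) :: 'b \<Rightarrow> real)" for j
    by (rule \<rho>.integrable_const_bound[of _ 1]) (auto simp: indicator_def)
  have P2: "prob G2 \<le> 1 / s"
  proof -
    let ?j = "q - 1"
    have "prob G2 = expectation (indicator G2)" by simp
    also have "\<dots> = expectation (\<lambda>\<omega>. \<Prod>k\<in>J. 1 - indicator (H ?j) (\<tau> k \<omega>))"
    proof (rule Bochner_Integration.integral_cong[OF refl])
      fix \<omega> assume "\<omega> \<in> space M"
      show "indicator G2 \<omega> = (\<Prod>k\<in>J. 1 - indicator (H ?j) (\<tau> k \<omega>) :: real)"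
      proof (cases "R ?j \<omega> = {}")
        case True
        then have "(\<Prod>k\<in>J. 1 - indicator (H ?j) (\<tau> k \<omega>) :: real) = (\<Prod>k\<in>J. 1)"
          by (intro prod.cong refl) (auto simp: R_def indicator_def)
        then show ?thesis using True \<open>\<omega> \<in> space M\<close> by (simp add: G2_def)
      next
        case False
        then have "(\<Prod>k\<in>J. 1 - indicator (H ?j) (\<tau> k \<omega>) :: real) = 0"
          using J by (intro prod_zero) (auto simp: R_def intro!: bexI)
        then show ?thesis using False by (simp add: G2_def)
      qed
    qed
    also have "\<dots> = (\<integral>l. 1 - indicator (H ?j) l \<partial>\<rho>) ^ card J"
      by (rule expectation_prod_iid[OF J indep law, where b = 1]) (auto simp: indicator_def)
    also have "(\<integral>l. 1 - indicator (H ?j) l \<partial>\<rho>) = 1 - p ?j"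
      using int_H[of ?j] by (subst Bochner_Integration.integral_diff) (auto simp: \<rho>.prob_space ind_int)
    also have "(1 - p ?j) ^ card J \<le> exp (- p ?j) ^ card J"
      using exp_ge_add_one_self[of "- p ?j"] by (intro power_mono) (auto simp: p_def)
    also have "\<dots> = exp (- (K * p ?j))" by (simp add: K_def exp_of_nat_mult[symmetric])
    also have "\<dots> \<le> exp (- ln s)" using below_q[of ?j] \<open>q \<noteq> 0\<close> by simp
    also have "\<dots> = 1 / s" using s by (simp add: exp_minus field_simps)
    finally show ?thesis .
  qed
  have P3: "prob G3 \<le> 1 / 2 / s"
  proof -
    let ?t = "2 powr (s + 5 / 4) :: real"
    have prod_eq: "2 powr real (card (R q \<omega>)) = (\<Prod>k\<in>J. 1 + indicator (H q) (\<tau> k \<omega>) :: real)" for \<omega>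
    proof -
      have "(\<Prod>k\<in>J. 1 + indicator (H q) (\<tau> k \<omega>) :: real) = (\<Prod>k\<in>R q \<omega>. 2)"
        using J by (intro prod.mono_neutral_cong_right) (auto simp: R_def)
      then show ?thesis by (simp add: powr_realpow)
    qed
    have E: "expectation (\<lambda>\<omega>. 2 powr real (card (R q \<omega>))) = (1 + p q) ^ card J"
    proof -
      have "expectation (\<lambda>\<omega>. 2 powr real (card (R q \<omega>))) = (\<integral>l. 1 + indicator (H q) l \<partial>\<rho>) ^ card J"
        unfolding prod_eq by (rule expectation_prod_iid[OF J indep law, where b = 2]) (auto simp: indicator_def)
      also have "(\<integral>l. 1 + indicator (H q) l \<partial>\<rho>) = 1 + p q"
        using int_H[of q] by (subst Bochner_Integration.integral_add) (auto simp: \<rho>.prob_space ind_int)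
      finally show ?thesis .
    qed
    have "card (R q \<omega>) \<le> card J" for \<omega> using J by (intro card_mono) (auto simp: R_def)
    then have int: "integrable M (\<lambda>\<omega>. 2 powr real (card (R q \<omega>)))"
      by (intro integrable_const_bound[of _ "2 powr real (card J)"]) auto
    have markov: "prob G3 \<le> expectation (\<lambda>\<omega>. 2 powr real (card (R q \<omega>))) / ?t"
      unfolding G3_alt by (intro integral_Markov_inequality_measure[where A = "{}"] int) auto
    have "(1 + p q) ^ card J \<le> exp (p q) ^ card J"
      using exp_ge_add_one_self[of "p q"] p_nonneg[of q] by (intro power_mono) auto
    also have "exp (p q) ^ card J = exp (K * p q)" by (simp add: K_def exp_of_nat_mult[symmetric])
    also have "\<dots> \<le> exp (ln s)" using q by simp
    also have "exp (ln s) = s" using s by simp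
    finally have "(1 + p q) ^ card J / ?t \<le> s / ?t" by (intro divide_right_mono) auto
    then have "prob G3 \<le> s / ?t" using markov unfolding E by linarith
    also have "s / ?t \<le> 1 / 2 / s"
    proof -
      have "ln 2 + 2 * ln s \<le> (s + 5 / 4) * ln 2" using two_ln_le[of s] s by (simp add: algebra_simps)
      then have "exp (ln 2 + 2 * ln s) \<le> ?t" by (simp add: powr_def)
      moreover have "exp (ln 2 + 2 * ln s) = 2 * (s * s)"
      proof -
        have "2 * ln s = ln s + ln s" by simp
        moreover have "exp (ln s) = s" using s by simp
        ultimately show ?thesis by (simp only: exp_add exp_ln zero_less_numeral)
      qed
      ultimately have "2 * (s * s) \<le> ?t" by simp
      then have "s * 2 * s / (?t * 2 * s) \<le> ?t / (?t * 2 * s)"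
        using s by (intro divide_right_mono) (auto simp: mult_ac)
      then show ?thesis using s by simp
    qed
    finally show ?thesis .
  qed
  define G where "G = space M - (G1 \<union> G2 \<union> G3)"
  have "prob (G1 \<union> G2 \<union> G3) \<le> prob G1 + prob G2 + prob G3"
    using measure_Un_le[of "G1 \<union> G2" M G3] measure_Un_le[of G1 M G2] by simp
  \<comment> \<open>The failure probabilities add up as
    \<open>3 / 2 + 1 + 1 / 2 = 3\<close>.\<close>
  also have "\<dots> \<le> 3 / s" using P1 P2 P3 s by (simp add: field_simps)
  finally have "1 - 3 / s \<le> prob G" unfolding G_def by (subst prob_compl) auto
  moreover have "G \<in> events" unfolding G_def by simp
  moreover have "\<bar>\<Sum>k\<in>J. \<Sum>j<len (\<tau> k \<omega>). of_bool (Y j (\<tau> k \<omega>) \<le> x) - c x\<bar>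
    \<le> (\<Sum>j<Max ((\<lambda>k. len (\<tau> k \<omega>)) ` J). sqrt (real (card {k \<in> J. j < len (\<tau> k \<omega>)}) / 2))
      + sqrt (real (card J) * s) * real (Max ((\<lambda>k. len (\<tau> k \<omega>)) ` J))
      + 2 * sqrt s * (ln (B * real (card J)) / \<gamma> * sqrt (ln s) + 1 / (1 - exp (- \<gamma> / 2)))"
    if \<omega>: "\<omega> \<in> G" and x: "x \<in> V" for \<omega> x
  proof -
    have \<omega>_sp: "\<omega> \<in> space M" using \<omega> by (simp add: G_def)
    define n where "n = Max ((\<lambda>k. len (\<tau> k \<omega>)) ` J)"
    define m where "m j = real (card (R j \<omega>))" for j
    have len_le: "len (\<tau> k \<omega>) \<le> n" if "k \<in> J" for k
      unfolding n_def using J that by (intro Max_ge) auto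
    have "R (q - 1) \<omega> \<noteq> {}" using \<omega> \<omega>_sp by (auto simp: G_def G2_def)
    then obtain k1 where k1: "k1 \<in> J" "q - 1 < len (\<tau> k1 \<omega>)" unfolding R_eq[OF \<omega>_sp] by auto
    then have q_n: "q \<le> n" using len_le[OF k1(1)] by linarith
    have m_mono: "m j \<le> m i" if "i \<le> j" for i j
      unfolding m_def R_eq[OF \<omega>_sp] using J that by (intro of_nat_mono card_mono) auto
    have m_pos: "0 < m j" if "j < q" for j
    proof -
      have "R j \<omega> \<noteq> {}" using k1 that by (auto simp: R_eq[OF \<omega>_sp])
      moreover have "finite (R j \<omega>)" using J by (simp add: R_def)
      ultimately show ?thesis by (simp add: m_def card_gt_0_iff)
    qed
    have "2 powr m q < 2 powr (s + 5 / 4)" using \<omega> \<omega>_sp by (auto simp: G_def G3_alt m_def)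
    then have m_q: "m q < s + 5 / 4" by simp
    have s_le: "s \<le> sqrt (K * s)"
      using s K by (intro real_le_rsqrt) (auto simp: power2_eq_square)
    \<comment> \<open>If \<open>m j\<close> exceeds \<open>s\<close>, then as an integer it is at
      least 4, so \<open>sqrt (m j / 2)\<close> covers the excess \<open>5 / 4\<close> left open by
      \<open>m_q\<close>.\<close>
    have high: "m j \<le> sqrt (m j / 2) + sqrt (K * s)" if "q \<le> j" for j
    proof (cases "m j \<le> s")
      case True
      have "0 \<le> sqrt (m j / 2)" by (simp add: m_def)
      then show ?thesis using True s_le by linarith
    next
      case False
      then have "3 < card (R j \<omega>)" using s unfolding m_def by linarith
      then have "(5 / 4)\<^sup>2 \<le> m j / 2" unfolding m_def by (simp add: power2_eq_square)
      then have "5 / 4 \<le> sqrt (m j / 2)" by (rule real_le_rsqrt)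
      then show ?thesis using m_mono[OF that] m_q s_le by linarith
    qed
    have low: "\<bar>\<Sum>k\<in>R j \<omega>. of_bool (Y j (\<tau> k \<omega>) \<le> x) - Q j x / p j\<bar> \<le> sqrt (m j / 2) + sqrt (W j \<omega> / 8)"
      if "j < q" for j
    proof -
      have "\<bar>\<Sum>k\<in>R j \<omega>. of_bool (Y j (\<tau> k \<omega>) \<le> x) - Q j x / p j\<bar> \<le> D j \<omega>"
        unfolding D_def using V x by (intro Max_ge) auto
      also have "\<dots> \<le> sqrt (m j / 2) + sqrt (W j \<omega> / 8)"
        unfolding W_def m_def[symmetric] by (rule am_gm_sqrt_bound[OF D_nonneg m_pos[OF that]])
      finally show ?thesis .
    qed
    have fluct: "(\<Sum>j<q. sqrt (W j \<omega> / 8) + \<bar>Z j \<omega>\<bar>) \<le> real q * sqrt (K * s)"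
    proof (rule power2_le_imp_le)
      have "(\<Sum>j<q. sqrt (W j \<omega> / 8) + \<bar>Z j \<omega>\<bar>)\<^sup>2
          \<le> real q * (\<Sum>j<q. 2 * ((sqrt (W j \<omega> / 8))\<^sup>2 + \<bar>Z j \<omega>\<bar>\<^sup>2))"
        by (rule square_sum_le_card)
      also have "(\<Sum>j<q. 2 * ((sqrt (W j \<omega> / 8))\<^sup>2 + \<bar>Z j \<omega>\<bar>\<^sup>2)) = U \<omega>"
        unfolding U_def using W_nonneg by (intro sum.cong refl) simp
      also have "real q * U \<omega> \<le> real q * (real q * K * s)"
        using \<omega> \<omega>_sp by (intro mult_left_mono) (auto simp: G_def G1_def)
      also have "\<dots> = (real q * sqrt (K * s))\<^sup>2" using K s by (simp add: power2_eq_square)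
      finally show "(\<Sum>j<q. sqrt (W j \<omega> / 8) + \<bar>Z j \<omega>\<bar>)\<^sup>2 \<le> (real q * sqrt (K * s))\<^sup>2" .
    qed (use K s in simp)
    have Q_le: "Q j x \<le> p j" for j
      unfolding Q_def p_def by (rule \<rho>.finite_measure_mono) auto
    have "\<bar>\<Sum>k\<in>J. \<Sum>j<len (\<tau> k \<omega>). of_bool (Y j (\<tau> k \<omega>) \<le> x) - c x\<bar>
      \<le> (\<Sum>j<q. \<bar>\<Sum>k\<in>{k \<in> J. j < len (\<tau> k \<omega>)}. of_bool (Y j (\<tau> k \<omega>) \<le> x) - Q j x / p j\<bar>
            + \<bar>real (card {k \<in> J. j < len (\<tau> k \<omega>)}) - card J * p j\<bar>)
        + (\<Sum>j=q..<n. real (card {k \<in> J. j < len (\<tau> k \<omega>)})) + card J * (\<Sum>j. p (j + q))"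
      by (rule block_sum_decomposition[where n = n, OF J len_le q_n])
        (use c summ p_pos Q_le balance in \<open>auto simp: Q_def\<close>)
    also have "\<dots> = (\<Sum>j<q. \<bar>\<Sum>k\<in>R j \<omega>. of_bool (Y j (\<tau> k \<omega>) \<le> x) - Q j x / p j\<bar> + \<bar>Z j \<omega>\<bar>)
        + (\<Sum>j=q..<n. m j) + K * (\<Sum>j. p (j + q))"
      unfolding R_eq[OF \<omega>_sp, symmetric] Z_def m_def K_def ..
    also have "(\<Sum>j<q. \<bar>\<Sum>k\<in>R j \<omega>. of_bool (Y j (\<tau> k \<omega>) \<le> x) - Q j x / p j\<bar> + \<bar>Z j \<omega>\<bar>)
        \<le> (\<Sum>j<q. sqrt (m j / 2) + (sqrt (W j \<omega> / 8) + \<bar>Z j \<omega>\<bar>))"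
      using low by (intro sum_mono) force
    also have "\<dots> = (\<Sum>j<q. sqrt (m j / 2)) + (\<Sum>j<q. sqrt (W j \<omega> / 8) + \<bar>Z j \<omega>\<bar>)"
      by (rule sum.distrib)
    also note fluct
    also have "(\<Sum>j=q..<n. m j) \<le> (\<Sum>j=q..<n. sqrt (m j / 2) + sqrt (K * s))"
      using high by (intro sum_mono) auto
    also have "\<dots> = (\<Sum>j=q..<n. sqrt (m j / 2)) + (real n - real q) * sqrt (K * s)"
      using q_n by (simp add: sum.distrib of_nat_diff)
    also have "K * (\<Sum>j. p (j + q)) \<le> 2 * sqrt s * (ln (B * K) / \<gamma> * sqrt (ln s) + 1 / (1 - exp (- \<gamma> / 2)))"
    proof (rule tail_sum_bound[OF p_nonneg anti tail q pos(2,1)])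
      have "1 \<le> B" using tail[of 0] p0 by simp
      then show "1 \<le> B * K" using mult_mono[of 1 B 1 K] K by simp
    qed (use K s in auto)
    finally have bound: "\<bar>\<Sum>k\<in>J. \<Sum>j<len (\<tau> k \<omega>). of_bool (Y j (\<tau> k \<omega>) \<le> x) - c x\<bar>
      \<le> (\<Sum>j<q. sqrt (m j / 2)) + real q * sqrt (K * s)
        + ((\<Sum>j=q..<n. sqrt (m j / 2)) + (real n - real q) * sqrt (K * s))
        + 2 * sqrt s * (ln (B * K) / \<gamma> * sqrt (ln s) + 1 / (1 - exp (- \<gamma> / 2)))"
      by simp
    \<comment> \<open>The positions below and from \<open>q\<close> on each carry
      \<open>sqrt (K * s)\<close>; joined, they give the factor \<open>n\<close>, the maximal tour
      length.\<close>
    have "{..<n} = {..<q} \<union> {q..<n}" using q_n by auto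
    then have "(\<Sum>j<n. sqrt (m j / 2)) = (\<Sum>j<q. sqrt (m j / 2)) + (\<Sum>j=q..<n. sqrt (m j / 2))"
      by (simp add: sum.union_disjoint ivl_disj_int)
    moreover have "real q * sqrt (K * s) + (real n - real q) * sqrt (K * s) = sqrt (K * s) * real n"
      by (simp add: algebra_simps)
    ultimately have "\<bar>\<Sum>k\<in>J. \<Sum>j<len (\<tau> k \<omega>). of_bool (Y j (\<tau> k \<omega>) \<le> x) - c x\<bar>
      \<le> (\<Sum>j<n. sqrt (m j / 2)) + sqrt (K * s) * real n
        + 2 * sqrt s * (ln (B * K) / \<gamma> * sqrt (ln s) + 1 / (1 - exp (- \<gamma> / 2)))"
      using bound by linarith
    then show ?thesis unfolding n_def[symmetric] K_def m_def R_eq[OF \<omega>_sp] .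
  qed
  ultimately show ?thesis by blast
qed

section \<open>Regenerative processes and Kac's formula\<close>

lemma mem_listset_iff: "l \<in> listset As \<longleftrightarrow> length l = length As \<and> (\<forall>i<length As. l ! i \<in> As ! i)"
proof (induction As arbitrary: l)
  case (Cons A As)
  then show ?case by (cases l) (auto simp: set_Cons_def All_less_Suc2)
qed simp

lemma space_finseq_space: "space (finseq_space S) = lists (space S)"
  and sets_finseq_space: "sets (finseq_space S) = sigma_sets (lists (space S)) (listset ` lists (sets S))"
proof -
  have "x \<in> space S" if "As \<in> lists (sets S)" "l \<in> listset As" "x \<in> set l" for As l x
  proof -
    from that obtain i where "i < length As" "x = l ! i" "l ! i \<in> As ! i"
      by (auto simp: mem_listset_iff in_set_conv_nth)
    moreover from this that have "As ! i \<in> sets S" by (auto simp: in_lists_conv_set)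
    ultimately show "x \<in> space S" using sets.sets_into_space by blast
  qed
  then have "listset ` lists (sets S) \<subseteq> Pow (lists (space S))" by (auto simp: in_lists_conv_set)
  then show "space (finseq_space S) = lists (space S)"
    and "sets (finseq_space S) = sigma_sets (lists (space S)) (listset ` lists (sets S))"
    unfolding finseq_space_def by (simp_all add: space_measure_of sets_measure_of)
qed

lemma listset_in_finseq_space: "As \<in> lists (sets S) \<Longrightarrow> listset As \<in> sets (finseq_space S)"
  unfolding sets_finseq_space by (rule sigma_sets.Basic) auto

text \<open>Sorting by length gives a countable union of rectangles, all of whose sides are the
  whole space except the one at \<open>j\<close>.\<close>

lemma finseq_nth_in_sets:
  assumes A: "A \<in> sets S"
  shows "{l \<in> space (finseq_space S). j < length l \<and> l ! j \<in> A} \<in> sets (finseq_space S)"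
proof -
  have "{l \<in> space (finseq_space S). j < length l \<and> l ! j \<in> A}
      = (\<Union>n\<in>{j<..}. listset ((replicate n (space S))[j := A]))"
  proof (intro equalityI subsetI)
    fix l assume "l \<in> {l \<in> space (finseq_space S). j < length l \<and> l ! j \<in> A}"
    then have "j < length l" "l \<in> listset ((replicate (length l) (space S))[j := A])"
      by (auto simp: mem_listset_iff space_finseq_space nth_list_update in_lists_conv_set)
    then show "l \<in> (\<Union>n\<in>{j<..}. listset ((replicate n (space S))[j := A]))" by blast
  next
    fix l assume "l \<in> (\<Union>n\<in>{j<..}. listset ((replicate n (space S))[j := A]))"
    then have l: "j < length l" "\<forall>i<length l. l ! i \<in> (if i = j then A else space S)"
      by (auto simp: mem_listset_iff nth_list_update)
    then have "\<forall>i<length l. l ! i \<in> space S" using sets.sets_into_space[OF A] by (auto split: if_splits)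
    then have "set l \<subseteq> space S" by (auto simp: in_set_conv_nth)
    then show "l \<in> {l \<in> space (finseq_space S). j < length l \<and> l ! j \<in> A}"
      using l by (auto simp: space_finseq_space in_lists_conv_set)
  qed
  also have "\<dots> \<in> sets (finseq_space S)"
  proof (rule sets.countable_UN'')
    fix n
    have "(replicate n (space S))[j := A] \<in> lists (sets S)"
      using A set_update_subset_insert[of "replicate n (space S)" j A]
      by (auto simp: in_lists_conv_set set_replicate_conv_if split: if_splits)
    then show "listset ((replicate n (space S))[j := A]) \<in> sets (finseq_space S)"
      by (rule listset_in_finseq_space)
  qed auto
  finally show ?thesis .
qed

lemma measurable_length_finseq [measurable]: "length \<in> measurable (finseq_space S) (count_space UNIV)"
proof (rule measurable_count_space_eq_countable[THEN iffD2], safe)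
  fix n :: nat
  have "length -` {n} \<inter> space (finseq_space S) = listset (replicate n (space S))"
    by (auto simp: mem_listset_iff space_finseq_space in_lists_conv_set) (auto simp: in_set_conv_nth)
  also have "\<dots> \<in> sets (finseq_space S)" by (rule listset_in_finseq_space) auto
  finally show "length -` {n} \<inter> space (finseq_space S) \<in> sets (finseq_space S)" .
qed auto

text \<open>The value 0 beyond the end makes the reading total; wherever it is used,
  \<open>j < length l\<close> guards it.\<close>

lemma borel_measurable_finseq_nth [measurable]:
  fixes f :: "'x \<Rightarrow> real"
  assumes [measurable]: "f \<in> borel_measurable S"
  shows "(\<lambda>l. if j < length l then f (l ! j) else 0) \<in> borel_measurable (finseq_space S)"
proof (rule measurableI)
  fix B :: "real set" assume [measurable]: "B \<in> sets borel"
  let ?N = "finseq_space S"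
  have "(\<lambda>l. if j < length l then f (l ! j) else 0) -` B \<inter> space ?N
      = {l \<in> space ?N. j < length l \<and> l ! j \<in> f -` B \<inter> space S}
        \<union> (if 0 \<in> B then {l \<in> space ?N. \<not> j < length l} else {})"
    by (auto simp: space_finseq_space in_lists_conv_set split: if_splits)
  also have "\<dots> \<in> sets ?N"
    by (intro sets.Un finseq_nth_in_sets) auto
  finally show "(\<lambda>l. if j < length l then f (l ! j) else 0) -` B \<inter> space ?N \<in> sets ?N" .
qed simp

lemma sum_of_odd: "(\<Sum>j<n. 2 * real j + 1) = (real n)\<^sup>2"
  by (induction n) (auto simp: power2_eq_square algebra_simps)

section \<open>Moments of tours and a weak law of large numbers for visits\<close>

locale regenerative_process = prob_space P
  for P :: "'w measure" +
  fixes S :: "'x measure" and X :: "nat \<Rightarrow> 'w \<Rightarrow> 'x" and T :: "nat \<Rightarrow> 'w \<Rightarrow> nat" and B \<gamma> :: real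
  assumes X_meas [measurable]: "\<And>t. X t \<in> measurable P S"
    and T_meas [measurable]: "\<And>k. T k \<in> measurable P (count_space UNIV)"
    and T_0: "\<And>\<omega>. \<omega> \<in> space P \<Longrightarrow> T 0 \<omega> = 0"
    and T_less: "\<And>\<omega> k. \<omega> \<in> space P \<Longrightarrow> T k \<omega> < T (Suc k) \<omega>"
    and tours: "iid_tours P S X T"
    and \<gamma>: "\<gamma> > 0"
    and tail: "\<And>t::nat. prob {\<omega> \<in> space P. T 1 \<omega> > t} \<le> B * exp (- \<gamma> * real t)"
begin

text \<open>The numerator in Kac's formula, the unnormalised occupation functional of the first
  tour.\<close>

definition visits :: "('x \<Rightarrow> real) \<Rightarrow> real" where
  "visits f = expectation (\<lambda>\<omega>. \<Sum>t<T 1 \<omega>. f (X t \<omega>))"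

lemma length_tour: "length (tour X T k \<omega>) = tour_length T k \<omega>"
  by (simp add: tour_def path_segment_def tour_length_def)

lemma nth_tour: "j < tour_length T k \<omega> \<Longrightarrow> tour X T k \<omega> ! j = X (T (k - 1) \<omega> + j) \<omega>"
  by (simp add: tour_def path_segment_def tour_length_def)

lemma sum_up_to_regeneration:
  assumes "\<omega> \<in> space P"
  shows "(\<Sum>t<T K \<omega>. f (X t \<omega>)) = (\<Sum>k=1..K. \<Sum>j<tour_length T k \<omega>. f (tour X T k \<omega> ! j))"
proof (induction K)
  case 0
  then show ?case using T_0[OF assms] by simp
next
  case (Suc K)
  have "(\<Sum>t<T (Suc K) \<omega>. f (X t \<omega>)) = (\<Sum>t<T K \<omega>. f (X t \<omega>)) + (\<Sum>t=T K \<omega>..<T (Suc K) \<omega>. f (X t \<omega>))"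
    using T_less[OF assms, of K] by (simp add: lessThan_atLeast0 sum.atLeastLessThan_concat)
  also have "(\<Sum>t=T K \<omega>..<T (Suc K) \<omega>. f (X t \<omega>)) = (\<Sum>j<tour_length T (Suc K) \<omega>. f (X (T K \<omega> + j) \<omega>))"
    using T_less[OF assms, of K] sum.shift_bounds_nat_ivl[of "\<lambda>t. f (X t \<omega>)" 0 "T K \<omega>" "T (Suc K) \<omega> - T K \<omega>"]
    by (simp add: tour_length_def lessThan_atLeast0 add.commute)
  also have "\<dots> = (\<Sum>j<tour_length T (Suc K) \<omega>. f (tour X T (Suc K) \<omega> ! j))"
    by (intro sum.cong refl) (simp add: nth_tour)
  finally show ?case using Suc by simp
qed

lemma T_eq_sum: "\<omega> \<in> space P \<Longrightarrow> T K \<omega> = (\<Sum>k=1..K. tour_length T k \<omega>)"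
  using sum_up_to_regeneration[of \<omega> "\<lambda>_. 1 :: nat" K] by simp

lemma tour_indep: "indep_vars (\<lambda>_. finseq_space S) (tour X T) {1..K}"
  using tours by (auto simp: iid_tours_def intro: indep_vars_subset)

lemma tour_law: "k \<ge> 1 \<Longrightarrow> distr P (finseq_space S) (tour X T k) = distr P (finseq_space S) (tour X T 1)"
  using tours unfolding iid_tours_def by blast

lemma tour_meas [measurable]: "k \<ge> 1 \<Longrightarrow> tour X T k \<in> measurable P (finseq_space S)"
  using tours unfolding iid_tours_def indep_vars_def by simp

lemma tail_summable:
  "summable (\<lambda>j. (2 * real j + 1) * prob {\<omega> \<in> space P. T 1 \<omega> > j})"
proof (rule summable_comparison_test'[of "\<lambda>j. 2 * B * (of_nat (Suc j) * exp (- \<gamma>) ^ j)" 0])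
  show "summable (\<lambda>j. 2 * B * (of_nat (Suc j) * exp (- \<gamma>) ^ j))"
    using \<gamma> geometric_deriv_sums[of "exp (- \<gamma>)"] by (intro summable_mult) (auto simp: sums_iff)
  fix j
  have "(2 * real j + 1) * prob {\<omega> \<in> space P. T 1 \<omega> > j} \<le> (2 * real (Suc j)) * (B * exp (- \<gamma> * real j))"
    by (intro mult_mono tail) auto
  also have "exp (- \<gamma> * real j) = exp (- \<gamma>) ^ j" by (simp add: exp_of_nat_mult[symmetric] mult.commute)
  finally show "norm ((2 * real j + 1) * prob {\<omega> \<in> space P. T 1 \<omega> > j})
      \<le> 2 * B * (of_nat (Suc j) * exp (- \<gamma>) ^ j)"
    by (simp add: algebra_simps)
qed

lemma weighted_visits_sums:
  fixes f :: "'x \<Rightarrow> real"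
  assumes [measurable]: "f \<in> borel_measurable S" and f: "\<And>x. 0 \<le> f x" "\<And>x. f x \<le> 1"
    and a: "\<And>j. 0 \<le> a j" "\<And>j. a j \<le> 2 * real j + 1"
  shows "integrable P (\<lambda>\<omega>. \<Sum>t<T 1 \<omega>. a t * f (X t \<omega>))"
    and "(\<lambda>j. expectation (\<lambda>\<omega>. of_bool (j < T 1 \<omega>) * (a j * f (X j \<omega>))))
      sums expectation (\<lambda>\<omega>. \<Sum>t<T 1 \<omega>. a t * f (X t \<omega>))"
proof -
  define g where "g j \<omega> = of_bool (j < T 1 \<omega>) * (a j * f (X j \<omega>))" for j \<omega>
  have g_nonneg: "0 \<le> g j \<omega>" for j \<omega> using f a by (simp add: g_def)
  have af: "a j * f x \<le> 2 * real j + 1" for j x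
    using mult_mono[OF a(2)[of j] f(2)[of x]] f(1)[of x] by simp
  have [measurable]: "g j \<in> borel_measurable P" for j unfolding g_def by measurable
  have int: "integrable P (g j)" for j
    by (rule integrable_const_bound[of _ "2 * real j + 1"]) (use af a f in \<open>auto simp: g_def\<close>)
  have suminf: "(\<Sum>j. g j \<omega>) = (\<Sum>t<T 1 \<omega>. a t * f (X t \<omega>))" for \<omega>
    by (subst suminf_finite[of "{..<T 1 \<omega>}"]) (auto simp: g_def)
  have summ: "summable (\<lambda>j. norm (g j \<omega>))" for \<omega>
    by (rule summable_finite[of "{..<T 1 \<omega>}"]) (auto simp: g_def)
  have "expectation (\<lambda>\<omega>. norm (g j \<omega>)) \<le> (2 * real j + 1) * prob {\<omega> \<in> space P. T 1 \<omega> > j}" for j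
  proof -
    have "expectation (\<lambda>\<omega>. norm (g j \<omega>)) \<le> expectation (\<lambda>\<omega>. (2 * real j + 1) * indicator {\<omega> \<in> space P. T 1 \<omega> > j} \<omega>)"
    proof (rule integral_mono)
      show "integrable P (\<lambda>\<omega>. norm (g j \<omega>))" using int by (rule integrable_norm)
      show "integrable P (\<lambda>\<omega>. (2 * real j + 1) * indicator {\<omega> \<in> space P. T 1 \<omega> > j} \<omega>)"
        by (rule integrable_const_bound[of _ "2 * real j + 1"]) (auto simp: indicator_def)
      show "norm (g j \<omega>) \<le> (2 * real j + 1) * indicator {\<omega> \<in> space P. T 1 \<omega> > j} \<omega>" if "\<omega> \<in> space P" for \<omega>
        using g_nonneg[of j \<omega>] af that by (auto simp: g_def)
    qed
    also have "\<dots> = (2 * real j + 1) * prob {\<omega> \<in> space P. T 1 \<omega> > j}" by simp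
    finally show ?thesis .
  qed
  then have summ': "summable (\<lambda>j. expectation (\<lambda>\<omega>. norm (g j \<omega>)))"
    by (intro summable_comparison_test'[OF tail_summable, of 0]) simp
  show "integrable P (\<lambda>\<omega>. \<Sum>t<T 1 \<omega>. a t * f (X t \<omega>))"
    using integrable_suminf[OF int _ summ'] summ by (simp add: suminf)
  show "(\<lambda>j. expectation (\<lambda>\<omega>. of_bool (j < T 1 \<omega>) * (a j * f (X j \<omega>))))
      sums expectation (\<lambda>\<omega>. \<Sum>t<T 1 \<omega>. a t * f (X t \<omega>))"
    using sums_integral[OF int _ summ'] summ unfolding suminf by (simp add: g_def)
qed

lemma visits_sums:
  fixes f :: "'x \<Rightarrow> real"
  assumes "f \<in> borel_measurable S" "\<And>x. 0 \<le> f x" "\<And>x. f x \<le> 1"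
  shows "integrable P (\<lambda>\<omega>. \<Sum>t<T 1 \<omega>. f (X t \<omega>))"
    and "(\<lambda>j. expectation (\<lambda>\<omega>. of_bool (j < T 1 \<omega>) * f (X j \<omega>))) sums visits f"
  using weighted_visits_sums[of f "\<lambda>_. 1"] assms by (auto simp: visits_def)

lemma T_square_integrable: "integrable P (\<lambda>\<omega>. (real (T 1 \<omega>))\<^sup>2)"
  using weighted_visits_sums(1)[of "\<lambda>_. 1" "\<lambda>j. 2 * real j + 1"] by (simp add: sum_of_odd)

lemma T_integrable: "integrable P (\<lambda>\<omega>. real (T 1 \<omega>))"
  by (rule square_integrable_imp_integrable[OF _ T_square_integrable]) measurable

text \<open>
  The weak law of large numbers in the form needed for Kac's formula: comparing \<open>n\<close> with
  \<open>T\<^sub>K\<close>, whose fluctuations are of order \<open>\<surd>K\<close>.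
\<close>

lemma visits_ergodic_bound:
  fixes f :: "'x \<Rightarrow> real" and K :: nat
  assumes [measurable]: "f \<in> borel_measurable S" and f: "\<And>x. 0 \<le> f x" "\<And>x. f x \<le> 1"
  defines "n \<equiv> nat \<lfloor>real K * expectation (\<lambda>\<omega>. real (T 1 \<omega>))\<rfloor>"
  shows "\<bar>(\<Sum>t<n. expectation (\<lambda>\<omega>. f (X t \<omega>))) - real K * visits f\<bar>
    \<le> sqrt (real K * variance (\<lambda>\<omega>. real (T 1 \<omega>))) + 1"
proof -
  define \<mu> where "\<mu> = expectation (\<lambda>\<omega>. real (T 1 \<omega>))"
  let ?N = "finseq_space S"
  define W where "W k \<omega> = real (length (tour X T k \<omega>)) - \<mu>" for k \<omega>
  define F where "F l = (\<Sum>j<length l. if j < length l then f (l ! j) else 0)" for l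
  have [measurable]: "F \<in> borel_measurable ?N"
    unfolding F_def by (rule measurable_compose_countable[where g = length]) measurable
  have T1: "tour_length T (Suc 0) \<omega> = T (Suc 0) \<omega>" if "\<omega> \<in> space P" for \<omega>
    using T_0[OF that] by (simp add: tour_length_def)
  have transfer: "integrable P (\<lambda>\<omega>. g (tour X T k \<omega>)) \<longleftrightarrow> integrable P (\<lambda>\<omega>. g (tour X T 1 \<omega>))"
      "expectation (\<lambda>\<omega>. g (tour X T k \<omega>)) = expectation (\<lambda>\<omega>. g (tour X T 1 \<omega>))"
    if "k \<ge> 1" and [measurable]: "g \<in> borel_measurable ?N" for k and g :: "'x list \<Rightarrow> real"
    using that tour_law[of k] tour_meas[of k] tour_meas[of 1]
    by (metis integrable_distr_eq order_refl, metis integral_distr order_refl)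
  have W1: "integrable P (\<lambda>\<omega>. (real (length (tour X T 1 \<omega>)) - \<mu>)\<^sup>2)"
      "expectation (\<lambda>\<omega>. (real (length (tour X T 1 \<omega>)) - \<mu>)\<^sup>2) = variance (\<lambda>\<omega>. real (T 1 \<omega>))"
      "expectation (\<lambda>\<omega>. real (length (tour X T 1 \<omega>)) - \<mu>) = 0"
  proof -
    have "integrable P (\<lambda>\<omega>. (real (T 1 \<omega>) - \<mu>)\<^sup>2)"
      using T_square_integrable T_integrable unfolding power2_diff by simp
    then show "integrable P (\<lambda>\<omega>. (real (length (tour X T 1 \<omega>)) - \<mu>)\<^sup>2)"
      by (rule Bochner_Integration.integrable_cong[THEN iffD1, OF refl, rotated]) (simp add: length_tour T1)
    show "expectation (\<lambda>\<omega>. (real (length (tour X T 1 \<omega>)) - \<mu>)\<^sup>2) = variance (\<lambda>\<omega>. real (T 1 \<omega>))"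
      unfolding \<mu>_def[symmetric] by (rule Bochner_Integration.integral_cong) (simp_all add: length_tour T1)
    have "expectation (\<lambda>\<omega>. real (length (tour X T 1 \<omega>)) - \<mu>) = expectation (\<lambda>\<omega>. real (T 1 \<omega>) - \<mu>)"
      by (rule Bochner_Integration.integral_cong) (simp_all add: length_tour T1)
    also have "\<dots> = 0" using T_integrable by (simp add: \<mu>_def prob_space)
    finally show "expectation (\<lambda>\<omega>. real (length (tour X T 1 \<omega>)) - \<mu>) = 0" .
  qed
  have W_indep: "indep_vars (\<lambda>_. borel) W {1..K}"
  proof -
    have "indep_vars (\<lambda>_. borel) (\<lambda>k \<omega>. (\<lambda>l. real (length l) - \<mu>) (tour X T k \<omega>)) {1..K}"
      by (rule indep_vars_compose2[OF tour_indep]) measurable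
    then show ?thesis unfolding W_def by simp
  qed
  have W: "integrable P (\<lambda>\<omega>. (W k \<omega>)\<^sup>2)" "expectation (W k) = 0"
      "expectation (\<lambda>\<omega>. (W k \<omega>)\<^sup>2) = variance (\<lambda>\<omega>. real (T 1 \<omega>))" if "k \<in> {1..K}" for k
    using that W1 transfer[of k "\<lambda>l. (real (length l) - \<mu>)\<^sup>2"] transfer[of k "\<lambda>l. real (length l) - \<mu>"]
    by (simp_all add: W_def[abs_def])
  have TK: "real (T K \<omega>) - real K * \<mu> = (\<Sum>k=1..K. W k \<omega>)" if "\<omega> \<in> space P" for \<omega>
    using T_eq_sum[OF that, of K] by (simp add: W_def length_tour sum_subtractf)
  have sq_int: "integrable P (\<lambda>\<omega>. (\<Sum>k=1..K. W k \<omega>)\<^sup>2)"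
    by (rule expectation_square_sum_indep(1)[OF _ W_indep]) (use W in auto)
  have sq: "expectation (\<lambda>\<omega>. (\<Sum>k=1..K. W k \<omega>)\<^sup>2) = real K * variance (\<lambda>\<omega>. real (T 1 \<omega>))"
    using W by (subst expectation_square_sum_indep(2)[OF _ W_indep]) auto
  have W_meas: "(\<lambda>\<omega>. \<Sum>k=1..K. W k \<omega>) \<in> borel_measurable P"
    using W_indep unfolding indep_vars_def by (intro borel_measurable_sum) auto
  have sum_int: "integrable P (\<lambda>\<omega>. \<Sum>k=1..K. W k \<omega>)"
    by (rule square_integrable_imp_integrable[OF W_meas sq_int])
  have abs_le: "expectation (\<lambda>\<omega>. \<bar>\<Sum>k=1..K. W k \<omega>\<bar>) \<le> sqrt (real K * variance (\<lambda>\<omega>. real (T 1 \<omega>)))"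
  proof (rule real_le_rsqrt)
    have "(expectation (\<lambda>\<omega>. \<bar>\<Sum>k=1..K. W k \<omega>\<bar>))\<^sup>2 \<le> expectation (\<lambda>\<omega>. \<bar>\<Sum>k=1..K. W k \<omega>\<bar>\<^sup>2)"
    proof -
      let ?Y = "\<lambda>\<omega>. \<bar>\<Sum>k=1..K. W k \<omega>\<bar>"
      have "variance ?Y = expectation (\<lambda>\<omega>. (?Y \<omega>)\<^sup>2) - (expectation ?Y)\<^sup>2"
        using sum_int sq_int by (intro variance_eq) auto
      then show ?thesis using variance_positive[of ?Y] by linarith
    qed
    then show "(expectation (\<lambda>\<omega>. \<bar>\<Sum>k=1..K. W k \<omega>\<bar>))\<^sup>2 \<le> real K * variance (\<lambda>\<omega>. real (T 1 \<omega>))"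
      by (simp only: sq power2_abs)
  qed
  have F_eq: "F (tour X T k \<omega>) = (\<Sum>j<tour_length T k \<omega>. f (tour X T k \<omega> ! j))" for k \<omega>
    unfolding F_def length_tour by (intro sum.cong refl) simp
  have F1_eq: "F (tour X T (Suc 0) \<omega>) = (\<Sum>t<T (Suc 0) \<omega>. f (X t \<omega>))" if "\<omega> \<in> space P" for \<omega>
    unfolding F_eq using sum_up_to_regeneration[OF that, of f 1] by simp
  have F1: "integrable P (\<lambda>\<omega>. F (tour X T 1 \<omega>))" "expectation (\<lambda>\<omega>. F (tour X T 1 \<omega>)) = visits f"
  proof -
    show "integrable P (\<lambda>\<omega>. F (tour X T 1 \<omega>))"
      using visits_sums(1)[OF assms(1) f] by (rule Bochner_Integration.integrable_cong[THEN iffD1, OF refl, rotated]) (simp add: F1_eq)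
    show "expectation (\<lambda>\<omega>. F (tour X T 1 \<omega>)) = visits f"
      unfolding visits_def by (rule Bochner_Integration.integral_cong) (simp_all add: F1_eq)
  qed
  have F: "integrable P (\<lambda>\<omega>. F (tour X T k \<omega>))" "expectation (\<lambda>\<omega>. F (tour X T k \<omega>)) = visits f"
    if "k \<in> {1..K}" for k
    using that F1 transfer[of k F] by auto
  define A where "A \<omega> = (\<Sum>k=1..K. F (tour X T k \<omega>))" for \<omega>
  have A: "integrable P A" "expectation A = real K * visits f"
    unfolding A_def using F by (auto simp: Bochner_Integration.integral_sum)
  have A_eq: "A \<omega> = (\<Sum>t<T K \<omega>. f (X t \<omega>))" if "\<omega> \<in> space P" for \<omega>
    unfolding A_def F_eq sum_up_to_regeneration[OF that] ..
  have f_int: "integrable P (\<lambda>\<omega>. f (X t \<omega>))" for t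
    by (rule integrable_const_bound[of _ 1]) (use f in auto)
  define D where "D \<omega> = (\<Sum>t<n. f (X t \<omega>))" for \<omega>
  have D: "integrable P D" "expectation D = (\<Sum>t<n. expectation (\<lambda>\<omega>. f (X t \<omega>)))"
    unfolding D_def using f_int by (auto simp: Bochner_Integration.integral_sum)
  have \<mu>_nonneg: "0 \<le> \<mu>" unfolding \<mu>_def by (rule Bochner_Integration.integral_nonneg) simp
  have n: "\<bar>real n - real K * \<mu>\<bar> \<le> 1"
  proof -
    have "0 \<le> real K * \<mu>" using \<mu>_nonneg by simp
    then show ?thesis unfolding n_def \<mu>_def[symmetric] by linarith
  qed
  \<comment> \<open>This pathwise comparison of the deterministic time \<open>n\<close> with
    \<open>T K\<close> takes the place of an optional stopping argument; only
    \<open>0 \<le> f \<le> 1\<close> enters.\<close>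
  have range_sum: "\<bar>(\<Sum>t<a. f (X t \<omega>)) - (\<Sum>t<b. f (X t \<omega>))\<bar> \<le> \<bar>real a - real b\<bar>" for a b \<omega>
  proof -
    have *: "\<bar>(\<Sum>t<a. f (X t \<omega>)) - (\<Sum>t<b. f (X t \<omega>))\<bar> \<le> real a - real b" if "b \<le> a" for a b
    proof -
      have "(\<Sum>t<a. f (X t \<omega>)) - (\<Sum>t<b. f (X t \<omega>)) = (\<Sum>t=b..<a. f (X t \<omega>))"
        using that by (simp add: lessThan_atLeast0 sum_diff_nat_ivl)
      moreover have "(\<Sum>t=b..<a. f (X t \<omega>)) \<le> (\<Sum>t=b..<a. 1)" "0 \<le> (\<Sum>t=b..<a. f (X t \<omega>))"
        using f by (auto intro!: sum_mono sum_nonneg simp del: sum_constant)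
      ultimately show ?thesis using that by (simp add: of_nat_diff)
    qed
    show ?thesis using *[of a b] *[of b a] by (cases "b \<le> a") auto
  qed
  have "\<bar>expectation D - expectation A\<bar> = \<bar>expectation (\<lambda>\<omega>. D \<omega> - A \<omega>)\<bar>"
    using A D by simp
  also have "\<dots> \<le> expectation (\<lambda>\<omega>. \<bar>D \<omega> - A \<omega>\<bar>)" by (rule integral_abs_bound)
  also have "\<dots> \<le> expectation (\<lambda>\<omega>. \<bar>\<Sum>k=1..K. W k \<omega>\<bar> + 1)"
  proof (rule integral_mono)
    show "integrable P (\<lambda>\<omega>. \<bar>D \<omega> - A \<omega>\<bar>)" using A D by simp
    show "integrable P (\<lambda>\<omega>. \<bar>\<Sum>k=1..K. W k \<omega>\<bar> + 1)" using sum_int by simp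
    fix \<omega> assume \<omega>: "\<omega> \<in> space P"
    have "\<bar>D \<omega> - A \<omega>\<bar> \<le> \<bar>real n - real (T K \<omega>)\<bar>"
      unfolding D_def A_eq[OF \<omega>] by (rule range_sum)
    also have "\<dots> \<le> \<bar>\<Sum>k=1..K. W k \<omega>\<bar> + 1" using TK[OF \<omega>] n by linarith
    finally show "\<bar>D \<omega> - A \<omega>\<bar> \<le> \<bar>\<Sum>k=1..K. W k \<omega>\<bar> + 1" .
  qed
  also have "\<dots> = expectation (\<lambda>\<omega>. \<bar>\<Sum>k=1..K. W k \<omega>\<bar>) + 1"
    using sum_int by (simp add: prob_space)
  also note abs_le
  finally show ?thesis using A D by simp
qed

end

text \<open>Linear growth beats the square root. Perfect squares \<open>K = k * k\<close> are
  tested, where the root is linear in \<open>k\<close>.\<close>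

lemma linear_le_sqrt_imp_nonpos:
  fixes d \<sigma> b :: real
  assumes "\<And>K::nat. real K * d \<le> sqrt (real K * \<sigma>) * 2 + b" and "0 \<le> b" "0 \<le> \<sigma>"
  shows "d \<le> 0"
proof (rule ccontr)
  assume "\<not> d \<le> 0"
  then obtain k :: nat where k: "2 * sqrt \<sigma> + b < real k * d"
    using reals_Archimedean3[of d] by auto
  have "0 \<le> 2 * sqrt \<sigma> + b" using assms by simp
  then have k1: "1 \<le> real k" using k by (cases k) auto
  have "sqrt (real (k * k) * \<sigma>) = real k * sqrt \<sigma>"
    by (simp add: real_sqrt_mult)
  then have "real (k * k) * d \<le> real k * sqrt \<sigma> * 2 + b" using assms(1)[of "k * k"] by simp
  also have "b \<le> real k * b" using k1 assms by (simp add: mult_le_cancel_right1)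
  finally have "real k * (real k * d) \<le> real k * (2 * sqrt \<sigma> + b)" by (simp add: algebra_simps)
  then show False using k k1 by simp
qed

lemma measurable_pair_nat:
  assumes "\<And>t. f t \<in> measurable M N"
  shows "(\<lambda>(\<omega>, t :: nat). f t \<omega>) \<in> measurable (M \<Otimes>\<^sub>M count_space UNIV) N"
  unfolding case_prod_beta
  by (rule measurable_compose_countable[where f = "\<lambda>t z. f t (fst z)" and g = snd])
    (auto intro: measurable_compose[OF measurable_fst assms])

section \<open>Kac's formula and the normalised occupation measure\<close>

context regenerative_process
begin

text \<open>The Markov property averaged over the past. \<open>min 1\<close> changes nothing on
  \<open>space S\<close>, where the kernel gives probability measures, but makes the integrand
  bounded by 1 at every argument, as the lemmas on \<open>visits\<close> require.\<close>

lemma kac_step: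
  assumes mc: "markov_chain P S \<kappa> X" and A[measurable]: "A \<in> sets S"
  shows "expectation (\<lambda>\<omega>. indicator A (X (Suc t) \<omega>)) = expectation (\<lambda>\<omega>. min 1 (measure (\<kappa> (X t \<omega>)) A))"
proof -
  let ?F = "natural_filtration P S X t"
  let ?I = "indicator (X (Suc t) -` A \<inter> space P) :: 'w \<Rightarrow> real"
  have \<kappa>: "\<kappa> \<in> S \<rightarrow>\<^sub>M prob_algebra S" using mc by (simp add: markov_chain_def)
  have gens: "(\<Union>i\<in>{..t}. sets (vimage_algebra (space P) (X i) S)) \<subseteq> events"
    using X_meas by (auto simp: sets_vimage_algebra2[OF measurable_space[OF X_meas, THEN funcsetI]])
  then have "(\<Union>i\<in>{..t}. sets (vimage_algebra (space P) (X i) S)) \<subseteq> Pow (space P)"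
    using sets.space_closed by blast
  then have "space ?F = space P" "sets ?F \<subseteq> events"
    using gens by (auto simp: natural_filtration_def sets_measure_of space_measure_of intro: sets.sigma_sets_subset[THEN subsetD])
  then have "subalgebra P ?F" by (simp add: subalgebra_def)
  then have subalg: "sigma_finite_subalgebra P ?F"
    by (intro finite_measure_subalgebra_is_sigma_finite) (unfold_locales, assumption)
  have int: "integrable P ?I" by (rule integrable_const_bound[of _ 1]) (auto simp: indicator_def)
  have ae: "AE \<omega> in P. real_cond_exp P ?F ?I \<omega> = min 1 (measure (\<kappa> (X t \<omega>)) A)"
  proof -
    have "AE \<omega> in P. real_cond_exp P ?F ?I \<omega> = measure (\<kappa> (X t \<omega>)) A"
      using mc A by (simp add: markov_chain_def)
    then show ?thesis
    proof (rule AE_mp, intro AE_I2 impI)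
      fix \<omega> assume "\<omega> \<in> space P" and eq: "real_cond_exp P ?F ?I \<omega> = measure (\<kappa> (X t \<omega>)) A"
      then have "\<kappa> (X t \<omega>) \<in> space (prob_algebra S)"
        using measurable_space[OF \<kappa>] measurable_space[OF X_meas] by blast
      then have "prob_space (\<kappa> (X t \<omega>))" by (simp add: space_prob_algebra)
      then show "real_cond_exp P ?F ?I \<omega> = min 1 (measure (\<kappa> (X t \<omega>)) A)"
        unfolding eq by (simp add: prob_space.prob_le_1)
    qed
  qed
  have [measurable]: "(\<lambda>x. measure (\<kappa> x) A) \<in> borel_measurable S"
    using \<kappa> by measurable
  have "expectation (\<lambda>\<omega>. indicator A (X (Suc t) \<omega>)) = expectation ?I"
    by (rule Bochner_Integration.integral_cong) (auto simp: indicator_def)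
  also have "\<dots> = expectation (real_cond_exp P ?F ?I)"
    by (rule sigma_finite_subalgebra.real_cond_exp_int(2)[OF subalg int, symmetric])
  also have "\<dots> = expectation (\<lambda>\<omega>. min 1 (measure (\<kappa> (X t \<omega>)) A))"
    using ae by (intro integral_cong_AE) auto
  finally show ?thesis .
qed

text \<open>Shifting time by one step changes the sum over \<open>t < n\<close> only by a boundary
  term of size at most 1, while both sums equal \<open>K\<close> times the respective visits up to
  order \<open>sqrt K\<close>. The constant 3 collects this 1 and one from each application of
  \<open>visits_ergodic_bound\<close>.\<close>

lemma kac:
  assumes mc: "markov_chain P S \<kappa> X" and A[measurable]: "A \<in> sets S"
  shows "visits (indicator A) = visits (\<lambda>x. min 1 (measure (\<kappa> x) A))"
proof -
  let ?f = "\<lambda>x. min 1 (measure (\<kappa> x) A)"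
  let ?\<sigma> = "variance (\<lambda>\<omega>. real (T 1 \<omega>))"
  have \<kappa>: "\<kappa> \<in> S \<rightarrow>\<^sub>M prob_algebra S" using mc by (simp add: markov_chain_def)
  have [measurable]: "(\<lambda>x. measure (\<kappa> x) A) \<in> borel_measurable S"
    using \<kappa> by measurable
  have bound: "real K * \<bar>visits (indicator A) - visits ?f\<bar> \<le> sqrt (real K * ?\<sigma>) * 2 + 3" for K
  proof -
    define n where "n = nat \<lfloor>real K * expectation (\<lambda>\<omega>. real (T 1 \<omega>))\<rfloor>"
    define g where "g t = expectation (\<lambda>\<omega>. indicator A (X t \<omega>) :: real)" for t
    have 1: "\<bar>(\<Sum>t<n. g t) - real K * visits (indicator A)\<bar> \<le> sqrt (real K * ?\<sigma>) + 1"
      unfolding n_def g_def by (rule visits_ergodic_bound) auto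
    have "\<bar>(\<Sum>t<n. expectation (\<lambda>\<omega>. ?f (X t \<omega>))) - real K * visits ?f\<bar> \<le> sqrt (real K * ?\<sigma>) + 1"
      unfolding n_def by (rule visits_ergodic_bound) auto
    then have 2: "\<bar>(\<Sum>t<n. g (Suc t)) - real K * visits ?f\<bar> \<le> sqrt (real K * ?\<sigma>) + 1"
      by (simp add: g_def kac_step[OF mc A])
    have "(\<Sum>t<n. g (Suc t)) - (\<Sum>t<n. g t) = g n - g 0"
      by (simp add: sum_subtractf[symmetric] sum_lessThan_telescope)
    moreover have "0 \<le> g t \<and> g t \<le> 1" for t
    proof -
      have "g t = prob (X t -` A \<inter> space P)" unfolding g_def
        by (subst Bochner_Integration.integral_indicator[symmetric], intro Bochner_Integration.integral_cong) (auto simp: indicator_def)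
      then show ?thesis by simp
    qed
    then have "0 \<le> g n" "g n \<le> 1" "0 \<le> g 0" "g 0 \<le> 1" by auto
    ultimately have "\<bar>real K * visits (indicator A) - real K * visits ?f\<bar> \<le> sqrt (real K * ?\<sigma>) * 2 + 3"
      using 1 2 by linarith
    moreover have "\<bar>real K * visits (indicator A) - real K * visits ?f\<bar> = real K * \<bar>visits (indicator A) - visits ?f\<bar>"
      by (simp add: right_diff_distrib[symmetric] abs_mult)
    ultimately show ?thesis by linarith
  qed
  have "\<bar>visits (indicator A) - visits ?f\<bar> \<le> 0"
    by (rule linear_le_sqrt_imp_nonpos[OF bound]) (use variance_positive in auto)
  then show ?thesis by simp
qed

definition mean_length :: real where
  "mean_length = expectation (\<lambda>\<omega>. real (T 1 \<omega>))"

lemma mean_length_pos: "0 < mean_length"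
proof -
  have "expectation (\<lambda>_. 1) \<le> mean_length" unfolding mean_length_def
  proof (rule integral_mono)
    fix \<omega> assume "\<omega> \<in> space P"
    then show "1 \<le> real (T 1 \<omega>)" using T_less[of \<omega> 0] by simp
  qed (use T_integrable in auto)
  then show ?thesis by (simp add: prob_space)
qed

lemma visits_one: "visits (\<lambda>_. 1) = mean_length"
  by (simp add: visits_def mean_length_def)

text \<open>The normalised mean occupation measure of a tour, written as the image of a density on
  pairs of outcome and time. In this form countable additivity is automatic and integrals reduce to
  Tonelli's theorem.\<close>

definition occupation :: "'x measure" where
  "occupation = distr (density (P \<Otimes>\<^sub>M count_space UNIV)
     (\<lambda>(\<omega>, t). ennreal (of_bool (t < T 1 \<omega>) / mean_length))) S (\<lambda>(\<omega>, t). X t \<omega>)"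

lemma sets_occupation [measurable_cong, simp]: "sets occupation = sets S"
  and space_occupation [simp]: "space occupation = space S"
  by (simp_all add: occupation_def)

lemma nn_integral_occupation:
  fixes f :: "'x \<Rightarrow> real"
  assumes [measurable]: "f \<in> borel_measurable S" and f: "\<And>x. 0 \<le> f x" "\<And>x. f x \<le> 1"
  shows "(\<integral>\<^sup>+ x. ennreal (f x) \<partial>occupation) = ennreal (visits f / mean_length)"
proof -
  interpret count: sigma_finite_measure "count_space (UNIV :: nat set)"
    by (rule sigma_finite_measure_count_space)
  have X_pair [measurable]: "(\<lambda>(\<omega>, t). X t \<omega>) \<in> measurable (P \<Otimes>\<^sub>M count_space UNIV) S"
    by (rule measurable_pair_nat) auto
  have fX_meas: "(\<lambda>z. ennreal (f (case z of (\<omega>, t) \<Rightarrow> X t \<omega>))) \<in> borel_measurable (P \<Otimes>\<^sub>M count_space UNIV)"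
    by (rule measurable_compose[OF X_pair]) simp
  let ?d = "\<lambda>(\<omega>, t). ennreal (of_bool (t < T 1 \<omega>) / mean_length)"
  have d_meas: "?d \<in> borel_measurable (P \<Otimes>\<^sub>M count_space UNIV)"
    by (rule measurable_pair_nat) auto
  have prod_meas: "(\<lambda>(\<omega>, t). ennreal (of_bool (t < T 1 \<omega>) / mean_length) * ennreal (f (X t \<omega>)))
      \<in> borel_measurable (P \<Otimes>\<^sub>M count_space UNIV)"
    by (rule measurable_pair_nat) auto
  have "(\<integral>\<^sup>+ x. ennreal (f x) \<partial>occupation)
      = (\<integral>\<^sup>+ z. ennreal (f (case z of (\<omega>, t) \<Rightarrow> X t \<omega>)) \<partial>density (P \<Otimes>\<^sub>M count_space UNIV) ?d)"
    unfolding occupation_def by (subst nn_integral_distr) auto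
  also have "\<dots> = (\<integral>\<^sup>+ z. ?d z * ennreal (f (case z of (\<omega>, t) \<Rightarrow> X t \<omega>)) \<partial>(P \<Otimes>\<^sub>M count_space UNIV))"
    by (rule nn_integral_density[OF d_meas fX_meas])
  also have "\<dots> = (\<integral>\<^sup>+ z. (case z of (\<omega>, t) \<Rightarrow> ennreal (of_bool (t < T 1 \<omega>) / mean_length) * ennreal (f (X t \<omega>)))
      \<partial>(P \<Otimes>\<^sub>M count_space UNIV))"
    by (simp add: case_prod_beta)
  also have "\<dots> = (\<integral>\<^sup>+ \<omega>. (\<integral>\<^sup>+ t. ennreal (of_bool (t < T 1 \<omega>) / mean_length) * ennreal (f (X t \<omega>)) \<partial>count_space UNIV) \<partial>P)"
    using count.nn_integral_fst[OF prod_meas] by simp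
  also have "\<dots> = (\<integral>\<^sup>+ \<omega>. ennreal ((\<Sum>t<T 1 \<omega>. f (X t \<omega>)) / mean_length) \<partial>P)"
  proof (rule nn_integral_cong)
    fix \<omega>
    have "(\<integral>\<^sup>+ t. ennreal (of_bool (t < T 1 \<omega>) / mean_length) * ennreal (f (X t \<omega>)) \<partial>count_space UNIV)
        = (\<Sum>t. ennreal (of_bool (t < T 1 \<omega>) / mean_length) * ennreal (f (X t \<omega>)))"
      by (rule nn_integral_count_space_nat)
    also have "\<dots> = (\<Sum>t<T 1 \<omega>. ennreal (of_bool (t < T 1 \<omega>) / mean_length) * ennreal (f (X t \<omega>)))"
      by (rule suminf_finite) auto
    also have "\<dots> = (\<Sum>t<T 1 \<omega>. ennreal (f (X t \<omega>) / mean_length))"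
      using mean_length_pos f by (intro sum.cong refl) (simp add: ennreal_mult[symmetric])
    also have "\<dots> = ennreal ((\<Sum>t<T 1 \<omega>. f (X t \<omega>)) / mean_length)"
      using mean_length_pos f by (subst sum_ennreal) (auto simp: sum_divide_distrib)
    finally show "(\<integral>\<^sup>+ t. ennreal (of_bool (t < T 1 \<omega>) / mean_length) * ennreal (f (X t \<omega>)) \<partial>count_space UNIV)
        = ennreal ((\<Sum>t<T 1 \<omega>. f (X t \<omega>)) / mean_length)" .
  qed
  also have "\<dots> = ennreal (expectation (\<lambda>\<omega>. (\<Sum>t<T 1 \<omega>. f (X t \<omega>)) / mean_length))"
    using visits_sums(1)[OF assms] mean_length_pos f
    by (intro nn_integral_eq_integral) (auto intro!: divide_nonneg_pos sum_nonneg)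
  also have "\<dots> = ennreal (visits f / mean_length)" by (simp add: visits_def)
  finally show ?thesis .
qed

lemma emeasure_occupation:
  assumes "A \<in> sets S"
  shows "emeasure occupation A = ennreal (visits (indicator A) / mean_length)"
  using nn_integral_occupation[of "indicator A"] assms by (simp add: ennreal_indicator)

lemma visits_nonneg: "(\<And>x. 0 \<le> f x) \<Longrightarrow> 0 \<le> visits f"
  unfolding visits_def by (intro Bochner_Integration.integral_nonneg sum_nonneg) auto

lemma measure_occupation:
  assumes "A \<in> sets S"
  shows "measure occupation A = visits (indicator A) / mean_length"
  using mean_length_pos visits_nonneg[of "indicator A"]
  by (simp add: measure_def emeasure_occupation[OF assms])

lemma stationary_occupation:
  assumes mc: "markov_chain P S \<kappa> X"
  shows "stationary_distribution S \<kappa> occupation"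
  unfolding stationary_distribution_def
proof (intro conjI)
  have \<kappa>: "\<kappa> \<in> S \<rightarrow>\<^sub>M prob_algebra S" using mc by (simp add: markov_chain_def)
  have total: "emeasure occupation (space occupation) = 1"
  proof -
    have "(\<integral>\<^sup>+ x. ennreal 1 \<partial>occupation) = 1"
      using nn_integral_occupation[of "\<lambda>_. 1"] mean_length_pos by (simp add: visits_one)
    then show ?thesis by simp
  qed
  then have prob: "prob_space occupation" by (rule prob_spaceI)
  then show "occupation \<in> space (prob_algebra S)" by (simp add: space_prob_algebra)
  have ne: "space occupation \<noteq> {}" using prob by (rule prob_space.not_empty)
  have \<kappa>': "\<kappa> \<in> occupation \<rightarrow>\<^sub>M subprob_algebra S"
    using measurable_prob_algebraD[OF \<kappa>] by simp
  show "occupation \<bind> \<kappa> = occupation"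
  proof (rule measure_eqI)
    show "sets (occupation \<bind> \<kappa>) = sets occupation"
      using sets_bind[of occupation \<kappa> S] measurable_space[OF \<kappa>] ne by (auto simp: space_prob_algebra)
    fix A assume "A \<in> sets (occupation \<bind> \<kappa>)"
    then have A[measurable]: "A \<in> sets S"
      using sets_bind[of occupation \<kappa> S] measurable_space[OF \<kappa>] ne by (auto simp: space_prob_algebra)
    have [measurable]: "(\<lambda>x. measure (\<kappa> x) A) \<in> borel_measurable S"
      using \<kappa> by measurable
    have "emeasure (occupation \<bind> \<kappa>) A = (\<integral>\<^sup>+ x. emeasure (\<kappa> x) A \<partial>occupation)"
      by (rule emeasure_bind[OF ne \<kappa>' A])
    also have "\<dots> = (\<integral>\<^sup>+ x. ennreal (min 1 (measure (\<kappa> x) A)) \<partial>occupation)"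
    proof (rule nn_integral_cong)
      fix x assume "x \<in> space occupation"
      then have "\<kappa> x \<in> space (prob_algebra S)" using measurable_space[OF \<kappa>] by simp
      then interpret \<kappa>x: prob_space "\<kappa> x" by (simp add: space_prob_algebra)
      show "emeasure (\<kappa> x) A = ennreal (min 1 (measure (\<kappa> x) A))"
        using \<kappa>x.prob_le_1[of A] by (simp add: \<kappa>x.emeasure_eq_measure)
    qed
    also have "\<dots> = ennreal (visits (\<lambda>x. min 1 (measure (\<kappa> x) A)) / mean_length)"
      by (rule nn_integral_occupation) auto
    also have "\<dots> = emeasure occupation A" by (simp add: emeasure_occupation[OF A] kac[OF mc A])
    finally show "emeasure (occupation \<bind> \<kappa>) A = emeasure occupation A" .
  qed
qed

text \<open>Such an \<open>h\<close> factors through the list of \<open>T 0\<close> to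
  \<open>T K\<close>, which takes values in a countable discrete space, where every function is
  measurable. This settles the measurability of the random bound, with its random range of
  summation, in one stroke.\<close>

lemma borel_measurable_of_regeneration_times:
  fixes h :: "'w \<Rightarrow> real"
  assumes dep: "\<And>\<omega> \<omega>'. \<omega> \<in> space P \<Longrightarrow> \<omega>' \<in> space P \<Longrightarrow> (\<And>k. k \<le> K \<Longrightarrow> T k \<omega> = T k \<omega>') \<Longrightarrow> h \<omega> = h \<omega>'"
  shows "h \<in> borel_measurable P"
proof -
  define L where "L \<omega> = map (\<lambda>k. T k \<omega>) [0..<Suc K]" for \<omega>
  have L_meas: "L \<in> measurable P (count_space UNIV)"
  proof (rule measurable_count_space_eq_countable[THEN iffD2], safe)
    fix l :: "nat list"
    have L_iff: "L \<omega> = l \<longleftrightarrow> length l = Suc K \<and> (\<forall>k<Suc K. T k \<omega> = l ! k)" for \<omega>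
      unfolding L_def list_eq_iff_nth_eq by (simp del: upt_Suc) metis
    have "L -` {l} \<inter> space P
        = {\<omega> \<in> space P. length l = Suc K \<and> (\<forall>k\<in>{..<Suc K}. T k \<omega> = l ! k)}"
      unfolding vimage_singleton_eq vimage_def by (auto simp only: L_iff Int_iff mem_Collect_eq singleton_iff lessThan_iff)
    also have "\<dots> \<in> events" by measurable
    finally show "L -` {l} \<inter> space P \<in> events" .
  qed auto
  define \<phi> where "\<phi> l = h (SOME \<omega>. \<omega> \<in> space P \<and> L \<omega> = l)" for l
  have "h \<omega> = \<phi> (L \<omega>)" if "\<omega> \<in> space P" for \<omega>
  proof -
    let ?\<omega> = "SOME \<omega>'. \<omega>' \<in> space P \<and> L \<omega>' = L \<omega>"
    have *: "?\<omega> \<in> space P \<and> L ?\<omega> = L \<omega>" by (rule someI[of _ \<omega>]) (use that in simp)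
    then have "T k ?\<omega> = T k \<omega>" if "k \<le> K" for k
    proof -
      have "\<forall>k\<in>set [0..<Suc K]. T k ?\<omega> = T k \<omega>"
        using * unfolding L_def map_eq_conv by blast
      then show ?thesis using that by (simp del: upt_Suc)
    qed
    then show ?thesis unfolding \<phi>_def using * that by (intro dep) auto
  qed
  moreover have "(\<lambda>\<omega>. \<phi> (L \<omega>)) \<in> borel_measurable P"
    using L_meas by (rule measurable_compose) simp
  ultimately show ?thesis by (simp cong: measurable_cong)
qed

end

section \<open>The deviation bound\<close>

text \<open>Continuity from above along the decreasing events for the first \<open>n\<close>
  conditions; it requires the same lower bound \<open>a\<close> for all \<open>n\<close>.\<close>

lemma (in prob_space) prob_ge_of_all_finite_subfamilies:
  fixes Q :: "nat \<Rightarrow> 'a \<Rightarrow> bool"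
  assumes [measurable]: "\<And>i. Measurable.pred M (Q i)"
    and le: "\<And>n. a \<le> prob {\<omega> \<in> space M. \<forall>i\<in>{..n}. Q i \<omega>}"
  shows "a \<le> prob {\<omega> \<in> space M. \<forall>i. Q i \<omega>}"
proof -
  let ?A = "\<lambda>n. {\<omega> \<in> space M. \<forall>i\<in>{..n}. Q i \<omega>}"
  have "(\<lambda>n. prob (?A n)) \<longlonglongrightarrow> prob (\<Inter>n. ?A n)"
    by (rule finite_Lim_measure_decseq) (auto simp: decseq_def)
  moreover have "(\<Inter>n. ?A n) = {\<omega> \<in> space M. \<forall>i. Q i \<omega>}" by auto
  ultimately show ?thesis using le by (metis (no_types, lifting) LIMSEQ_le_const)
qed

text \<open>A violation at \<open>x\<close> persists immediately to the right of \<open>x\<close>,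
  where there are rationals. The supremum is thereby tested by countably many events.\<close>

lemma cSUP_le_iff_rational:
  fixes f :: "real \<Rightarrow> real"
  assumes cont: "\<And>x. continuous (at_right x) f" and bdd: "bdd_above (range f)"
  shows "(SUP x. f x) \<le> b \<longleftrightarrow> (\<forall>x\<in>\<rat>. f x \<le> b)"
proof
  assume "(SUP x. f x) \<le> b"
  then show "\<forall>x\<in>\<rat>. f x \<le> b" using cSUP_upper[OF UNIV_I bdd] by (meson order_trans)
next
  assume rat: "\<forall>x\<in>\<rat>. f x \<le> b"
  have "f x \<le> b" for x
  proof (rule ccontr)
    assume "\<not> f x \<le> b"
    moreover have "(f \<longlongrightarrow> f x) (at_right x)" using cont[of x] by (simp add: continuous_within)
    ultimately have "\<forall>\<^sub>F y in at_right x. b < f y" by (intro order_tendstoD) auto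
    then obtain d where d: "x < d" "\<And>y. x < y \<Longrightarrow> y < d \<Longrightarrow> b < f y"
      by (auto simp: eventually_at_right_field)
    obtain r where "r \<in> \<rat>" "x < r" "r < d" using Rats_dense_in_real[OF d(1)] by auto
    then show False using d(2)[of r] rat by (auto simp: not_less)
  qed
  then show "(SUP x. f x) \<le> b" by (intro cSUP_least) auto
qed

section \<open>The random bound of the theorem, and the estimate for finitely many levels\<close>

context regenerative_process
begin

definition deviation_bound :: "nat \<Rightarrow> real \<Rightarrow> 'w \<Rightarrow> real" where
  "deviation_bound K \<delta> \<omega> =
    (let n = T K \<omega>; M = max_tour_length T K \<omega>; m = (\<lambda>j. real (num_longer_tours T K j \<omega>))
     in 1 / sqrt (2 * real n) *
            (\<Sum>j<M. sqrt (min (m j / real n * ln (6 * real n / (\<delta> * m j))) (2 * (m j)\<^sup>2 / real n)))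
          + sqrt (real K) / real n * (real M / sqrt (\<delta> / 3))
          + 2 / (real n * sqrt (\<delta> / 3)) *
            (ln (B * real K) / \<gamma> * sqrt (ln (3 / \<delta>)) + 1 / (1 - exp (- \<gamma> / 2))))"

lemma one_le_B: "1 \<le> B"
proof -
  have "{\<omega> \<in> space P. T 1 \<omega> > 0} = space P" using T_less[of _ 0] by force
  then show ?thesis using tail[of 0] by (simp add: prob_space)
qed

lemma tour_length_pos: "\<omega> \<in> space P \<Longrightarrow> 1 \<le> k \<Longrightarrow> 0 < tour_length T k \<omega>"
  using T_less[of \<omega> "k - 1"] by (simp add: tour_length_def)

lemma K_le_T: "\<omega> \<in> space P \<Longrightarrow> K \<le> T K \<omega>"
proof -
  assume \<omega>: "\<omega> \<in> space P"
  have "(\<Sum>k=1..K. 1) \<le> (\<Sum>k=1..K. tour_length T k \<omega>)"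
    using tour_length_pos[OF \<omega>] by (intro sum_mono) (auto simp: Suc_le_eq)
  then show "K \<le> T K \<omega>" using T_eq_sum[OF \<omega>, of K] by simp
qed

text \<open>Both members of the minimum are at least \<open>m j / n\<close>: the logarithm is at
  least 1 because \<open>\<delta> * m j \<le> n\<close>, and \<open>2 * (m j)^2 \<ge> m j\<close>
  because some tour is longer than \<open>j\<close> whenever \<open>j < M\<close>. The other two
  terms are only rewritten.\<close>

lemma deviation_bound_ge:
  assumes \<omega>: "\<omega> \<in> space P" and K: "K \<ge> 1" and \<delta>: "0 < \<delta>" "\<delta> < 1"
  defines "M \<equiv> max_tour_length T K \<omega>" and "n \<equiv> real (T K \<omega>)"
  shows "((\<Sum>j<M. sqrt (real (num_longer_tours T K j \<omega>) / 2)) + sqrt (real K * (3 / \<delta>)) * real M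
      + 2 * sqrt (3 / \<delta>) * (ln (B * real K) / \<gamma> * sqrt (ln (3 / \<delta>)) + 1 / (1 - exp (- \<gamma> / 2)))) / n
    \<le> deviation_bound K \<delta> \<omega>"
proof -
  define m where "m j = real (num_longer_tours T K j \<omega>)" for j
  have n: "0 < n" "real K \<le> n" using K_le_T[OF \<omega>, of K] K by (auto simp: n_def)
  have m: "1 \<le> m j" "m j \<le> n" if "j < M" for j
  proof -
    have "M \<in> (\<lambda>k. tour_length T k \<omega>) ` {1..K}"
      unfolding M_def max_tour_length_def using K by (intro Max_in) auto
    then have "{k \<in> {1..K}. j < tour_length T k \<omega>} \<noteq> {}" using that by auto
    then show "1 \<le> m j" by (simp add: m_def num_longer_tours_def Suc_le_eq card_gt_0_iff)
    have "num_longer_tours T K j \<omega> \<le> card {1..K}"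
      unfolding num_longer_tours_def by (intro card_mono) auto
    then show "m j \<le> n" using n by (simp add: m_def)
  qed
  have "sqrt (m j / 2) / n \<le> 1 / sqrt (2 * n) * sqrt (min (m j / n * ln (6 * n / (\<delta> * m j))) (2 * (m j)\<^sup>2 / n))"
    if "j < M" for j
  proof -
    note mj = m[OF that]
    have "\<delta> * m j \<le> 1 * n" using mj \<delta> by (intro mult_mono) auto
    then have "6 \<le> 6 * n / (\<delta> * m j)" using mj \<delta> by (simp add: field_simps)
    moreover have "1 \<le> ln (6 :: real)"
      using e_less_272 ln_mono[of "exp 1" "6 :: real"] by simp
    ultimately have "1 \<le> ln (6 * n / (\<delta> * m j))"
      using ln_mono[of 6 "6 * n / (\<delta> * m j)"] by linarith
    then have "m j / n * 1 \<le> m j / n * ln (6 * n / (\<delta> * m j))"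
      using mj n by (intro mult_left_mono) auto
    moreover have "m j / n \<le> 2 * (m j)\<^sup>2 / n"
      using mj n by (intro divide_right_mono) (auto simp: power2_eq_square)
    ultimately have "sqrt (m j / n) \<le> sqrt (min (m j / n * ln (6 * n / (\<delta> * m j))) (2 * (m j)\<^sup>2 / n))"
      by (intro real_sqrt_le_mono) simp
    then have "1 / sqrt (2 * n) * sqrt (m j / n)
        \<le> 1 / sqrt (2 * n) * sqrt (min (m j / n * ln (6 * n / (\<delta> * m j))) (2 * (m j)\<^sup>2 / n))"
      using n by (intro mult_left_mono) auto
    moreover have "1 / sqrt (2 * n) * sqrt (m j / n) = sqrt (m j / 2) / n"
      using n by (simp add: real_sqrt_divide real_sqrt_mult)
    ultimately show ?thesis by simp
  qed
  then have 1: "(\<Sum>j<M. sqrt (m j / 2)) / n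
      \<le> 1 / sqrt (2 * n) * (\<Sum>j<M. sqrt (min (m j / n * ln (6 * n / (\<delta> * m j))) (2 * (m j)\<^sup>2 / n)))"
    unfolding sum_divide_distrib sum_distrib_left by (intro sum_mono) auto
  have 2: "sqrt (real K * (3 / \<delta>)) * real M / n = sqrt (real K) / n * (real M / sqrt (\<delta> / 3))"
    by (simp add: real_sqrt_mult real_sqrt_divide mult_ac)
  have 3: "2 * sqrt (3 / \<delta>) * c / n = 2 / (n * sqrt (\<delta> / 3)) * c" for c
    by (simp add: real_sqrt_divide)
  show ?thesis
    using 1 unfolding deviation_bound_def Let_def add_divide_distrib 2 3
    unfolding M_def[symmetric] n_def[symmetric] m_def[symmetric] by linarith
qed

lemma empirical_deviation_eq:
  assumes "\<omega> \<in> space P" "K \<ge> 1"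
  shows "empirical_cdf \<theta> X (T K \<omega>) \<omega> x - c
    = (\<Sum>k=1..K. \<Sum>j<length (tour X T k \<omega>).
        of_bool ((if j < length (tour X T k \<omega>) then \<theta> (tour X T k \<omega> ! j) else 0) \<le> x) - c) / real (T K \<omega>)"
proof -
  have pos: "0 < T K \<omega>" using K_le_T[OF assms(1), of K] assms by simp
  have "(\<Sum>k=1..K. \<Sum>j<length (tour X T k \<omega>).
        of_bool ((if j < length (tour X T k \<omega>) then \<theta> (tour X T k \<omega> ! j) else 0) \<le> x) - c)
      = (\<Sum>k=1..K. \<Sum>j<tour_length T k \<omega>. (\<lambda>y. of_bool (\<theta> y \<le> x) - c) (tour X T k \<omega> ! j))"
    unfolding length_tour by (intro sum.cong refl) simp
  also have "\<dots> = (\<Sum>t<T K \<omega>. of_bool (\<theta> (X t \<omega>) \<le> x) - c)"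
    by (rule sum_up_to_regeneration[OF assms(1), symmetric])
  also have "\<dots> = (\<Sum>t<T K \<omega>. of_bool (\<theta> (X t \<omega>) \<le> x)) - real (T K \<omega>) * c"
    by (simp only: sum_subtractf sum_constant card_lessThan)
  finally show ?thesis
    using pos by (simp only: empirical_cdf_def) (simp add: diff_divide_distrib del: sum_of_bool_eq)
qed

lemma tour_law_eq_prob:
  assumes [measurable]: "Measurable.pred (finseq_space S) p"
  shows "measure (distr P (finseq_space S) (tour X T 1)) {l \<in> space (finseq_space S). p l}
    = prob {\<omega> \<in> space P. p (tour X T 1 \<omega>)}"
proof -
  have "measure (distr P (finseq_space S) (tour X T 1)) {l \<in> space (finseq_space S). p l}
      = prob (tour X T 1 -` {l \<in> space (finseq_space S). p l} \<inter> space P)"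
    by (rule measure_distr) auto
  also have "tour X T 1 -` {l \<in> space (finseq_space S). p l} \<inter> space P = {\<omega> \<in> space P. p (tour X T 1 \<omega>)}"
    using measurable_space[OF tour_meas[of 1]] by auto
  finally show ?thesis .
qed

lemma finite_family_deviation:
  fixes \<theta> :: "'x \<Rightarrow> real"
  assumes [measurable]: "\<theta> \<in> borel_measurable S" and V: "finite V" "V \<noteq> {}"
    and K: "K \<ge> 1" and \<delta>: "0 < \<delta>" "\<delta> < 1"
  defines "c \<equiv> \<lambda>x. visits (\<lambda>y. of_bool (\<theta> y \<le> x)) / mean_length"
  shows "\<exists>G\<in>events. 1 - \<delta> \<le> prob G \<and>
    (\<forall>\<omega>\<in>G. \<forall>x\<in>V. \<bar>empirical_cdf \<theta> X (T K \<omega>) \<omega> x - c x\<bar> \<le> deviation_bound K \<delta> \<omega>)"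
proof -
  define s where "s = 3 / \<delta>"
  have s: "3 < s" "3 / s = \<delta>" using \<delta> by (auto simp: s_def field_simps)
  let ?N = "finseq_space S"
  let ?\<rho> = "distr P ?N (tour X T 1)"
  let ?Y = "\<lambda>j l. if j < length l then \<theta> (l ! j) else 0"
  let ?f = "\<lambda>x y. of_bool (\<theta> y \<le> x) :: real"
  have T1: "tour_length T 1 \<omega> = T 1 \<omega>" if "\<omega> \<in> space P" for \<omega>
    using T_0[OF that] by (simp add: tour_length_def)
  have f_meas [measurable]: "?f x \<in> borel_measurable S" for x by measurable
  have visits_le: "visits (?f x) \<le> mean_length" for x
    unfolding visits_one[symmetric] visits_def
  proof (rule integral_mono)
    show "integrable P (\<lambda>\<omega>. \<Sum>t<T 1 \<omega>. ?f x (X t \<omega>))" by (rule visits_sums(1)) auto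
    show "integrable P (\<lambda>\<omega>. \<Sum>t<T 1 \<omega>. 1 :: real)" using T_integrable by simp
    show "(\<Sum>t<T 1 \<omega>. ?f x (X t \<omega>)) \<le> (\<Sum>t<T 1 \<omega>. 1)" for \<omega> by (intro sum_mono) simp
  qed
  have c: "0 \<le> c x" "c x \<le> 1" for x
    using visits_nonneg[of "?f x"] visits_le[of x] mean_length_pos by (auto simp: c_def)
  show ?thesis
  proof (cases "real K \<le> s")
    case True
    have "\<bar>empirical_cdf \<theta> X (T K \<omega>) \<omega> x - c x\<bar> \<le> deviation_bound K \<delta> \<omega>"
      if \<omega>: "\<omega> \<in> space P" for \<omega> x
    proof -
      define n where "n = real (T K \<omega>)"
      define M where "M = max_tour_length T K \<omega>"
      have n: "0 < n" using K_le_T[OF \<omega>, of K] K by (simp add: n_def)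
      have "(\<Sum>t<T K \<omega>. ?f x (X t \<omega>)) \<le> (\<Sum>t<T K \<omega>. 1)" by (intro sum_mono) simp
      then have "0 \<le> empirical_cdf \<theta> X (T K \<omega>) \<omega> x" "empirical_cdf \<theta> X (T K \<omega>) \<omega> x \<le> 1"
        using n by (auto simp: empirical_cdf_def n_def field_simps sum_nonneg simp del: sum_of_bool_eq)
      then have le1: "\<bar>empirical_cdf \<theta> X (T K \<omega>) \<omega> x - c x\<bar> \<le> 1" using c[of x] by linarith
      have "T K \<omega> \<le> (\<Sum>k=1..K. M)"
        unfolding T_eq_sum[OF \<omega>] M_def max_tour_length_def by (intro sum_mono Max_ge) auto
      then have n_le: "n \<le> real K * real M" unfolding n_def by (simp flip: of_nat_mult)
      \<comment> \<open>With \<open>n \<le> K * M\<close>, the \<open>M\<close> term alone makes the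
        bound at least 1, which no difference of distribution functions exceeds.\<close>
      have "real K \<le> sqrt (real K * s)"
        using True by (intro real_le_rsqrt) (simp add: power2_eq_square mult_left_mono)
      then have "real K * real M \<le> sqrt (real K * s) * real M" by (intro mult_right_mono) auto
      moreover have "0 \<le> (\<Sum>j<M. sqrt (real (num_longer_tours T K j \<omega>) / 2))" by (intro sum_nonneg) auto
      moreover have "0 \<le> 2 * sqrt s * (ln (B * real K) / \<gamma> * sqrt (ln s) + 1 / (1 - exp (- \<gamma> / 2)))"
      proof -
        have "1 * 1 \<le> B * real K" using one_le_B K by (intro mult_mono) auto
        then show ?thesis using s \<gamma> by simp
      qed
      ultimately have "n \<le> (\<Sum>j<M. sqrt (real (num_longer_tours T K j \<omega>) / 2)) + sqrt (real K * s) * real M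
          + 2 * sqrt s * (ln (B * real K) / \<gamma> * sqrt (ln s) + 1 / (1 - exp (- \<gamma> / 2)))"
        using n_le by linarith
      then have "1 \<le> ((\<Sum>j<M. sqrt (real (num_longer_tours T K j \<omega>) / 2)) + sqrt (real K * s) * real M
          + 2 * sqrt s * (ln (B * real K) / \<gamma> * sqrt (ln s) + 1 / (1 - exp (- \<gamma> / 2)))) / n"
        using n by simp
      also have "\<dots> \<le> deviation_bound K \<delta> \<omega>"
        unfolding s_def M_def n_def by (rule deviation_bound_ge[OF \<omega> K \<delta>])
      finally show ?thesis using le1 by linarith
    qed
    then show ?thesis using \<delta> by (intro bexI[of _ "space P"]) (auto simp: prob_space)
  next
    case False
    have p_eq: "measure ?\<rho> {l \<in> space ?N. j < length l} = prob {\<omega> \<in> space P. j < T 1 \<omega>}" for j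
    proof -
      have "measure ?\<rho> {l \<in> space ?N. j < length l} = prob {\<omega> \<in> space P. j < length (tour X T 1 \<omega>)}"
        by (rule tour_law_eq_prob) measurable
      also have "{\<omega> \<in> space P. j < length (tour X T 1 \<omega>)} = {\<omega> \<in> space P. j < T 1 \<omega>}"
        using T1 unfolding length_tour by auto
      finally show ?thesis .
    qed
    have Q_eq: "measure ?\<rho> {l \<in> space ?N. j < length l \<and> ?Y j l \<le> x}
        = expectation (\<lambda>\<omega>. of_bool (j < T 1 \<omega>) * ?f x (X j \<omega>))" for j x
    proof -
      have "measure ?\<rho> {l \<in> space ?N. j < length l \<and> ?Y j l \<le> x}
          = prob {\<omega> \<in> space P. j < length (tour X T 1 \<omega>) \<and> ?Y j (tour X T 1 \<omega>) \<le> x}"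
        by (rule tour_law_eq_prob) measurable
      also have "{\<omega> \<in> space P. j < length (tour X T 1 \<omega>) \<and> ?Y j (tour X T 1 \<omega>) \<le> x}
          = {\<omega> \<in> space P. j < T 1 \<omega> \<and> \<theta> (X j \<omega>) \<le> x}"
        using T1 T_0 nth_tour[of j 1] unfolding length_tour by (auto split: if_splits)
      also have "prob \<dots> = expectation (indicator \<dots>)" by simp
      also have "\<dots> = expectation (\<lambda>\<omega>. of_bool (j < T 1 \<omega>) * ?f x (X j \<omega>))"
        by (rule Bochner_Integration.integral_cong) (auto simp: indicator_def)
      finally show ?thesis .
    qed
    have p_sums: "(\<lambda>j. prob {\<omega> \<in> space P. j < T 1 \<omega>}) sums mean_length"
    proof -
      have "expectation (\<lambda>\<omega>. of_bool (j < T 1 \<omega>) * 1) = prob {\<omega> \<in> space P. j < T 1 \<omega>}" for j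
      proof -
        have "prob {\<omega> \<in> space P. j < T 1 \<omega>} = expectation (indicator {\<omega> \<in> space P. j < T 1 \<omega>})" by simp
        also have "\<dots> = expectation (\<lambda>\<omega>. of_bool (j < T 1 \<omega>) * 1)"
          by (rule Bochner_Integration.integral_cong) (auto simp: indicator_def)
        finally show ?thesis ..
      qed
      then show ?thesis using visits_sums(2)[of "\<lambda>_. 1"] by (simp add: visits_one)
    qed
    \<comment> \<open>Summed over positions, the two measures are the visits to the sublevel set and
      the mean tour length, and \<open>c x\<close> is their quotient.\<close>
    have balance: "(\<lambda>j. measure ?\<rho> {l \<in> space ?N. j < length l \<and> ?Y j l \<le> x}
        - measure ?\<rho> {l \<in> space ?N. j < length l} * c x) sums 0" for x
    proof -
      have "(\<lambda>j. expectation (\<lambda>\<omega>. of_bool (j < T 1 \<omega>) * ?f x (X j \<omega>))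
          - prob {\<omega> \<in> space P. j < T 1 \<omega>} * c x) sums (visits (?f x) - mean_length * c x)"
        by (intro sums_diff sums_mult2 p_sums visits_sums(2)) auto
      moreover have "visits (?f x) - mean_length * c x = 0"
        using mean_length_pos by (simp add: c_def)
      ultimately show ?thesis unfolding p_eq Q_eq by simp
    qed
    have p0: "measure ?\<rho> {l \<in> space ?N. 0 < length l} = 1"
    proof -
      have "{\<omega> \<in> space P. 0 < T 1 \<omega>} = space P" using T1 tour_length_pos[of _ 1] by auto
      then show ?thesis unfolding p_eq by (simp add: prob_space)
    qed
    have "\<exists>G\<in>events. 1 - 3 / s \<le> prob G \<and> (\<forall>\<omega>\<in>G. \<forall>x\<in>V.
      \<bar>\<Sum>k=1..K. \<Sum>j<length (tour X T k \<omega>). of_bool (?Y j (tour X T k \<omega>) \<le> x) - c x\<bar>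
      \<le> (\<Sum>j<Max ((\<lambda>k. length (tour X T k \<omega>)) ` {1..K}). sqrt (real (card {k \<in> {1..K}. j < length (tour X T k \<omega>)}) / 2))
        + sqrt (real (card {1..K}) * s) * real (Max ((\<lambda>k. length (tour X T k \<omega>)) ` {1..K}))
        + 2 * sqrt s * (ln (B * real (card {1..K})) / \<gamma> * sqrt (ln s) + 1 / (1 - exp (- \<gamma> / 2))))"
    proof (rule regenerative_deviation[where \<rho> = ?\<rho> and N = ?N])
      show "finite {1..K}" by simp
      show "indep_vars (\<lambda>_. ?N) (tour X T) {1..K}" by (rule tour_indep)
      show "distr P ?N (tour X T k) = ?\<rho>" if "k \<in> {1..K}" for k using tour_law[of k] that by simp
      show "length \<in> measurable ?N (count_space UNIV)" by measurable
      show "?Y j \<in> borel_measurable ?N" for j by measurable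
      show "measure ?\<rho> {l \<in> space ?N. j < length l} \<le> B * exp (- \<gamma> * real j)" for j
        unfolding p_eq by (rule tail)
      show "0 < B" using one_le_B by simp
      show "s < real (card {1..K})" using False by simp
    qed (use V c balance p0 \<gamma> s in auto)
    then obtain G where G: "G \<in> events" "1 - \<delta> \<le> prob G" and dev: "\<And>\<omega> x. \<omega> \<in> G \<Longrightarrow> x \<in> V \<Longrightarrow>
      \<bar>\<Sum>k=1..K. \<Sum>j<length (tour X T k \<omega>). of_bool (?Y j (tour X T k \<omega>) \<le> x) - c x\<bar>
      \<le> (\<Sum>j<max_tour_length T K \<omega>. sqrt (real (num_longer_tours T K j \<omega>) / 2))
        + sqrt (real K * (3 / \<delta>)) * real (max_tour_length T K \<omega>)
        + 2 * sqrt (3 / \<delta>) * (ln (B * real K) / \<gamma> * sqrt (ln (3 / \<delta>)) + 1 / (1 - exp (- \<gamma> / 2)))"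
      unfolding s(2) unfolding s_def length_tour max_tour_length_def[symmetric] num_longer_tours_def[symmetric]
        card_atLeastAtMost diff_Suc_1
      by blast
    have "\<bar>empirical_cdf \<theta> X (T K \<omega>) \<omega> x - c x\<bar> \<le> deviation_bound K \<delta> \<omega>"
      if \<omega>G: "\<omega> \<in> G" and x: "x \<in> V" for \<omega> x
    proof -
      have \<omega>: "\<omega> \<in> space P" using sets.sets_into_space[OF G(1)] \<omega>G by auto
      have "\<bar>empirical_cdf \<theta> X (T K \<omega>) \<omega> x - c x\<bar>
          = \<bar>\<Sum>k=1..K. \<Sum>j<length (tour X T k \<omega>). of_bool (?Y j (tour X T k \<omega>) \<le> x) - c x\<bar> / real (T K \<omega>)"
        unfolding empirical_deviation_eq[OF \<omega> K] by (simp add: abs_divide)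
      also have "\<dots> \<le> ((\<Sum>j<max_tour_length T K \<omega>. sqrt (real (num_longer_tours T K j \<omega>) / 2))
        + sqrt (real K * (3 / \<delta>)) * real (max_tour_length T K \<omega>)
        + 2 * sqrt (3 / \<delta>) * (ln (B * real K) / \<gamma> * sqrt (ln (3 / \<delta>)) + 1 / (1 - exp (- \<gamma> / 2)))) / real (T K \<omega>)"
        by (intro divide_right_mono dev[OF \<omega>G x]) simp
      also have "\<dots> \<le> deviation_bound K \<delta> \<omega>" by (rule deviation_bound_ge[OF \<omega> K \<delta>])
      finally show ?thesis .
    qed
    then show ?thesis using G by blast
  qed
qed

lemma deviation_bound_measurable [measurable]: "deviation_bound K \<delta> \<in> borel_measurable P"
proof (rule borel_measurable_of_regeneration_times[where K = K])
  fix \<omega> \<omega>' assume eq: "\<And>k. k \<le> K \<Longrightarrow> T k \<omega> = T k \<omega>'"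
  have len: "tour_length T k \<omega> = tour_length T k \<omega>'" if "k \<in> {1..K}" for k
    using eq[of k] eq[of "k - 1"] that by (auto simp: tour_length_def)
  have "max_tour_length T K \<omega> = max_tour_length T K \<omega>'"
    unfolding max_tour_length_def by (rule arg_cong[OF image_cong[OF refl len]])
  moreover have "num_longer_tours T K j \<omega> = num_longer_tours T K j \<omega>'" for j
    unfolding num_longer_tours_def using len by (intro arg_cong[where f = card] Collect_cong) auto
  ultimately show "deviation_bound K \<delta> \<omega> = deviation_bound K \<delta> \<omega>'"
    unfolding deviation_bound_def using eq[of K] by simp
qed

end

theorem theorem1p1:
  fixes P :: "'w measure" and S :: "'x measure"
    and \<kappa> :: "'x \<Rightarrow> 'x measure" and \<pi> \<nu> :: "'x measure"
    and X :: "nat \<Rightarrow> 'w \<Rightarrow> 'x" and T :: "nat \<Rightarrow> 'w \<Rightarrow> nat"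
    and \<theta> :: "'x \<Rightarrow> real" and B \<gamma> \<delta> :: real and K :: nat
  assumes "prob_space P"
    and "markov_chain P S \<kappa> X"
    and "stationary_distribution S \<kappa> \<pi>"
    and "\<And>\<pi>'. stationary_distribution S \<kappa> \<pi>' \<Longrightarrow> \<pi>' = \<pi>"
    and "\<theta> \<in> borel_measurable S"
    and "\<nu> \<in> space (prob_algebra S)"
    and "\<And>\<omega>. \<omega> \<in> space P \<Longrightarrow> T 0 \<omega> = 0"
    and "\<And>\<omega> k. \<omega> \<in> space P \<Longrightarrow> T k \<omega> < T (Suc k) \<omega>"
    and "\<And>k. regeneration_time P S \<nu> X (T k)"
    and "iid_tours P S X T"
    and "B > 0" and "\<gamma> > 0"
    and "\<And>t::nat. measure P {\<omega> \<in> space P. T 1 \<omega> > t} \<le> B * exp (- \<gamma> * real t)"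
    and "K \<ge> 1"
    and "\<delta> > 0"
  shows "measure P {\<omega> \<in> space P.
    (let n = T K \<omega>;
         M = max_tour_length T K \<omega>;
         m = (\<lambda>j. real (num_longer_tours T K j \<omega>))
     in (SUP x::real. \<bar>empirical_cdf \<theta> X n \<omega> x - observable_cdf \<pi> \<theta> x\<bar>)
        \<le> 1 / sqrt (2 * real n) *
            (\<Sum>j<M. sqrt (min (m j / real n * ln (6 * real n / (\<delta> * m j)))
                              (2 * (m j)\<^sup>2 / real n)))
          + sqrt (real K) / real n * (real M / sqrt (\<delta> / 3))
          + 2 / (real n * sqrt (\<delta> / 3)) *
            (ln (B * real K) / \<gamma> * sqrt (ln (3 / \<delta>)) + 1 / (1 - exp (- \<gamma> / 2))))}
    \<ge> 1 - \<delta>"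
proof -
  interpret prob_space P by fact
  interpret regenerative_process P S X T B \<gamma>
  proof
    show "X t \<in> measurable P S" for t using assms(2) by (simp add: markov_chain_def)
    show "T k \<in> measurable P (count_space UNIV)" for k
      using assms(9)[of k] by (simp add: regeneration_time_def)
  qed (fact assms)+
  define c where "c x = visits (\<lambda>y. of_bool (\<theta> y \<le> x)) / mean_length" for x
  note \<theta>[measurable] = assms(5)
  \<comment> \<open>Uniqueness of the stationary distribution enters here: the centring obtained
    from the tours is thereby the distribution function under \<open>\<pi>\<close>.\<close>
  have "occupation = \<pi>" using assms(4) stationary_occupation[OF assms(2)] by simp
  have cdf: "observable_cdf \<pi> \<theta> x = c x" for x
  proof -
    have "observable_cdf \<pi> \<theta> x = measure occupation {y \<in> space S. \<theta> y \<le> x}"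
      using \<open>occupation = \<pi>\<close> by (simp add: observable_cdf_def flip: space_occupation)
    also have "\<dots> = visits (indicator {y \<in> space S. \<theta> y \<le> x}) / mean_length"
      by (rule measure_occupation) measurable
    also have "visits (indicator {y \<in> space S. \<theta> y \<le> x}) = visits (\<lambda>y. of_bool (\<theta> y \<le> x))"
      unfolding visits_def
      by (intro Bochner_Integration.integral_cong sum.cong refl)
        (use measurable_space[OF X_meas] in \<open>auto simp: indicator_def\<close>)
    finally show ?thesis by (simp add: c_def)
  qed
  have c: "0 \<le> c x" "c x \<le> 1" for x
    using stationary_occupation[OF assms(2)] \<open>occupation = \<pi>\<close>
    by (auto simp: cdf[symmetric] observable_cdf_def stationary_distribution_def space_prob_algebra
        intro: prob_space.prob_le_1)
  have c_cont: "continuous (at_right x) c" for x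
  proof -
    interpret \<pi>: prob_space \<pi>
      using assms(3) by (simp add: stationary_distribution_def space_prob_algebra)
    have [measurable_cong]: "sets \<pi> = sets S"
      using assms(3) by (simp add: stationary_distribution_def space_prob_algebra)
    have \<theta>_\<pi>: "\<theta> \<in> borel_measurable \<pi>" by measurable
    interpret D: real_distribution "distr \<pi> borel \<theta>" by (rule \<pi>.real_distribution_distr[OF \<theta>_\<pi>])
    have "cdf (distr \<pi> borel \<theta>) y = c y" for y
      using \<theta>_\<pi> by (simp add: cdf_def2 measure_distr cdf[symmetric] observable_cdf_def vimage_def Int_def conj_commute)
    then have "cdf (distr \<pi> borel \<theta>) = c" ..
    then show ?thesis using D.cdf_is_right_cont[of x] by simp
  qed
  let ?e = "\<lambda>\<omega> x. empirical_cdf \<theta> X (T K \<omega>) \<omega> x"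
  have e: "0 \<le> ?e \<omega> x" "?e \<omega> x \<le> 1" for \<omega> x
  proof -
    have "(\<Sum>t<T K \<omega>. of_bool (\<theta> (X t \<omega>) \<le> x) :: real) \<le> (\<Sum>t<T K \<omega>. 1)" by (intro sum_mono) simp
    then show "0 \<le> ?e \<omega> x" "?e \<omega> x \<le> 1"
      by (auto simp: empirical_cdf_def divide_le_eq sum_nonneg simp del: sum_of_bool_eq)
  qed
  have e_cont: "continuous (at_right x) (?e \<omega>)" for \<omega> x
  proof -
    have "continuous (at_right x) (\<lambda>x. of_bool (a \<le> x) :: real)" for a :: real
    proof -
      have "\<forall>\<^sub>F y in at_right x. (of_bool (a \<le> x) :: real) = of_bool (a \<le> y)"
      proof (cases "a \<le> x")
        case True
        then show ?thesis by (auto simp: eventually_at_filter)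
      next
        case False
        then show ?thesis by (auto simp: eventually_at_right_field intro!: exI[of _ a])
      qed
      then show ?thesis unfolding continuous_within by (rule tendsto_eventually[OF eventually_mono]) simp
    qed
    then show ?thesis unfolding empirical_cdf_def by (intro continuous_intros)
  qed
  have sup_iff: "(SUP x. \<bar>?e \<omega> x - c x\<bar>) \<le> b \<longleftrightarrow> (\<forall>x\<in>\<rat>. \<bar>?e \<omega> x - c x\<bar> \<le> b)" for \<omega> b
  proof (rule cSUP_le_iff_rational)
    show "continuous (at_right x) (\<lambda>x. \<bar>?e \<omega> x - c x\<bar>)" for x
      by (intro continuous_intros c_cont e_cont)
    have "\<bar>?e \<omega> x - c x\<bar> \<le> 1" for x using e[of \<omega> x] c[of x] by linarith
    then show "bdd_above (range (\<lambda>x. \<bar>?e \<omega> x - c x\<bar>))" by (intro bdd_aboveI2)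
  qed
  have "1 - \<delta> \<le> prob {\<omega> \<in> space P. (SUP x. \<bar>?e \<omega> x - c x\<bar>) \<le> deviation_bound K \<delta> \<omega>}"
  proof (cases "\<delta> < 1")
    case False
    then have "1 - \<delta> \<le> 0" by simp
    then show ?thesis using measure_nonneg order_trans by blast
  next
    case True
    define r where "r = from_nat_into (\<rat> :: real set)"
    have rat: "\<rat> = range r" unfolding r_def
      by (rule range_from_nat_into[symmetric]) (auto simp: countable_rat)
    have "{\<omega> \<in> space P. (SUP x. \<bar>?e \<omega> x - c x\<bar>) \<le> deviation_bound K \<delta> \<omega>}
        = {\<omega> \<in> space P. \<forall>i. \<bar>?e \<omega> (r i) - c (r i)\<bar> \<le> deviation_bound K \<delta> \<omega>}"
      unfolding sup_iff rat by blast
    moreover have "1 - \<delta> \<le> prob {\<omega> \<in> space P. \<forall>i. \<bar>?e \<omega> (r i) - c (r i)\<bar> \<le> deviation_bound K \<delta> \<omega>}"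
    proof (rule prob_ge_of_all_finite_subfamilies)
      have e_meas[measurable]: "(\<lambda>\<omega>. ?e \<omega> x) \<in> borel_measurable P" for x
        unfolding empirical_cdf_def
        by (rule measurable_compose_countable[where g = "T K"]) measurable
      show meas: "Measurable.pred P (\<lambda>\<omega>. \<bar>?e \<omega> (r i) - c (r i)\<bar> \<le> deviation_bound K \<delta> \<omega>)" for i
        by measurable
      fix n
      \<comment> \<open>The event \<open>G\<close> changes with \<open>n\<close>, so no single good
        event is available; only its probability is passed on, to the measurable event that contains
        it.\<close>
      have "\<exists>G\<in>events. 1 - \<delta> \<le> prob G \<and>
          (\<forall>\<omega>\<in>G. \<forall>x\<in>r ` {..n}. \<bar>?e \<omega> x - c x\<bar> \<le> deviation_bound K \<delta> \<omega>)"
        unfolding c_def by (rule finite_family_deviation) (use assms True in auto)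
      then obtain G where G: "G \<in> events" "1 - \<delta> \<le> prob G"
          "\<forall>\<omega>\<in>G. \<forall>x\<in>r ` {..n}. \<bar>?e \<omega> x - c x\<bar> \<le> deviation_bound K \<delta> \<omega>"
        by blast
      have "prob G \<le> prob {\<omega> \<in> space P. \<forall>i\<in>{..n}. \<bar>?e \<omega> (r i) - c (r i)\<bar> \<le> deviation_bound K \<delta> \<omega>}"
        using G sets.sets_into_space[OF G(1)] by (intro finite_measure_mono) (auto, measurable)
      then show "1 - \<delta> \<le> prob {\<omega> \<in> space P. \<forall>i\<in>{..n}. \<bar>?e \<omega> (r i) - c (r i)\<bar> \<le> deviation_bound K \<delta> \<omega>}"
        using G(2) by linarith
    qed
    ultimately show ?thesis by simp
  qed
  then show ?thesis unfolding deviation_bound_def Let_def cdf .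
qed

end
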